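(* Let $\Omega\subseteq\mathbb{R}^n$ be open. Integration, $u\mapsto\big(v\mapsto\int_\Omega u(y)v(y)\,dy\big)$, defines a $\widetilde{\mathbb{C}}$-linear continuous embedding (injective continuous map) of (i) $\mathcal{G}(\Omega)$ into $\mathcal{L}(\mathcal{G}_c(\Omega),\widetilde{\mathbb{C}})$, (ii) $\mathcal{G}_c(\Omega)$ into $\mathcal{L}(\mathcal{G}(\Omega),\widetilde{\mathbb{C}})$. Restriction (of a functional $T$ to the smaller space) defines a $\widetilde{\mathbb{C}}$-linear continuous embedding of (iii) $\mathcal{L}(\mathcal{G}(\Omega),\widetilde{\mathbb{C}})$ into $\mathcal{L}(\mathcal{G}_c(\Omega),\widetilde{\mathbb{C}})$, (iv) $\mathcal{L}(\mathcal{G}^\infty(\Omega),\widetilde{\mathbb{C}})$ into $\mathcal{L}(\mathcal{G}_c^\infty(\Omega),\widetilde{\mathbb{C}})$.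
   Context: All nets are indexed by $\varepsilon\in(0,1]$ and $O$-estimates are for $\varepsilon\to 0$. Generalized numbers: $\widetilde{\mathbb{C}}$ is the ring of nets $(z_\varepsilon)_\varepsilon\in\mathbb{C}^{(0,1]}$ with $|z_\varepsilon|=O(\varepsilon^{-N})$ for some $N\in\mathbb{N}$, modulo the nets with $|z_\varepsilon|=O(\varepsilon^q)$ for all $q\in\mathbb{N}$. For $z=[(z_\varepsilon)_\varepsilon]$, $\mathrm{v}(z)=\sup\{b\in\mathbb{R}: |z_\varepsilon|=O(\varepsilon^b)\}$ and $|z|_{\mathrm e}=e^{-\mathrm{v}(z)}$; $\widetilde{\mathbb{C}}$ carries the topology of the ultrametric $|z-z'|_{\mathrm e}$. Algebras: $\mathcal{G}(\Omega)=\mathcal{E}_M(\Omega)/\mathcal{N}(\Omega)$, where $\mathcal{E}_M(\Omega)$ is the set of nets $(u_\varepsilon)_\varepsilon\in C^\infty(\Omega)^{(0,1]}$ such that for all compact $K\subset\Omega$ and $\alpha\in\mathbb{N}^n$ there is $N\in\mathbb{N}$ with $\sup_{x\in K}|\partial^\alpha u_\varepsilon(x)|=O(\varepsilon^{-N})$, and $\mathcal{N}(\Omega)$ is the set of nets such that for all $K,\alpha$ and all $q\in\mathbb{N}$, $\sup_{x\in K}|\partial^\alpha u_\varepsilon(x)|=O(\varepsilon^{q})$. $\mathcal{G}^\infty(\Omega)=\mathcal{E}_M^\infty(\Omega)/\mathcal{N}(\Omega)$, where $\mathcal{E}_M^\infty(\Omega)$ is the set of nets such that for all compact $K\subset\Omega$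 there is $N\in\mathbb{N}$ such that for all $\alpha\in\mathbb{N}^n$, $\sup_{x\in K}|\partial^\alpha u_\varepsilon(x)|=O(\varepsilon^{-N})$. The support of $u\in\mathcal{G}(\Omega)$ is the complement in $\Omega$ of the largest open set on which $u$ restricts to $0$; $\mathcal{G}_c(\Omega)$, $\mathcal{G}_c^\infty(\Omega)$ are the sets of compactly supported elements of $\mathcal{G}(\Omega)$, $\mathcal{G}^\infty(\Omega)$; $\mathcal{G}_K(\Omega)$, $\mathcal{G}^\infty_K(\Omega)$ are the sets of elements of $\mathcal{G}(\Omega)$, $\mathcal{G}^\infty(\Omega)$ with support contained in the compact set $K\subset\Omega$. For $w\in\mathcal{G}_c(\Omega)$, $\int_\Omega w(y)\,dy:=[(\int_K w_\varepsilon(y)\,dy)_\varepsilon]\in\widetilde{\mathbb{C}}$, $K\subset\Omega$ any compact set containing $\mathrm{supp}\,w$ in its interior. Topologies: an ultra-pseudo-seminorm on a $\widetilde{\mathbb{C}}$-module $\mathcal{M}$ is a map $\mathcal{P}:\mathcal{M}\to[0,\infty)$ with $\mathcal{P}(0)=0$, $\mathcal{P}(\lambda u)\le|\lambda|_{\mathrm e}\mathcal{P}(u)$ for $\lambda\in\widetilde{\mathbb{C}}$, equality holding if $\lambda=[(c\varepsilon^a)_\varepsilon]$ with $c\in\mathbb{C}\setminus\{0\}$, $a\in\mathbb{R}$, and $\mathcal{P}(u+v)\le\max\{\mathcal{P}(u),\mathcal{P}(v)\}$. Locally convex $\widetilde{\mathbb{C}}$-linear topologies are those determined by families of ultra-pseudo-seminorms.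 $\mathcal{G}(\Omega)$ carries the topology of the family $\mathcal{P}_{K,j}(u)=\exp(-\sup\{b\in\mathbb{R}:\sup_{x\in K,|\alpha|\le j}|\partial^\alpha u_\varepsilon(x)|=O(\varepsilon^b)\})$, $K\subset\Omega$ compact, $j\in\mathbb{N}$. $\mathcal{G}^\infty(\Omega)$ carries the topology of the family $\mathcal{P}_{\mathcal{G}^\infty(K)}(u)=\exp(-\sup\{b\in\mathbb{R}:\forall\alpha\in\mathbb{N}^n\ \sup_{x\in K}|\partial^\alpha u_\varepsilon(x)|=O(\varepsilon^b)\})$, $K\subset\Omega$ compact. For $K\subset\Omega$ compact and any compact $K'\subset\Omega$ with $K\subseteq\mathrm{int}(K')$, $\mathcal{G}_K(\Omega)$ carries the topology of $\mathcal{P}_{\mathcal{G}_K(\Omega),j}(u):=\mathcal{P}_{K',j}(u)$, $j\in\mathbb{N}$, and $\mathcal{G}_K^\infty(\Omega)$ that of $\mathcal{P}_{\mathcal{G}_K^\infty(\Omega)}(u):=\mathcal{P}_{\mathcal{G}^\infty(K')}(u)$ (the values do not depend on $K'$). For an exhausting sequence $(K_n)_n$ of compact subsets of $\Omega$, $\mathcal{G}_c(\Omega)=\bigcup_n\mathcal{G}_{K_n}(\Omega)$ and $\mathcal{G}_c^\infty(\Omega)=\bigcup_n\mathcal{G}^\infty_{K_n}(\Omega)$ carry the strict inductive limit topologies, i.e. the finest locally convex $\widetilde{\mathbb{C}}$-linear topologies making all inclusions of the steps continuous. $\mathcal{L}(\mathcal{M},\widetilde{\mathbb{C}})$ is the space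 of continuous $\widetilde{\mathbb{C}}$-linear functionals on $\mathcal{M}$; it carries the topology $\beta_b$ of uniform convergence on bounded subsets, determined by the ultra-pseudo-seminorms $T\mapsto\sup_{u\in B}|Tu|_{\mathrm e}$, $B\subseteq\mathcal{M}$ bounded. A set $B\subseteq\mathcal{M}$ is bounded if every continuous ultra-pseudo-seminorm of $\mathcal{M}$ is bounded on $B$. *)

theory Defs
  imports "HOL-Analysis.Analysis" "HOL-Algebra.Module" "HOL-Library.Landau_Symbols"
begin

section \<open>Generalized numbers\<close>

text \<open>Nets are functions on the reals of which only the values at \<open>\<epsilon> \<in> (0,1]\<close> matter: all
  estimates below are for \<open>\<epsilon> \<rightarrow> 0\<close>, and the equivalence relations ignore the other values.\<close>

abbreviation order_O :: "(real \<Rightarrow> real) \<Rightarrow> real \<Rightarrow> bool" where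
  "order_O f b \<equiv> f \<in> O[at_right 0](\<lambda>\<epsilon>. \<epsilon> powr b)"

definition moderate :: "(real \<Rightarrow> complex) \<Rightarrow> bool" where
  "moderate z \<longleftrightarrow> (\<exists>N::nat. order_O (\<lambda>\<epsilon>. cmod (z \<epsilon>)) (- real N))"

definition negligible :: "(real \<Rightarrow> complex) \<Rightarrow> bool" where
  "negligible z \<longleftrightarrow> (\<forall>q::nat. order_O (\<lambda>\<epsilon>. cmod (z \<epsilon>)) (real q))"

definition gc_rel :: "(real \<Rightarrow> complex) \<Rightarrow> (real \<Rightarrow> complex) \<Rightarrow> bool" where
  "gc_rel z w \<longleftrightarrow> moderate z \<and> moderate w \<and> negligible (\<lambda>\<epsilon>. z \<epsilon> - w \<epsilon>)"

lemma powr_bigo_mono: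
  assumes "a \<le> b"
  shows "(\<lambda>\<epsilon>::real. \<epsilon> powr b) \<in> O[at_right 0](\<lambda>\<epsilon>. \<epsilon> powr a)"
proof (rule bigoI[of _ 1])
  have "eventually (\<lambda>\<epsilon>::real. \<epsilon> \<in> {0<..<1}) (at_right 0)"
    by (rule eventually_at_right_real) simp
  then show "\<forall>\<^sub>F \<epsilon> in at_right 0. norm (\<epsilon> powr b :: real) \<le> 1 * norm (\<epsilon> powr a)"
    by eventually_elim (use assms in \<open>auto intro: powr_mono'\<close>)
qed

lemma order_O_mono: "order_O f b \<Longrightarrow> a \<le> b \<Longrightarrow> order_O f a"
  using landau_o.big_trans powr_bigo_mono by blast

lemma order_O_add:
  "order_O (\<lambda>\<epsilon>. cmod (z \<epsilon>)) b \<Longrightarrow> order_O (\<lambda>\<epsilon>. cmod (w \<epsilon>)) b \<Longrightarrow>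
   order_O (\<lambda>\<epsilon>. cmod (z \<epsilon> + w \<epsilon>)) b"
  by (rule landau_o.big_trans[of _ _ "\<lambda>\<epsilon>. cmod (z \<epsilon>) + cmod (w \<epsilon>)"],
      rule bigoI[of _ 1]) (auto intro: sum_in_bigo always_eventually norm_triangle_ineq)

lemma order_O_mult:
  assumes "order_O (\<lambda>\<epsilon>. cmod (z \<epsilon>)) a" "order_O (\<lambda>\<epsilon>. cmod (w \<epsilon>)) b"
  shows "order_O (\<lambda>\<epsilon>. cmod (z \<epsilon> * w \<epsilon>)) (a + b)"
  using landau_o.big.mult[OF assms] by (simp add: norm_mult powr_add)

lemma moderate_add: "moderate z \<Longrightarrow> moderate w \<Longrightarrow> moderate (\<lambda>\<epsilon>. z \<epsilon> + w \<epsilon>)"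
proof -
  assume "moderate z" "moderate w"
  then obtain N M :: nat where "order_O (\<lambda>\<epsilon>. cmod (z \<epsilon>)) (- real N)"
    "order_O (\<lambda>\<epsilon>. cmod (w \<epsilon>)) (- real M)" unfolding moderate_def by blast
  then have "order_O (\<lambda>\<epsilon>. cmod (z \<epsilon>)) (- real (max N M))"
    "order_O (\<lambda>\<epsilon>. cmod (w \<epsilon>)) (- real (max N M))"
    by (auto elim!: order_O_mono)
  then show ?thesis unfolding moderate_def using order_O_add by blast
qed

lemma moderate_mult: "moderate z \<Longrightarrow> moderate w \<Longrightarrow> moderate (\<lambda>\<epsilon>. z \<epsilon> * w \<epsilon>)"
proof -
  assume "moderate z" "moderate w"
  then obtain N M :: nat where "order_O (\<lambda>\<epsilon>. cmod (z \<epsilon>)) (- real N)"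
    "order_O (\<lambda>\<epsilon>. cmod (w \<epsilon>)) (- real M)" unfolding moderate_def by blast
  from order_O_mult[OF this] have "order_O (\<lambda>\<epsilon>. cmod (z \<epsilon> * w \<epsilon>)) (- real (N + M))"
    by (simp add: algebra_simps)
  then show ?thesis unfolding moderate_def by blast
qed

lemma moderate_uminus: "moderate z \<Longrightarrow> moderate (\<lambda>\<epsilon>. - z \<epsilon>)"
  by (simp add: moderate_def)

lemma moderate_const: "moderate (\<lambda>_. c)"
  unfolding moderate_def
  by (rule exI[of _ 0]) (auto intro!: bigoI[of _ "cmod c"] eventually_mono[OF eventually_at_right_less])

lemma negligible_zero: "negligible (\<lambda>_. 0)"
  by (simp add: negligible_def)

lemma negligible_add: "negligible z \<Longrightarrow> negligible w \<Longrightarrow> negligible (\<lambda>\<epsilon>. z \<epsilon> + w \<epsilon>)"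
  unfolding negligible_def using order_O_add by blast

lemma negligible_uminus: "negligible z \<Longrightarrow> negligible (\<lambda>\<epsilon>. - z \<epsilon>)"
  by (simp add: negligible_def)

lemma negligible_mult: "negligible z \<Longrightarrow> moderate w \<Longrightarrow> negligible (\<lambda>\<epsilon>. z \<epsilon> * w \<epsilon>)"
  unfolding negligible_def
proof
  fix q :: nat
  assume z: "\<forall>q::nat. order_O (\<lambda>\<epsilon>. cmod (z \<epsilon>)) (real q)" and "moderate w"
  then obtain N :: nat where "order_O (\<lambda>\<epsilon>. cmod (w \<epsilon>)) (- real N)"
    unfolding moderate_def by blast
  from order_O_mult[OF z[rule_format, of "q + N"] this]
  show "order_O (\<lambda>\<epsilon>. cmod (z \<epsilon> * w \<epsilon>)) (real q)" by simp
qed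

quotient_type gcomplex = "real \<Rightarrow> complex" / partial: gc_rel
proof (rule part_equivpI)
  show "\<exists>x. gc_rel x x"
    using moderate_const[of 0] negligible_zero by (auto simp: gc_rel_def)
  show "symp gc_rel"
    by (rule sympI) (auto simp: gc_rel_def dest: negligible_uminus)
  show "transp gc_rel"
    by (rule transpI) (auto simp: gc_rel_def dest: negligible_add)
qed

instantiation gcomplex :: comm_ring_1
begin

lift_definition zero_gcomplex :: gcomplex is "\<lambda>_. 0"
  by (auto simp: gc_rel_def moderate_const negligible_zero)

lift_definition one_gcomplex :: gcomplex is "\<lambda>_. 1"
  by (auto simp: gc_rel_def moderate_const negligible_zero)

lift_definition plus_gcomplex :: "gcomplex \<Rightarrow> gcomplex \<Rightarrow> gcomplex" is "\<lambda>z w \<epsilon>. z \<epsilon> + w \<epsilon>"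
proof -
  fix z z' w w' assume "gc_rel z z'" "gc_rel w w'"
  then show "gc_rel (\<lambda>\<epsilon>. z \<epsilon> + w \<epsilon>) (\<lambda>\<epsilon>. z' \<epsilon> + w' \<epsilon>)"
    unfolding gc_rel_def
    using negligible_add[of "\<lambda>\<epsilon>. z \<epsilon> - z' \<epsilon>" "\<lambda>\<epsilon>. w \<epsilon> - w' \<epsilon>"]
    by (auto simp: moderate_add algebra_simps)
qed

lift_definition uminus_gcomplex :: "gcomplex \<Rightarrow> gcomplex" is "\<lambda>z \<epsilon>. - z \<epsilon>"
proof -
  fix z z' assume "gc_rel z z'"
  then show "gc_rel (\<lambda>\<epsilon>. - z \<epsilon>) (\<lambda>\<epsilon>. - z' \<epsilon>)"
    unfolding gc_rel_def using negligible_uminus[of "\<lambda>\<epsilon>. z \<epsilon> - z' \<epsilon>"]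
    by (auto simp: moderate_uminus algebra_simps)
qed

lift_definition minus_gcomplex :: "gcomplex \<Rightarrow> gcomplex \<Rightarrow> gcomplex" is "\<lambda>z w \<epsilon>. z \<epsilon> - w \<epsilon>"
proof -
  fix z z' w w' assume *: "gc_rel z z'" "gc_rel w w'"
  have "moderate (\<lambda>\<epsilon>. z \<epsilon> - w \<epsilon>)" "moderate (\<lambda>\<epsilon>. z' \<epsilon> - w' \<epsilon>)"
    using * moderate_add[OF _ moderate_uminus, of z w] moderate_add[OF _ moderate_uminus, of z' w']
    by (auto simp: gc_rel_def)
  moreover have "negligible (\<lambda>\<epsilon>. (z \<epsilon> - w \<epsilon>) - (z' \<epsilon> - w' \<epsilon>))"
    using * negligible_add[OF _ negligible_uminus, of "\<lambda>\<epsilon>. z \<epsilon> - z' \<epsilon>" "\<lambda>\<epsilon>. w \<epsilon> - w' \<epsilon>"]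
    by (auto simp: gc_rel_def algebra_simps)
  ultimately show "gc_rel (\<lambda>\<epsilon>. z \<epsilon> - w \<epsilon>) (\<lambda>\<epsilon>. z' \<epsilon> - w' \<epsilon>)"
    by (simp add: gc_rel_def)
qed

lift_definition times_gcomplex :: "gcomplex \<Rightarrow> gcomplex \<Rightarrow> gcomplex" is "\<lambda>z w \<epsilon>. z \<epsilon> * w \<epsilon>"
proof -
  fix z z' w w' assume *: "gc_rel z z'" "gc_rel w w'"
  have "negligible (\<lambda>\<epsilon>. (z \<epsilon> - z' \<epsilon>) * w \<epsilon> + (w \<epsilon> - w' \<epsilon>) * z' \<epsilon>)"
    using * by (intro negligible_add negligible_mult) (auto simp: gc_rel_def)
  then show "gc_rel (\<lambda>\<epsilon>. z \<epsilon> * w \<epsilon>) (\<lambda>\<epsilon>. z' \<epsilon> * w' \<epsilon>)"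
    using * by (auto simp: gc_rel_def moderate_mult algebra_simps)
qed

lemma not_negligible_one: "\<not> negligible (\<lambda>_. 1)"
proof
  assume "negligible (\<lambda>_. 1)"
  then have "order_O (\<lambda>_. cmod 1) (real 1)" unfolding negligible_def by blast
  then obtain c where c: "c > 0" "\<forall>\<^sub>F \<epsilon> in at_right 0. norm (cmod 1) \<le> c * norm (\<epsilon> powr real 1 :: real)"
    by (elim landau_o.bigE)
  have "eventually (\<lambda>\<epsilon>::real. \<epsilon> \<in> {0<..<1/c}) (at_right 0)"
    by (rule eventually_at_right_real) (use c in simp)
  with c(2) have "\<forall>\<^sub>F \<epsilon>::real in at_right 0. False"
    by eventually_elim (use c(1) in \<open>auto simp: field_simps\<close>)
  then show False by (simp add: trivial_limit_at_right_real)
qed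

instance
proof
  fix a b c :: gcomplex
  note [simp] = gc_rel_def moderate_add moderate_mult moderate_uminus moderate_const
    negligible_zero algebra_simps
  show "a * b * c = a * (b * c)" by transfer (auto)
  show "a * b = b * a" by transfer (auto)
  show "1 * a = a" by transfer (auto)
  show "a + b + c = a + (b + c)" by transfer (auto)
  show "a + b = b + a" by transfer (auto)
  show "0 + a = a" by transfer (auto)
  show "- a + a = 0" by transfer (auto)
  show "a - b = a + - b"
    by transfer (use moderate_add[OF _ moderate_uminus] in auto)
  show "(a + b) * c = a * c + b * c" by transfer (auto)
  show "(0::gcomplex) \<noteq> 1"
    by transfer (use not_negligible_one negligible_uminus[of "\<lambda>_. - 1"] in auto)
qed

end

definition gval :: "gcomplex \<Rightarrow> ereal" where
  "gval z = (SUP b\<in>{b. order_O (\<lambda>\<epsilon>. cmod (rep_gcomplex z \<epsilon>)) b}. ereal b)"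

text \<open>\<open>e\<^sup>-\<^sup>v\<close> with \<open>e\<^sup>-\<^sup>\<infinity> = 0\<close>; the value \<open>v = -\<infinity>\<close> does not occur for moderate nets.\<close>

definition exp_neg :: "ereal \<Rightarrow> real" where
  "exp_neg v = (if v = \<infinity> then 0 else exp (- real_of_ereal v))"

definition gnorm :: "gcomplex \<Rightarrow> real" where
  "gnorm z = exp_neg (gval z)"

lemma rep_gcomplex_moderate: "moderate (rep_gcomplex z)"
  using Quotient3_rep_reflp[OF Quotient3_gcomplex, of z] by (simp add: gc_rel_def)

lemma abs_rep_gcomplex: "abs_gcomplex (rep_gcomplex z) = z"
  by (rule Quotient3_abs_rep[OF Quotient3_gcomplex])

lemma rep_abs_gcomplex: "moderate z \<Longrightarrow> gc_rel (rep_gcomplex (abs_gcomplex z)) z"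
  using Quotient3_rep_abs[OF Quotient3_gcomplex, of z] negligible_zero by (simp add: gc_rel_def)

lemma order_O_cong_gc_rel:
  assumes "gc_rel z w"
  shows "order_O (\<lambda>\<epsilon>. cmod (z \<epsilon>)) b \<longleftrightarrow> order_O (\<lambda>\<epsilon>. cmod (w \<epsilon>)) b"
proof -
  have *: "order_O (\<lambda>\<epsilon>. cmod (z \<epsilon>)) b" if "negligible (\<lambda>\<epsilon>. z \<epsilon> - w \<epsilon>)"
    "order_O (\<lambda>\<epsilon>. cmod (w \<epsilon>)) b" for z w
  proof -
    obtain q :: nat where "b \<le> real q" using real_arch_simple by blast
    then have "order_O (\<lambda>\<epsilon>. cmod (z \<epsilon> - w \<epsilon>)) b"
      using that(1) order_O_mono unfolding negligible_def by blast
    from order_O_add[OF this that(2)] show ?thesis by simp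
  qed
  show ?thesis using *[of z w] *[of w z] assms negligible_uminus[of "\<lambda>\<epsilon>. z \<epsilon> - w \<epsilon>"]
    by (auto simp: gc_rel_def)
qed

lemma gval_abs:
  "moderate z \<Longrightarrow> gval (abs_gcomplex z) = (SUP b\<in>{b. order_O (\<lambda>\<epsilon>. cmod (z \<epsilon>)) b}. ereal b)"
  unfolding gval_def using order_O_cong_gc_rel[OF rep_abs_gcomplex] by simp

lemma gval_not_MInf: "gval z \<noteq> -\<infinity>"
proof -
  obtain N :: nat where "order_O (\<lambda>\<epsilon>. cmod (rep_gcomplex z \<epsilon>)) (- real N)"
    using rep_gcomplex_moderate unfolding moderate_def by blast
  then have "ereal (- real N) \<le> gval z" unfolding gval_def by (intro SUP_upper) simp
  then show ?thesis by auto
qed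

lemma gval_less: "ereal c < gval z \<Longrightarrow> order_O (\<lambda>\<epsilon>. cmod (rep_gcomplex z \<epsilon>)) c"
  unfolding gval_def less_SUP_iff by (auto elim: order_O_mono)

lemma gval_eq_PInf_iff: "gval z = \<infinity> \<longleftrightarrow> z = 0"
proof
  assume "gval z = \<infinity>"
  then have "negligible (rep_gcomplex z)" unfolding negligible_def using gval_less by simp
  then have "gc_rel (rep_gcomplex z) (\<lambda>_. 0)"
    using rep_gcomplex_moderate moderate_const by (simp add: gc_rel_def)
  then have "abs_gcomplex (rep_gcomplex z) = abs_gcomplex (\<lambda>_. 0)"
    by (rule Quotient3_rel_abs[OF Quotient3_gcomplex])
  then show "z = 0" by (simp add: abs_rep_gcomplex zero_gcomplex.abs_eq)
next
  assume "z = 0"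
  then have "gval z = (SUP b::real. ereal b)"
    using gval_abs[OF moderate_const[of 0]] by (simp add: zero_gcomplex_def)
  also have "\<dots> = \<infinity>"
    by (rule SUP_PInfty) (auto intro: exI[of _ "real n" for n])
  finally show "gval z = \<infinity>" .
qed

lemma plus_gcomplex_rep: "z + w = abs_gcomplex (\<lambda>\<epsilon>. rep_gcomplex z \<epsilon> + rep_gcomplex w \<epsilon>)"
  by (simp add: plus_gcomplex_def)

lemma uminus_gcomplex_rep: "- z = abs_gcomplex (\<lambda>\<epsilon>. - rep_gcomplex z \<epsilon>)"
  by (simp add: uminus_gcomplex_def)

lemma gval_uminus: "gval (- z) = gval z"
  unfolding uminus_gcomplex_rep gval_abs[OF moderate_uminus[OF rep_gcomplex_moderate]]
  by (simp add: gval_def)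

lemma gval_add: "min (gval z) (gval w) \<le> gval (z + w)"
proof (rule ereal_le_real)
  fix x assume le: "gval (z + w) \<le> ereal x"
  show "min (gval z) (gval w) \<le> ereal x"
  proof (rule dense_ge)
    fix y assume y: "ereal x < y"
    show "min (gval z) (gval w) \<le> y"
    proof (rule ccontr)
      assume "\<not> ?thesis"
      then have less: "y < gval z" "y < gval w" by (auto simp: min_le_iff_disj not_le)
      then obtain c where c: "y = ereal c" using y by (cases y) auto
      have "order_O (\<lambda>\<epsilon>. cmod (rep_gcomplex z \<epsilon> + rep_gcomplex w \<epsilon>)) c"
        using less by (intro order_O_add gval_less) (auto simp: c)
      then have "ereal c \<le> gval (z + w)"
        unfolding plus_gcomplex_rep
          gval_abs[OF moderate_add[OF rep_gcomplex_moderate rep_gcomplex_moderate]]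
        by (intro SUP_upper) simp
      then show False using le y c by (metis not_le order_trans)
    qed
  qed
qed

lemma exp_neg_antimono: "u \<noteq> -\<infinity> \<Longrightarrow> u \<le> v \<Longrightarrow> exp_neg v \<le> exp_neg u"
  by (cases u; cases v) (auto simp: exp_neg_def)

lemma gnorm_nonneg: "0 \<le> gnorm z"
  by (simp add: gnorm_def exp_neg_def)

lemma gnorm_eq_0_iff: "gnorm z = 0 \<longleftrightarrow> z = 0"
  using gval_eq_PInf_iff by (simp add: gnorm_def exp_neg_def)

lemma gnorm_uminus: "gnorm (- z) = gnorm z"
  by (simp add: gnorm_def gval_uminus)

lemma gnorm_add: "gnorm (z + w) \<le> max (gnorm z) (gnorm w)"
proof -
  have "gval z \<le> gval (z + w) \<or> gval w \<le> gval (z + w)"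
    using gval_add[of z w] by (auto simp: min_le_iff_disj)
  then show ?thesis
    unfolding gnorm_def using exp_neg_antimono gval_not_MInf le_max_iff_disj by blast
qed

instantiation gcomplex :: metric_space
begin

definition dist_gcomplex :: "gcomplex \<Rightarrow> gcomplex \<Rightarrow> real" where
  "dist_gcomplex z w = gnorm (z - w)"

definition uniformity_gcomplex :: "(gcomplex \<times> gcomplex) filter" where
  "uniformity_gcomplex = (INF e\<in>{0<..}. principal {(x, y). dist x y < e})"

definition open_gcomplex :: "gcomplex set \<Rightarrow> bool" where
  "open_gcomplex U \<longleftrightarrow> (\<forall>x\<in>U. eventually (\<lambda>(x', y). x' = x \<longrightarrow> y \<in> U) uniformity)"

instance
proof
  fix x y z :: gcomplex
  show "dist x y = 0 \<longleftrightarrow> x = y"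
    by (simp add: dist_gcomplex_def gnorm_eq_0_iff)
  have "gnorm ((x - z) + - (y - z)) \<le> max (gnorm (x - z)) (gnorm (- (y - z)))"
    by (rule gnorm_add)
  then show "dist x y \<le> dist x z + dist y z"
    using gnorm_nonneg[of "x - z"] gnorm_nonneg[of "y - z"]
    unfolding dist_gcomplex_def gnorm_uminus by (simp add: algebra_simps)
qed (simp_all add: uniformity_gcomplex_def open_gcomplex_def)

end


section \<open>Locally convex modules over the generalized numbers\<close>

text \<open>A module over \<^typ>\<open>gcomplex\<close> in the record format of HOL-Algebra, together with a family of
  ultra-pseudo-seminorms that determines its topology. The fields \<open>mult\<close> and \<open>one\<close> inherited from
  the ring record play no role for the module structure.\<close>

record 'a lc_module = "(gcomplex, 'a) module" +
  seminorms :: "('a \<Rightarrow> real) set"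

definition ultra_pseudo_seminorm :: "(gcomplex, 'a, 'm) module_scheme \<Rightarrow> ('a \<Rightarrow> real) \<Rightarrow> bool" where
  "ultra_pseudo_seminorm M P \<longleftrightarrow>
     (\<forall>u\<in>carrier M. 0 \<le> P u) \<and>
     P \<zero>\<^bsub>M\<^esub> = 0 \<and>
     (\<forall>z. \<forall>u\<in>carrier M. P (z \<odot>\<^bsub>M\<^esub> u) \<le> gnorm z * P u) \<and>
     (\<forall>c a. \<forall>u\<in>carrier M. c \<noteq> 0 \<longrightarrow>
        (let z = abs_gcomplex (\<lambda>\<epsilon>. c * complex_of_real (\<epsilon> powr a))
         in P (z \<odot>\<^bsub>M\<^esub> u) = gnorm z * P u)) \<and>
     (\<forall>u\<in>carrier M. \<forall>v\<in>carrier M. P (u \<oplus>\<^bsub>M\<^esub> v) \<le> max (P u) (P v))"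

definition seminorm_topology ::
  "(gcomplex, 'a, 'm) module_scheme \<Rightarrow> ('a \<Rightarrow> real) set \<Rightarrow> 'a topology" where
  "seminorm_topology M F = topology_generated_by
     (insert (carrier M)
        {{v \<in> carrier M. P (v \<ominus>\<^bsub>M\<^esub> u) < r} | P u r. P \<in> F \<and> u \<in> carrier M \<and> 0 < r})"

definition lc_topology :: "'a lc_module \<Rightarrow> 'a topology" where
  "lc_topology M = seminorm_topology M (seminorms M)"

text \<open>The finest locally convex topology on \<open>M\<close> making the inclusions of all steps continuous is
  the supremum of all such topologies, so it is determined by the union of all families of
  ultra-pseudo-seminorms that determine such a topology.\<close>

definition ind_lim_seminorms ::
  "(gcomplex, 'a, 'm) module_scheme \<Rightarrow> 'a lc_module set \<Rightarrow> ('a \<Rightarrow> real) set" where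
  "ind_lim_seminorms M \<S> = \<Union> {F. (\<forall>P\<in>F. ultra_pseudo_seminorm M P) \<and>
     (\<forall>S\<in>\<S>. continuous_map (lc_topology S) (seminorm_topology M F) id)}"

lemma seminorm_topology_mono:
  assumes "F \<subseteq> F'"
  shows "openin (seminorm_topology M F) U \<Longrightarrow> openin (seminorm_topology M F') U"
  unfolding seminorm_topology_def openin_topology_generated_by_iff
proof (induction rule: generate_topology_on.induct)
  case (Basis s)
  then show ?case using assms by (intro generate_topology_on.Basis) auto
qed (auto intro: generate_topology_on.intros)

lemma topspace_seminorm_topology: "topspace (seminorm_topology M F) = carrier M"
  by (auto simp: seminorm_topology_def)

lemma ind_lim_seminorms_ups:
  "P \<in> ind_lim_seminorms M \<S> \<Longrightarrow> ultra_pseudo_seminorm M P"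
  by (auto simp: ind_lim_seminorms_def)

lemma continuous_id_ind_lim:
  assumes "S \<in> \<S>" "carrier S \<subseteq> carrier M"
  shows "continuous_map (lc_topology S) (seminorm_topology M (ind_lim_seminorms M \<S>)) id"
  unfolding seminorm_topology_def[of M "ind_lim_seminorms M \<S>"]
proof (rule continuous_on_generated_topo)
  fix U assume U: "U \<in> insert (carrier M) {{v \<in> carrier M. P (v \<ominus>\<^bsub>M\<^esub> u) < r} | P u r.
      P \<in> ind_lim_seminorms M \<S> \<and> u \<in> carrier M \<and> 0 < r}"
  have top: "topspace (lc_topology S) = carrier S"
    by (simp add: lc_topology_def topspace_seminorm_topology)
  show "openin (lc_topology S) (id -` U \<inter> topspace (lc_topology S))"
  proof (cases "U = carrier M")
    case True
    then have "id -` U \<inter> topspace (lc_topology S) = topspace (lc_topology S)"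
      using assms(2) top by auto
    then show ?thesis by simp
  next
    case False
    with U obtain P u r where P: "P \<in> ind_lim_seminorms M \<S>" "u \<in> carrier M" "0 < r"
      "U = {v \<in> carrier M. P (v \<ominus>\<^bsub>M\<^esub> u) < r}" by auto
    then obtain F where F: "P \<in> F" "continuous_map (lc_topology S) (seminorm_topology M F) id"
      using assms(1) unfolding ind_lim_seminorms_def by blast
    have "openin (seminorm_topology M F) U"
      unfolding seminorm_topology_def using P F(1) by (intro topology_generated_by_Basis) blast
    from openin_continuous_map_preimage[OF F(2) this] show ?thesis
      by (simp add: vimage_def Int_def conj_commute)
  qed
next
  show "id ` topspace (lc_topology S) \<subseteq> \<Union> (insert (carrier M) {{v \<in> carrier M. P (v \<ominus>\<^bsub>M\<^esub> u) < r} | P u r.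
      P \<in> ind_lim_seminorms M \<S> \<and> u \<in> carrier M \<and> 0 < r})"
    using assms by (auto simp: lc_topology_def topspace_seminorm_topology)
qed

lemma ind_lim_finest:
  assumes "\<forall>P\<in>F. ultra_pseudo_seminorm M P"
    and "\<forall>S\<in>\<S>. continuous_map (lc_topology S) (seminorm_topology M F) id"
    and "openin (seminorm_topology M F) U"
  shows "openin (seminorm_topology M (ind_lim_seminorms M \<S>)) U"
  using assms seminorm_topology_mono[of F "ind_lim_seminorms M \<S>" M U]
  unfolding ind_lim_seminorms_def by blast

definition bounded_in :: "'a lc_module \<Rightarrow> 'a set \<Rightarrow> bool" where
  "bounded_in M B \<longleftrightarrow> B \<subseteq> carrier M \<and>
     (\<forall>P. ultra_pseudo_seminorm M P \<and> continuous_map (lc_topology M) euclideanreal P \<longrightarrow>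
          (\<exists>C. \<forall>u\<in>B. P u \<le> C))"

definition linear_functional :: "'a lc_module \<Rightarrow> ('a \<Rightarrow> gcomplex) \<Rightarrow> bool" where
  "linear_functional M T \<longleftrightarrow>
     (\<forall>u\<in>carrier M. \<forall>v\<in>carrier M. T (u \<oplus>\<^bsub>M\<^esub> v) = T u + T v) \<and>
     (\<forall>z. \<forall>u\<in>carrier M. T (z \<odot>\<^bsub>M\<^esub> u) = z * T u)"

text \<open>The suprema below are taken in \<open>[0,\<infinity>)\<close>; inserting \<open>0\<close> makes the supremum over the empty
  set equal to \<open>0\<close> and changes nothing otherwise.\<close>

abbreviation sup_nonneg :: "real set \<Rightarrow> real" where
  "sup_nonneg A \<equiv> Sup (insert 0 A)"

text \<open>Functionals are kept extensional, so that equality of elements of the dual is equality on the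
  carrier of \<open>M\<close>. The topology is that of uniform convergence on bounded subsets. A product of
  functionals is not needed; \<open>mult\<close> and \<open>one\<close> are placeholders.\<close>

definition dual :: "'a lc_module \<Rightarrow> ('a \<Rightarrow> gcomplex) lc_module" where
  "dual M = \<lparr>
     carrier = {T \<in> extensional (carrier M).
       linear_functional M T \<and> continuous_map (lc_topology M) euclidean T},
     monoid.mult = (\<lambda>_ _. undefined),
     one = undefined,
     zero = (\<lambda>u\<in>carrier M. 0),
     add = (\<lambda>S T. \<lambda>u\<in>carrier M. S u + T u),
     smult = (\<lambda>z T. \<lambda>u\<in>carrier M. z * T u),
     seminorms = {(\<lambda>T. sup_nonneg ((\<lambda>u. gnorm (T u)) ` B)) | B. bounded_in M B}\<rparr>"

text \<open>An embedding is an injective continuous map; it need not be a homeomorphism onto its image.\<close>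

definition continuous_linear_embedding ::
  "'a lc_module \<Rightarrow> 'b lc_module \<Rightarrow> ('a \<Rightarrow> 'b) \<Rightarrow> bool" where
  "continuous_linear_embedding M N f \<longleftrightarrow>
     f \<in> carrier M \<rightarrow> carrier N \<and>
     (\<forall>u\<in>carrier M. \<forall>v\<in>carrier M. f (u \<oplus>\<^bsub>M\<^esub> v) = f u \<oplus>\<^bsub>N\<^esub> f v) \<and>
     (\<forall>z. \<forall>u\<in>carrier M. f (z \<odot>\<^bsub>M\<^esub> u) = z \<odot>\<^bsub>N\<^esub> f u) \<and>
     inj_on f (carrier M) \<and>
     continuous_map (lc_topology M) (lc_topology N) f"


section \<open>Smooth functions\<close>

definition partial_derivative :: "'n \<Rightarrow> (real^'n \<Rightarrow> complex) \<Rightarrow> real^'n \<Rightarrow> complex" where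
  "partial_derivative i f x = vector_derivative (\<lambda>t. f (x + t *\<^sub>R axis i 1)) (at 0)"

text \<open>\<open>f\<close> is smooth iff all its iterated partial derivatives are differentiable.\<close>

definition smooth_on :: "(real^'n) set \<Rightarrow> (real^'n \<Rightarrow> complex) \<Rightarrow> bool" where
  "smooth_on \<Omega> f \<longleftrightarrow> (\<forall>is. foldr partial_derivative is f differentiable_on \<Omega>)"

text \<open>For a multi-index \<open>\<alpha>\<close>, direction \<open>i\<close> is differentiated \<open>\<alpha> i\<close> times; the order of
  differentiation is irrelevant for smooth functions.\<close>

definition multi_deriv :: "('n::finite \<Rightarrow> nat) \<Rightarrow> (real^'n \<Rightarrow> complex) \<Rightarrow> real^'n \<Rightarrow> complex" where
  "multi_deriv \<alpha> f = foldr partial_derivative (SOME is. \<forall>i. count_list is i = \<alpha> i) f"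

definition order_multiindex :: "('n::finite \<Rightarrow> nat) \<Rightarrow> nat" where
  "order_multiindex \<alpha> = (\<Sum>i\<in>UNIV. \<alpha> i)"


section \<open>Colombeau algebras\<close>

text \<open>Functions on \<open>\<Omega>\<close> are represented by total functions, whose values outside the open set \<open>\<Omega>\<close>
  are identified by the equivalence relation.\<close>

type_synonym 'n net = "real \<Rightarrow> real^'n \<Rightarrow> complex"

definition smooth_nets :: "(real^'n) set \<Rightarrow> 'n net set" where
  "smooth_nets \<Omega> = {u. \<forall>\<epsilon>\<in>{0<..1}. smooth_on \<Omega> (u \<epsilon>)}"

definition sup_deriv :: "(real^'n) set \<Rightarrow> ('n \<Rightarrow> nat) \<Rightarrow> 'n net \<Rightarrow> real \<Rightarrow> real" where
  "sup_deriv K \<alpha> u \<epsilon> = sup_nonneg ((\<lambda>x. cmod (multi_deriv \<alpha> (u \<epsilon>) x)) ` K)"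

definition E_M :: "(real^'n) set \<Rightarrow> 'n net set" where
  "E_M \<Omega> = {u \<in> smooth_nets \<Omega>. \<forall>K \<alpha>. compact K \<and> K \<subseteq> \<Omega> \<longrightarrow>
     (\<exists>N::nat. order_O (sup_deriv K \<alpha> u) (- real N))}"

definition E_M_inf :: "(real^'n) set \<Rightarrow> 'n net set" where
  "E_M_inf \<Omega> = {u \<in> smooth_nets \<Omega>. \<forall>K. compact K \<and> K \<subseteq> \<Omega> \<longrightarrow>
     (\<exists>N::nat. \<forall>\<alpha>. order_O (sup_deriv K \<alpha> u) (- real N))}"

definition N_ideal :: "(real^'n) set \<Rightarrow> 'n net set" where
  "N_ideal \<Omega> = {u \<in> smooth_nets \<Omega>. \<forall>K \<alpha>. compact K \<and> K \<subseteq> \<Omega> \<longrightarrow>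
     (\<forall>q::nat. order_O (sup_deriv K \<alpha> u) (real q))}"

type_synonym 'n gfun = "'n net set"

definition gclass :: "(real^'n) set \<Rightarrow> 'n net \<Rightarrow> 'n gfun" where
  "gclass \<Omega> u = {v \<in> E_M \<Omega>. (\<lambda>\<epsilon> x. u \<epsilon> x - v \<epsilon> x) \<in> N_ideal \<Omega>}"

definition representative :: "'n gfun \<Rightarrow> 'n net" where
  "representative U = (SOME u. u \<in> U)"

definition gmult :: "(real^'n) set \<Rightarrow> 'n gfun \<Rightarrow> 'n gfun \<Rightarrow> 'n gfun" where
  "gmult \<Omega> U V = gclass \<Omega> (\<lambda>\<epsilon> x. representative U \<epsilon> x * representative V \<epsilon> x)"

definition P_\<G> :: "(real^'n) set \<Rightarrow> nat \<Rightarrow> 'n gfun \<Rightarrow> real" where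
  "P_\<G> K j U = exp_neg (SUP b\<in>{b. order_O
     (\<lambda>\<epsilon>. sup_nonneg {cmod (multi_deriv \<alpha> (representative U \<epsilon>) x) | x \<alpha>. x \<in> K \<and> order_multiindex \<alpha> \<le> j}) b}.
     ereal b)"

definition P_\<G>_inf :: "(real^'n) set \<Rightarrow> 'n gfun \<Rightarrow> real" where
  "P_\<G>_inf K U = exp_neg (SUP b\<in>{b. \<forall>\<alpha>. order_O (sup_deriv K \<alpha> (representative U)) b}. ereal b)"

definition \<G> :: "(real^'n) set \<Rightarrow> 'n gfun lc_module" where
  "\<G> \<Omega> = \<lparr>
     carrier = gclass \<Omega> ` E_M \<Omega>,
     monoid.mult = gmult \<Omega>,
     one = gclass \<Omega> (\<lambda>_ _. 1),
     zero = gclass \<Omega> (\<lambda>_ _. 0),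
     add = (\<lambda>U V. gclass \<Omega> (\<lambda>\<epsilon> x. representative U \<epsilon> x + representative V \<epsilon> x)),
     smult = (\<lambda>z U. gclass \<Omega> (\<lambda>\<epsilon> x. rep_gcomplex z \<epsilon> * representative U \<epsilon> x)),
     seminorms = {P_\<G> K j | K j. compact K \<and> K \<subseteq> \<Omega>}\<rparr>"

text \<open>As \<^term>\<open>N_ideal \<Omega>\<close> is contained in \<^term>\<open>E_M_inf \<Omega>\<close>, the classes of elements of
  \<^term>\<open>E_M_inf \<Omega>\<close> in \<^term>\<open>\<G> \<Omega>\<close> are the elements of the quotient of \<^term>\<open>E_M_inf \<Omega>\<close>
  by \<^term>\<open>N_ideal \<Omega>\<close>.\<close>

definition \<G>_inf :: "(real^'n) set \<Rightarrow> 'n gfun lc_module" where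
  "\<G>_inf \<Omega> = (\<G> \<Omega>)\<lparr>
     carrier := gclass \<Omega> ` E_M_inf \<Omega>,
     seminorms := {P_\<G>_inf K | K. compact K \<and> K \<subseteq> \<Omega>}\<rparr>"

text \<open>The restriction of \<open>U\<close> to the open set \<open>V\<close> is \<open>0\<close> iff a representative of \<open>U\<close> lies in
  \<^term>\<open>N_ideal V\<close>; the union of all such \<open>V\<close> is the largest one.\<close>

definition gsupport :: "(real^'n) set \<Rightarrow> 'n gfun \<Rightarrow> (real^'n) set" where
  "gsupport \<Omega> U = \<Omega> - \<Union> {V. open V \<and> V \<subseteq> \<Omega> \<and> representative U \<in> N_ideal V}"

text \<open>The seminorms do not depend on the choice of the neighbourhood \<open>K'\<close> of \<open>K\<close>, so taking
  all \<open>K'\<close> amounts to fixing one of them.\<close>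

definition \<G>_on :: "(real^'n) set \<Rightarrow> (real^'n) set \<Rightarrow> 'n gfun lc_module" where
  "\<G>_on \<Omega> K = (\<G> \<Omega>)\<lparr>
     carrier := {U \<in> carrier (\<G> \<Omega>). gsupport \<Omega> U \<subseteq> K},
     seminorms := {P_\<G> K' j | K' j. compact K' \<and> K' \<subseteq> \<Omega> \<and> K \<subseteq> interior K'}\<rparr>"

definition \<G>_inf_on :: "(real^'n) set \<Rightarrow> (real^'n) set \<Rightarrow> 'n gfun lc_module" where
  "\<G>_inf_on \<Omega> K = (\<G>_inf \<Omega>)\<lparr>
     carrier := {U \<in> carrier (\<G>_inf \<Omega>). gsupport \<Omega> U \<subseteq> K},
     seminorms := {P_\<G>_inf K' | K'. compact K' \<and> K' \<subseteq> \<Omega> \<and> K \<subseteq> interior K'}\<rparr>"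

definition exhausting :: "(real^'n) set \<Rightarrow> (nat \<Rightarrow> (real^'n) set) \<Rightarrow> bool" where
  "exhausting \<Omega> K \<longleftrightarrow>
     (\<forall>n. compact (K n) \<and> K n \<subseteq> interior (K (Suc n))) \<and> (\<Union>n. K n) = \<Omega>"

lemma ex_exhausting:
  assumes "open \<Omega>"
  shows "\<exists>K. exhausting \<Omega> K"
proof -
  obtain C where C: "\<And>n. compact (C n)" "\<And>n. C n \<subseteq> \<Omega>" "\<And>n. C n \<subseteq> interior (C (Suc n))"
    "\<Union> (range C) = \<Omega>"
    using open_Union_compact_subsets[OF assms] by metis
  then show ?thesis unfolding exhausting_def by blast
qed

definition \<G>_c :: "(real^'n) set \<Rightarrow> (nat \<Rightarrow> (real^'n) set) \<Rightarrow> 'n gfun lc_module" where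
  "\<G>_c \<Omega> K = (let M = (\<G> \<Omega>)\<lparr>carrier := {U \<in> carrier (\<G> \<Omega>). compact (gsupport \<Omega> U)}\<rparr>
     in M\<lparr>seminorms := ind_lim_seminorms M (range (\<lambda>n. \<G>_on \<Omega> (K n)))\<rparr>)"

definition \<G>_inf_c :: "(real^'n) set \<Rightarrow> (nat \<Rightarrow> (real^'n) set) \<Rightarrow> 'n gfun lc_module" where
  "\<G>_inf_c \<Omega> K = (let M = (\<G>_inf \<Omega>)\<lparr>carrier := {U \<in> carrier (\<G>_inf \<Omega>). compact (gsupport \<Omega> U)}\<rparr>
     in M\<lparr>seminorms := ind_lim_seminorms M (range (\<lambda>n. \<G>_inf_on \<Omega> (K n)))\<rparr>)"

definition gintegral :: "(real^'n) set \<Rightarrow> 'n gfun \<Rightarrow> gcomplex" where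
  "gintegral \<Omega> W =
     (let K = (SOME K. compact K \<and> K \<subseteq> \<Omega> \<and> gsupport \<Omega> W \<subseteq> interior K)
      in abs_gcomplex (\<lambda>\<epsilon>. LINT y:K|lborel. representative W \<epsilon> y))"

end

theory Submission
  imports Defs "HOL-Computational_Algebra.Polynomial"
begin

text \<open>On representatives, \<open>|\<integral>\<^sub>L u v| \<le> vol(L) sup\<^sub>L |u| sup\<^sub>L |v|\<close>, which bounds the pairing by a product
  of zeroth order seminorms and gives the continuity of both integration maps. For the topology of uniform
  convergence on bounded sets one also needs that a bounded subset of \<open>\<G>\<^sub>c\<close> lies in one step of the
  inductive limit: otherwise weighted seminorms, taken over compact sets escaping to the boundary of
  \<open>\<Omega>\<close>, have a supremum that is a continuous ultra-pseudo-seminorm unbounded on the set.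

  The pairing is nondegenerate because testing \<open>u\<close> against \<open>\<kappa> \<cdot> cnj u\<close> with a cutoff \<open>\<kappa>\<close> makes
  \<open>\<integral> \<kappa> |u|\<^sup>2\<close> negligible; as the gradient of \<open>u\<close> is moderate, \<open>u\<close> cannot be large at a point without
  being large on a ball whose radius is a power of \<open>\<epsilon>\<close>, so the values of \<open>u\<close> are negligible, and
  interpolation between \<open>u\<close> and its second derivatives makes all its derivatives negligible.

  The restriction maps are injective since for a finite set of seminorms there is a cutoff \<open>\<kappa>\<close> for which
  \<open>\<kappa> u - u\<close> vanishes near the compact sets involved: compactly supported elements are dense.\<close>


section \<open>Smooth functions\<close>

text \<open>Every seminorm involved has the form \<open>exp (- sup S)\<close> with a downward closed
  set \<open>S\<close> of admissible orders. Two such sets are always comparable, which is the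
  source of the ultrametric inequality, and orders add under products, so all seminorm estimates
  become inclusions between sets of reals. For the inductive limit it suffices to dominate a
  seminorm on each step separately, with constants that depend on the step. A functional on
  \<open>\<G>_c\<close> is therefore continuous as soon as its own absolute value is such a
  seminorm, and the embedding of \<open>\<G>_c\<close> is continuous because the supremum of the
  pairing over a bounded subset of \<open>\<G> \<Omega>\<close> is one. A second obstacle is the
  encoding of derivatives: smoothness and the inductions speak of lists of directions, the seminorms
  of multi-indices, and passing between them rests on the symmetry of mixed derivatives.\<close>

lemma has_vector_derivative_along_axis:
  assumes "(f has_derivative f') (at (x + t *\<^sub>R axis i 1))"
  shows "((\<lambda>t. f (x + t *\<^sub>R axis i 1)) has_vector_derivative f' (axis i 1)) (at t)"
proof -
  have "((\<lambda>t. x + t *\<^sub>R axis i 1) has_derivative (\<lambda>h. h *\<^sub>R axis i 1)) (at t)"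
    by (auto intro!: derivative_eq_intros)
  from has_derivative_compose[OF this assms]
  show ?thesis
    using assms by (simp add: has_vector_derivative_def linear_scale has_derivative_linear)
qed

lemma partial_derivative_eq:
  assumes "(f has_derivative f') (at x)"
  shows "partial_derivative i f x = f' (axis i 1)"
  unfolding partial_derivative_def
  using has_vector_derivative_along_axis[of f f' x 0 i] assms by (simp add: vector_derivative_at)

lemma has_vector_derivative_partial_derivative:
  assumes "f differentiable (at (x + t *\<^sub>R axis i 1))"
  shows "((\<lambda>t. f (x + t *\<^sub>R axis i 1)) has_vector_derivative
    partial_derivative i f (x + t *\<^sub>R axis i 1)) (at t)"
proof -
  obtain f' where f': "(f has_derivative f') (at (x + t *\<^sub>R axis i 1))"
    using assms by (auto simp: differentiable_def)
  show ?thesis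
    unfolding partial_derivative_eq[OF f'] by (rule has_vector_derivative_along_axis[OF f'])
qed

text \<open>A linear map is determined by its values on the axes, and these values are the partial
  derivatives. The total derivative is wanted for the mean value inequality in
  \<open>gradient_bound\<close>.\<close>

lemma has_derivative_partial_derivatives:
  fixes f :: "real^'n \<Rightarrow> complex"
  assumes "f differentiable (at x)"
  shows "(f has_derivative (\<lambda>h. \<Sum>i\<in>UNIV. (h $ i) *\<^sub>R partial_derivative i f x)) (at x)"
proof -
  obtain f' where f': "(f has_derivative f') (at x)"
    using assms by (auto simp: differentiable_def)
  have lin: "linear f'" using f' has_derivative_linear by blast
  have "f' = (\<lambda>h. \<Sum>i\<in>UNIV. (h $ i) *\<^sub>R partial_derivative i f x)"
  proof
    fix h
    have "f' h = f' (\<Sum>i\<in>UNIV. (h $ i) *\<^sub>R axis i 1)"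
      using basis_expansion[of h] by (simp add: scalar_mult_eq_scaleR)
    then show "f' h = (\<Sum>i\<in>UNIV. (h $ i) *\<^sub>R partial_derivative i f x)"
      by (simp add: linear_sum[OF lin] linear_scale[OF lin] partial_derivative_eq[OF f'])
  qed
  then show ?thesis using f' by simp
qed

text \<open>The derivative along an axis sees only points near \<open>x\<close>. Nets are total
  functions that are controlled on \<Omega> alone, so this is the congruence by which identities
  valid on an open set may be differentiated.\<close>

lemma partial_derivative_cong:
  assumes "open S" "x \<in> S" "\<And>y. y \<in> S \<Longrightarrow> f y = g y"
  shows "partial_derivative i f x = partial_derivative i g x"
  unfolding partial_derivative_def
proof (rule vector_derivative_cong_eq)
  have "continuous_on UNIV (\<lambda>t. x + t *\<^sub>R axis i (1::real))"
    by (intro continuous_intros)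
  then have "open ((\<lambda>t. x + t *\<^sub>R axis i (1::real)) -` S)"
    using assms(1) open_vimage by blast
  then have "\<forall>\<^sub>F t in nhds 0. t \<in> (\<lambda>t. x + t *\<^sub>R axis i 1) -` S"
    using assms(2) by (intro eventually_nhds_in_open) auto
  then show "\<forall>\<^sub>F t in nhds 0. t \<in> UNIV \<longrightarrow> f (x + t *\<^sub>R axis i 1) = g (x + t *\<^sub>R axis i 1)"
    by eventually_elim (use assms(3) in auto)
qed auto

lemma partial_derivative_add:
  assumes "f differentiable (at x)" "g differentiable (at x)"
  shows "partial_derivative i (\<lambda>x. f x + g x) x = partial_derivative i f x + partial_derivative i g x"
proof -
  obtain f' g' where *: "(f has_derivative f') (at x)" "(g has_derivative g') (at x)"
    using assms by (auto simp: differentiable_def)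
  show ?thesis
    using partial_derivative_eq[OF has_derivative_add[OF *]]
    by (simp add: partial_derivative_eq[OF *(1)] partial_derivative_eq[OF *(2)])
qed

lemma partial_derivative_mult:
  assumes "f differentiable (at x)" "g differentiable (at x)"
  shows "partial_derivative i (\<lambda>x. f x * g x) x =
    partial_derivative i f x * g x + f x * partial_derivative i g x"
proof -
  obtain f' g' where *: "(f has_derivative f') (at x)" "(g has_derivative g') (at x)"
    using assms by (auto simp: differentiable_def)
  show ?thesis
    using partial_derivative_eq[OF has_derivative_mult[OF *]]
    by (simp add: partial_derivative_eq[OF *(1)] partial_derivative_eq[OF *(2)])
qed

lemma partial_derivative_linear:
  assumes "bounded_linear L" "f differentiable (at x)"
  shows "partial_derivative i (\<lambda>x. L (f x)) x = L (partial_derivative i f x)"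
proof -
  obtain f' where *: "(f has_derivative f') (at x)"
    using assms by (auto simp: differentiable_def)
  show ?thesis
    using partial_derivative_eq[OF bounded_linear.has_derivative[OF assms(1) *]]
    by (simp add: partial_derivative_eq[OF *])
qed

lemma partial_derivative_inverse:
  assumes "f differentiable (at x)" "f x \<noteq> 0"
  shows "partial_derivative i (\<lambda>x. inverse (f x)) x =
    - (inverse (f x) * (partial_derivative i f x * inverse (f x)))"
proof -
  obtain f' where *: "(f has_derivative f') (at x)"
    using assms by (auto simp: differentiable_def)
  show ?thesis
    using partial_derivative_eq[OF Deriv.has_derivative_inverse[OF assms(2) *]]
    by (simp add: partial_derivative_eq[OF *] mult.assoc)
qed

text \<open>Chain rule for an outer function of a real variable. The cutoff functions are real but
  are kept complex-valued to fit \<open>smooth_on\<close>, hence the detour through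
  \<open>Re\<close> and \<open>complex_of_real\<close>.\<close>

lemma partial_derivative_comp_real:
  assumes "f differentiable (at x)" "(F has_real_derivative F') (at (Re (f x)))"
  shows "partial_derivative i (\<lambda>x. complex_of_real (F (Re (f x)))) x =
    complex_of_real F' * complex_of_real (Re (partial_derivative i f x))"
    and "(\<lambda>x. complex_of_real (F (Re (f x)))) differentiable (at x)"
proof -
  obtain f' where *: "(f has_derivative f') (at x)"
    using assms by (auto simp: differentiable_def)
  have F: "(F has_derivative (\<lambda>h. F' * h)) (at (Re (f x)))"
    using assms(2) by (simp add: has_field_derivative_def)
  have c: "((\<lambda>x. complex_of_real (F (Re (f x)))) has_derivative
      (\<lambda>h. complex_of_real (F' * Re (f' h)))) (at x)"
    using has_derivative_compose[OF has_derivative_Re[OF *] F] has_derivative_of_real by blast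
  show "partial_derivative i (\<lambda>x. complex_of_real (F (Re (f x)))) x =
    complex_of_real F' * complex_of_real (Re (partial_derivative i f x))"
    by (simp add: partial_derivative_eq[OF c] partial_derivative_eq[OF *])
  show "(\<lambda>x. complex_of_real (F (Re (f x)))) differentiable (at x)"
    using c by (auto simp: differentiable_def)
qed

lemma partial_derivative_const [simp]: "partial_derivative i (\<lambda>_. c) = (\<lambda>_. 0)"
  by (simp add: partial_derivative_def fun_eq_iff)

section \<open>Finite orders of differentiability and the calculus of smooth functions\<close>

text \<open>Counting the order makes induction possible: the derivative of a reciprocal contains the
  reciprocal again, but only to one order less. The recursion differentiates \<open>f\<close> first,
  so that the induction hypothesis applies to derivatives of sums, products and compositions after
  one use of the respective rule.\<close>

primrec Ck :: "nat \<Rightarrow> (real^'n) set \<Rightarrow> (real^'n \<Rightarrow> complex) \<Rightarrow> bool" where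
  "Ck 0 \<Omega> f \<longleftrightarrow> f differentiable_on \<Omega>"
| "Ck (Suc n) \<Omega> f \<longleftrightarrow> f differentiable_on \<Omega> \<and> (\<forall>i. Ck n \<Omega> (partial_derivative i f))"

lemma Ck_iff:
  "Ck n \<Omega> f \<longleftrightarrow> (\<forall>is. length is \<le> n \<longrightarrow> foldr partial_derivative is f differentiable_on \<Omega>)"
proof (induction n arbitrary: f)
  case (Suc n)
  show ?case
  proof safe
    fix "is" :: "'a list" assume *: "Ck (Suc n) \<Omega> f" "length is \<le> Suc n"
    \<comment> \<open>The recursion of \<open>Ck\<close> removes the derivative that is applied
      first, which under \<open>foldr\<close> is the last entry of the list; hence the case split
      from the right.\<close>
    show "foldr partial_derivative is f differentiable_on \<Omega>"
      by (cases "is" rule: rev_cases) (use * Suc.IH in auto)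
  next
    assume *: "\<forall>is. length is \<le> Suc n \<longrightarrow> foldr partial_derivative is f differentiable_on \<Omega>"
    have "f differentiable_on \<Omega>" using *[rule_format, of "[]"] by simp
    moreover have "Ck n \<Omega> (partial_derivative i f)" for i
      unfolding Suc.IH
    proof safe
      fix "is" :: "'a list" assume "length is \<le> n"
      then show "foldr partial_derivative is (partial_derivative i f) differentiable_on \<Omega>"
        using *[rule_format, of "is @ [i]"] by simp
    qed
    ultimately show "Ck (Suc n) \<Omega> f" by simp
  qed
qed simp

lemma smooth_on_iff_Ck: "smooth_on \<Omega> f \<longleftrightarrow> (\<forall>n. Ck n \<Omega> f)"
  unfolding smooth_on_def Ck_iff by (meson order_refl)

lemma Ck_Suc_imp: "Ck (Suc n) \<Omega> f \<Longrightarrow> Ck n \<Omega> f"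
  unfolding Ck_iff by (meson le_SucI)

lemma differentiable_on_cong_open:
  assumes "open \<Omega>" "\<And>x. x \<in> \<Omega> \<Longrightarrow> f x = g x" "f differentiable_on \<Omega>"
  shows "g differentiable_on \<Omega>"
  unfolding differentiable_on_def
proof
  fix x assume x: "x \<in> \<Omega>"
  then obtain f' where "(f has_derivative f') (at x within \<Omega>)"
    using assms(3) by (auto simp: differentiable_on_def differentiable_def)
  then have "(g has_derivative f') (at x within \<Omega>)"
    by (rule has_derivative_transform_within[of _ _ _ _ 1]) (use x assms in auto)
  then show "g differentiable at x within \<Omega>" by (auto simp: differentiable_def)
qed

lemma Ck_cong:
  assumes "open \<Omega>" "\<And>x. x \<in> \<Omega> \<Longrightarrow> f x = g x" "Ck n \<Omega> f"
  shows "Ck n \<Omega> g"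
  using assms(2,3)
proof (induction n arbitrary: f g)
  case 0
  from differentiable_on_cong_open[OF assms(1) 0(1)] 0(2) show ?case by simp
next
  case (Suc n)
  have "Ck n \<Omega> (partial_derivative i g)" for i
  proof (rule Suc.IH)
    fix x assume "x \<in> \<Omega>"
    then show "partial_derivative i f x = partial_derivative i g x"
      by (rule partial_derivative_cong[OF assms(1)]) (use Suc.prems(1) in auto)
  qed (use Suc.prems in auto)
  moreover have "g differentiable_on \<Omega>"
    by (rule differentiable_on_cong_open[OF assms(1) Suc.prems(1)]) (use Suc.prems in auto)
  ultimately show ?case by simp
qed

lemma foldr_partial_derivative_cong:
  assumes "open \<Omega>" "\<And>x. x \<in> \<Omega> \<Longrightarrow> f x = g x" "x \<in> \<Omega>"
  shows "foldr partial_derivative is f x = foldr partial_derivative is g x"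
  using assms(3)
proof (induction "is" arbitrary: x)
  case (Cons i js)
  from partial_derivative_cong[OF assms(1) Cons.prems Cons.IH] show ?case by simp
qed (simp add: assms(2))

lemma Ck_add:
  assumes "open \<Omega>" "Ck n \<Omega> f" "Ck n \<Omega> g"
  shows "Ck n \<Omega> (\<lambda>x. f x + g x)"
  using assms(2,3)
proof (induction n arbitrary: f g)
  case (Suc n)
  have d: "f differentiable_on \<Omega>" "g differentiable_on \<Omega>" using Suc.prems by auto
  have "Ck n \<Omega> (partial_derivative i (\<lambda>x. f x + g x))" for i
    by (rule Ck_cong[OF assms(1) _ Suc.IH[of "partial_derivative i f" "partial_derivative i g"]])
      (use Suc.prems d assms(1) in \<open>auto simp: partial_derivative_add differentiable_on_eq_differentiable_at\<close>)
  then show ?case using d by (auto intro: differentiable_on_add)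
qed (auto intro: differentiable_on_add)

lemma Ck_mult:
  assumes "open \<Omega>" "Ck n \<Omega> f" "Ck n \<Omega> g"
  shows "Ck n \<Omega> (\<lambda>x. f x * g x)"
  using assms(2,3)
proof (induction n arbitrary: f g)
  case (Suc n)
  have d: "f differentiable_on \<Omega>" "g differentiable_on \<Omega>" using Suc.prems by auto
  \<comment> \<open>Besides the derivatives, the product rule contains the factors themselves, which
    are needed at the lower order \<open>n\<close>.\<close>
  have n: "Ck n \<Omega> f" "Ck n \<Omega> g" using Suc.prems by (blast intro: Ck_Suc_imp)+
  have "Ck n \<Omega> (partial_derivative i (\<lambda>x. f x * g x))" for i
    by (rule Ck_cong[OF assms(1) _ Ck_add[OF assms(1) Suc.IH[of "partial_derivative i f" g]
      Suc.IH[of f "partial_derivative i g"]]])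
      (use Suc.prems d n assms(1) in
        \<open>auto simp: partial_derivative_mult differentiable_on_eq_differentiable_at\<close>)
  then show ?case using d by (auto intro: differentiable_on_mult)
qed (auto intro: differentiable_on_mult)

lemma Ck_linear:
  assumes "open \<Omega>" "bounded_linear L" "Ck n \<Omega> f"
  shows "Ck n \<Omega> (\<lambda>x. L (f x))"
  using assms(3)
proof (induction n arbitrary: f)
  case 0
  then show ?case
    using assms(2) by (auto simp: differentiable_on_def differentiable_def
        dest: bounded_linear.has_derivative)
next
  case (Suc n)
  have d: "f differentiable_on \<Omega>" using Suc.prems by auto
  have "Ck n \<Omega> (partial_derivative i (\<lambda>x. L (f x)))" for i
    by (rule Ck_cong[OF assms(1) _ Suc.IH[of "partial_derivative i f"]])
      (use Suc.prems d assms in \<open>auto simp: partial_derivative_linear differentiable_on_eq_differentiable_at\<close>)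
  moreover have "(\<lambda>x. L (f x)) differentiable_on \<Omega>"
    using d assms(2) by (auto simp: differentiable_on_def differentiable_def
        dest: bounded_linear.has_derivative)
  ultimately show ?case by auto
qed

text \<open>Induction on the order with \<open>f\<close> fixed: the derivative of the reciprocal is
  a product of the reciprocal, known to have order \<open>n\<close> by induction, and the derivative
  of \<open>f\<close>.\<close>

lemma Ck_inverse:
  assumes "open \<Omega>" "Ck n \<Omega> f" "\<And>x. x \<in> \<Omega> \<Longrightarrow> f x \<noteq> 0"
  shows "Ck n \<Omega> (\<lambda>x. inverse (f x))"
  using assms(2)
proof (induction n)
  case (Suc n)
  have d: "f differentiable_on \<Omega>" using Suc.prems by auto
  have "Ck n \<Omega> (\<lambda>x. inverse (f x))" using Suc.IH Suc.prems Ck_Suc_imp by blast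
  then have "Ck n \<Omega> (\<lambda>x. - (inverse (f x) * (partial_derivative i f x * inverse (f x))))" for i
    using Suc.prems by (intro Ck_linear[OF assms(1) bounded_linear_minus[OF bounded_linear_ident]]
        Ck_mult[OF assms(1)]) auto
  then have "Ck n \<Omega> (partial_derivative i (\<lambda>x. inverse (f x)))" for i
    by (rule Ck_cong[OF assms(1), rotated])
      (use d assms in \<open>auto simp: partial_derivative_inverse differentiable_on_eq_differentiable_at\<close>)
  moreover have "(\<lambda>x. inverse (f x)) differentiable_on \<Omega>"
    using d assms by (auto intro: differentiable_on_inverse)
  ultimately show ?case by auto
qed (use assms in \<open>auto intro: differentiable_on_inverse\<close>)

lemma Ck_const: "Ck n \<Omega> (\<lambda>_. c)"
  by (induction n arbitrary: c) auto

lemma Ck_coord: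
  assumes "open \<Omega>"
  shows "Ck n \<Omega> (\<lambda>x. complex_of_real (x $ j))"
proof -
  have der: "((\<lambda>x. complex_of_real (x $ j)) has_derivative (\<lambda>h. complex_of_real (h $ j))) (at x)"
    for x :: "real^'a"
    by (intro bounded_linear_imp_has_derivative bounded_linear_compose[OF bounded_linear_of_real]
        bounded_linear_vec_nth)
  have "partial_derivative i (\<lambda>x. complex_of_real (x $ j)) = (\<lambda>_. complex_of_real (axis i 1 $ j))" for i
    by (simp add: fun_eq_iff partial_derivative_eq[OF der])
  moreover have "(\<lambda>x. complex_of_real (x $ j)) differentiable_on \<Omega>"
    using der assms unfolding differentiable_on_eq_differentiable_at[OF assms]
    by (auto simp: differentiable_def)
  ultimately show ?thesis by (cases n) (auto intro: Ck_const)
qed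

lemma smooth_on_cong:
  "open \<Omega> \<Longrightarrow> (\<And>x. x \<in> \<Omega> \<Longrightarrow> f x = g x) \<Longrightarrow> smooth_on \<Omega> f \<Longrightarrow> smooth_on \<Omega> g"
  unfolding smooth_on_iff_Ck using Ck_cong by blast

lemma smooth_on_add:
  "open \<Omega> \<Longrightarrow> smooth_on \<Omega> f \<Longrightarrow> smooth_on \<Omega> g \<Longrightarrow> smooth_on \<Omega> (\<lambda>x. f x + g x)"
  unfolding smooth_on_iff_Ck using Ck_add by blast

lemma smooth_on_mult:
  "open \<Omega> \<Longrightarrow> smooth_on \<Omega> f \<Longrightarrow> smooth_on \<Omega> g \<Longrightarrow> smooth_on \<Omega> (\<lambda>x. f x * g x)"
  unfolding smooth_on_iff_Ck using Ck_mult by blast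

lemma smooth_on_linear:
  "open \<Omega> \<Longrightarrow> bounded_linear L \<Longrightarrow> smooth_on \<Omega> f \<Longrightarrow> smooth_on \<Omega> (\<lambda>x. L (f x))"
  unfolding smooth_on_iff_Ck using Ck_linear by blast

lemma smooth_on_inverse:
  "open \<Omega> \<Longrightarrow> smooth_on \<Omega> f \<Longrightarrow> (\<And>x. x \<in> \<Omega> \<Longrightarrow> f x \<noteq> 0) \<Longrightarrow> smooth_on \<Omega> (\<lambda>x. inverse (f x))"
  unfolding smooth_on_iff_Ck using Ck_inverse by blast

lemma smooth_on_const: "smooth_on \<Omega> (\<lambda>_. c)"
  unfolding smooth_on_iff_Ck using Ck_const by blast

lemma smooth_on_coord: "open \<Omega> \<Longrightarrow> smooth_on \<Omega> (\<lambda>x. complex_of_real (x $ j))"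
  unfolding smooth_on_iff_Ck using Ck_coord by blast

lemma smooth_on_diff:
  assumes "open \<Omega>" "smooth_on \<Omega> f" "smooth_on \<Omega> g"
  shows "smooth_on \<Omega> (\<lambda>x. f x - g x)"
  using smooth_on_add[OF assms(1,2) smooth_on_linear[OF assms(1)
        bounded_linear_minus[OF bounded_linear_ident] assms(3)]] by simp

lemma smooth_on_sum:
  assumes "open \<Omega>" "\<And>i. i \<in> I \<Longrightarrow> smooth_on \<Omega> (f i)"
  shows "smooth_on \<Omega> (\<lambda>x. \<Sum>i\<in>I. f i x)"
  using assms(2)
  by (induction I rule: infinite_finite_induct) (auto intro!: smooth_on_add smooth_on_const assms(1))

lemma smooth_on_subset: "smooth_on \<Omega> f \<Longrightarrow> V \<subseteq> \<Omega> \<Longrightarrow> smooth_on V f"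
  unfolding smooth_on_def using differentiable_on_subset by blast

text \<open>Smoothness is local, because on an open set \<open>differentiable_on\<close> means
  differentiability at each point.\<close>

lemma smooth_on_Union:
  assumes "\<And>V. V \<in> \<V> \<Longrightarrow> open V \<and> smooth_on V f"
  shows "smooth_on (\<Union>\<V>) f"
  unfolding smooth_on_def
proof
  fix "is"
  have "open (\<Union>\<V>)" using assms by blast
  moreover have "foldr partial_derivative is f differentiable (at x)" if "x \<in> V" "V \<in> \<V>" for x V
    using that assms[OF that(2)] by (auto simp: smooth_on_def differentiable_on_eq_differentiable_at)
  ultimately show "foldr partial_derivative is f differentiable_on \<Union>\<V>"
    by (auto simp: differentiable_on_eq_differentiable_at)
qed

lemma smooth_on_foldr: "smooth_on \<Omega> f \<Longrightarrow> smooth_on \<Omega> (foldr partial_derivative is f)"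
  unfolding smooth_on_def by (simp flip: foldr_append)

lemma smooth_on_partial_derivative: "smooth_on \<Omega> f \<Longrightarrow> smooth_on \<Omega> (partial_derivative i f)"
  using smooth_on_foldr[of \<Omega> f "[i]"] by simp

lemma smooth_on_differentiable:
  "open \<Omega> \<Longrightarrow> smooth_on \<Omega> f \<Longrightarrow> x \<in> \<Omega> \<Longrightarrow> foldr partial_derivative is f differentiable (at x)"
  by (auto simp: smooth_on_def differentiable_on_eq_differentiable_at)

lemma smooth_on_continuous_on:
  "smooth_on \<Omega> f \<Longrightarrow> continuous_on \<Omega> (foldr partial_derivative is f)"
  by (auto simp: smooth_on_def differentiable_imp_continuous_on)

lemma foldr_partial_derivative_add:
  assumes "open \<Omega>" "smooth_on \<Omega> f" "smooth_on \<Omega> g" "x \<in> \<Omega>"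
  shows "foldr partial_derivative is (\<lambda>x. f x + g x) x =
    foldr partial_derivative is f x + foldr partial_derivative is g x"
  using assms(4)
proof (induction "is" arbitrary: x)
  case (Cons i js)
  have "partial_derivative i (foldr partial_derivative js (\<lambda>x. f x + g x)) x =
      partial_derivative i (\<lambda>x. foldr partial_derivative js f x + foldr partial_derivative js g x) x"
    by (rule partial_derivative_cong[OF assms(1) Cons.prems]) (rule Cons.IH)
  also have "\<dots> = partial_derivative i (foldr partial_derivative js f) x
      + partial_derivative i (foldr partial_derivative js g) x"
    using assms Cons.prems by (intro partial_derivative_add smooth_on_differentiable)
  finally show ?case by simp
qed simp

lemma foldr_partial_derivative_linear:
  assumes "open \<Omega>" "bounded_linear L" "smooth_on \<Omega> f" "x \<in> \<Omega>"
  shows "foldr partial_derivative is (\<lambda>x. L (f x)) x = L (foldr partial_derivative is f x)"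
  using assms(4)
proof (induction "is" arbitrary: x)
  case (Cons i js)
  have "partial_derivative i (foldr partial_derivative js (\<lambda>x. L (f x))) x =
      partial_derivative i (\<lambda>x. L (foldr partial_derivative js f x)) x"
    by (rule partial_derivative_cong[OF assms(1) Cons.prems]) (rule Cons.IH)
  also have "\<dots> = L (partial_derivative i (foldr partial_derivative js f) x)"
    using assms Cons.prems by (intro partial_derivative_linear smooth_on_differentiable)
  finally show ?case by simp
qed simp

section \<open>Symmetry of mixed partial derivatives\<close>

text \<open>Two applications of the mean value theorem evaluate the second difference over a square
  exactly. The theorem fails for complex values, so a real-linear \<open>L\<close> is applied first,
  later the real and the imaginary part.\<close>

lemma second_difference_mvt:
  fixes f :: "real^'n \<Rightarrow> complex" and L :: "complex \<Rightarrow> real"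
  assumes "open \<Omega>" "smooth_on \<Omega> f" "ball x r \<subseteq> \<Omega>" "0 < h" "2 * h < r" "bounded_linear L"
  obtains y where "y \<in> ball x r"
    "L (f (x + h *\<^sub>R axis i 1 + h *\<^sub>R axis j 1) - f (x + h *\<^sub>R axis i 1)
        - f (x + h *\<^sub>R axis j 1) + f x) =
     h * (h * L (partial_derivative j (partial_derivative i f) y))"
proof -
  define p where "p s t = x + s *\<^sub>R axis i 1 + t *\<^sub>R axis j (1::real)" for s t
  have p: "p s t \<in> ball x r" if "0 \<le> s" "s \<le> h" "0 \<le> t" "t \<le> h" for s t
  proof -
    have "norm (s *\<^sub>R axis i 1 + t *\<^sub>R axis j (1::real)) \<le> s + t"
      using norm_triangle_ineq[of "s *\<^sub>R axis i 1" "t *\<^sub>R axis j (1::real)"] that by simp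
    then show ?thesis
      using that assms(5) by (simp add: p_def dist_norm norm_minus_commute add.assoc) (simp add: add.commute)
  qed
  have diff: "foldr partial_derivative is f differentiable (at (p s t))"
    if "0 \<le> s" "s \<le> h" "0 \<le> t" "t \<le> h" for s t "is"
    using smooth_on_differentiable[OF assms(1,2)] p[OF that] assms(3) by blast
  have der1: "((\<lambda>s. L (f (p s t))) has_real_derivative L (partial_derivative i f (p s t))) (at s)"
    if "0 \<le> s" "s \<le> h" "0 \<le> t" "t \<le> h" for s t
    using bounded_linear.has_vector_derivative[OF assms(6)
        has_vector_derivative_partial_derivative[of f "x + t *\<^sub>R axis j 1" s i]]
      diff[OF that, of "[]"]
    by (simp add: p_def has_real_derivative_iff_has_vector_derivative add_ac)
  have der2: "((\<lambda>t. L (partial_derivative i f (p s t))) has_real_derivative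
      L (partial_derivative j (partial_derivative i f) (p s t))) (at t)"
    if "0 \<le> s" "s \<le> h" "0 \<le> t" "t \<le> h" for s t
    using bounded_linear.has_vector_derivative[OF assms(6)
        has_vector_derivative_partial_derivative[of "partial_derivative i f" "x + s *\<^sub>R axis i 1" t j]]
      diff[OF that, of "[i]"]
    by (simp add: p_def has_real_derivative_iff_has_vector_derivative add_ac)
  \<comment> \<open>The difference in \<open>t\<close> is treated as a function of \<open>s\<close>;
    the derivative in direction \<open>i\<close> that this produces is then treated as a function of
    \<open>t\<close>.\<close>
  have "\<exists>s>0. s < h \<and> (L (f (p h h)) - L (f (p h 0))) - (L (f (p 0 h)) - L (f (p 0 0))) =
      (h - 0) * (L (partial_derivative i f (p s h)) - L (partial_derivative i f (p s 0)))"
    by (rule MVT2[OF assms(4), of "\<lambda>s. L (f (p s h)) - L (f (p s 0))"])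
      (intro DERIV_diff der1; use assms(4) in simp)
  then obtain s where s: "0 < s" "s < h"
    "(L (f (p h h)) - L (f (p h 0))) - (L (f (p 0 h)) - L (f (p 0 0))) =
      h * (L (partial_derivative i f (p s h)) - L (partial_derivative i f (p s 0)))" by auto
  have "\<exists>t>0. t < h \<and> L (partial_derivative i f (p s h)) - L (partial_derivative i f (p s 0)) =
      (h - 0) * L (partial_derivative j (partial_derivative i f) (p s t))"
    by (rule MVT2[OF assms(4), of "\<lambda>t. L (partial_derivative i f (p s t))"])
      (intro der2; use s in simp)
  then obtain t where t: "0 < t" "t < h"
    "L (partial_derivative i f (p s h)) - L (partial_derivative i f (p s 0)) =
      h * L (partial_derivative j (partial_derivative i f) (p s t))" by auto
  have "L (f (p h h) - f (p h 0) - f (p 0 h) + f (p 0 0)) =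
      h * (h * L (partial_derivative j (partial_derivative i f) (p s t)))"
    using s(3) t(3) by (simp add: bounded_linear.linear[OF assms(6)] linear_add linear_diff)
  then show thesis
    using that[of "p s t"] p[of s t] s t by (simp add: p_def)
qed

text \<open>Schwarz's theorem: the second difference over a small square is symmetric in the two
  directions, and divided by the area it is a value of either mixed derivative near
  \<open>x\<close>. Continuity of both derivatives at \<open>x\<close> then forces them to agree
  there.\<close>

lemma partial_derivative_commute:
  fixes f :: "real^'n \<Rightarrow> complex"
  assumes "open \<Omega>" "smooth_on \<Omega> f" "x \<in> \<Omega>"
  shows "partial_derivative i (partial_derivative j f) x = partial_derivative j (partial_derivative i f) x"
proof -
  define a b where "a = partial_derivative i (partial_derivative j f)"
    and "b = partial_derivative j (partial_derivative i f)"
  have "continuous (at x) a" "continuous (at x) b"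
    using smooth_on_differentiable[OF assms, of "[i, j]"] smooth_on_differentiable[OF assms, of "[j, i]"]
    by (simp_all add: a_def b_def differentiable_imp_continuous_within)
  have main: "\<bar>L (a x) - L (b x)\<bar> \<le> 2 * e" if e: "0 < e" and L: "bounded_linear L"
    and L_le: "\<And>z. \<bar>L z\<bar> \<le> cmod z" for e and L :: "complex \<Rightarrow> real"
  proof -
    obtain r1 where r1: "r1 > 0" "ball x r1 \<subseteq> \<Omega>"
      using assms by (meson open_contains_ball)
    obtain r2 where r2: "r2 > 0" "\<And>y. dist y x < r2 \<Longrightarrow> dist (a y) (a x) < e"
      using \<open>continuous (at x) a\<close> \<open>0 < e\<close> unfolding continuous_at_eps_delta by (metis (no_types))
    obtain r3 where r3: "r3 > 0" "\<And>y. dist y x < r3 \<Longrightarrow> dist (b y) (b x) < e"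
      using \<open>continuous (at x) b\<close> \<open>0 < e\<close> unfolding continuous_at_eps_delta by (metis (no_types))
    define r where "r = min r1 (min r2 r3)"
    have r: "r > 0" "ball x r \<subseteq> \<Omega>" using r1 r2 r3 by (auto simp: r_def)
    \<comment> \<open>Any positive \<open>h\<close> with \<open>2 * h < r\<close> keeps the square
      inside the ball.\<close>
    define h where "h = r / 4"
    have h: "0 < h" "2 * h < r" using r by (auto simp: h_def)
    obtain y where y: "y \<in> ball x r"
      "L (f (x + h *\<^sub>R axis i 1 + h *\<^sub>R axis j 1) - f (x + h *\<^sub>R axis i 1)
        - f (x + h *\<^sub>R axis j 1) + f x) = h * (h * L (b y))"
      unfolding b_def by (rule second_difference_mvt[OF assms(1,2) r(2) h L])
    obtain z where z: "z \<in> ball x r"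
      "L (f (x + h *\<^sub>R axis j 1 + h *\<^sub>R axis i 1) - f (x + h *\<^sub>R axis j 1)
        - f (x + h *\<^sub>R axis i 1) + f x) = h * (h * L (a z))"
      unfolding a_def by (rule second_difference_mvt[OF assms(1,2) r(2) h L])
    \<comment> \<open>The two second differences are the same number with reordered summands, so the
      mixed derivatives agree at the two nearby points \<open>y\<close> and
      \<open>z\<close>.\<close>
    have "h * (h * L (b y)) = h * (h * L (a z))"
      unfolding y(2)[symmetric] z(2)[symmetric] by (rule arg_cong[of _ _ L]) (simp add: add_ac)
    then have "L (b y) = L (a z)" using h by simp
    moreover have "\<bar>L (b y - b x)\<bar> < e" "\<bar>L (a z - a x)\<bar> < e"
      using L_le[of "b y - b x"] L_le[of "a z - a x"] r2(2)[of z] r3(2)[of y] y(1) z(1)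
      by (auto simp: r_def dist_norm norm_minus_commute)
    ultimately show ?thesis
      using linear_diff[OF bounded_linear.linear[OF L]] by (simp add: abs_le_iff abs_less_iff)
  qed
  have eq: "L (a x) = L (b x)" if "bounded_linear L" "\<And>z. \<bar>L z\<bar> \<le> cmod z" for L :: "complex \<Rightarrow> real"
  proof -
    have "\<bar>L (a x) - L (b x)\<bar> \<le> e" if "0 < e" for e
      using main[of "e / 2" L] that \<open>bounded_linear L\<close> \<open>\<And>z. \<bar>L z\<bar> \<le> cmod z\<close> by simp
    then have "\<bar>L (a x) - L (b x)\<bar> \<le> 0" by (rule field_le_epsilon) simp
    then show ?thesis by simp
  qed
  have "a x = b x"
    using eq[OF bounded_linear_Re abs_Re_le_cmod] eq[OF bounded_linear_Im abs_Im_le_cmod]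
    by (simp add: complex_eq_iff)
  then show ?thesis by (simp add: a_def b_def)
qed

lemma foldr_partial_derivative_move:
  assumes "open \<Omega>" "smooth_on \<Omega> f" "x \<in> \<Omega>"
  shows "foldr partial_derivative (ys @ i # zs) f x = foldr partial_derivative (i # ys @ zs) f x"
  using assms(3)
proof (induction ys arbitrary: x)
  case (Cons y ys)
  have "foldr partial_derivative ((y # ys) @ i # zs) f x =
      partial_derivative y (partial_derivative i (foldr partial_derivative (ys @ zs) f)) x"
    using partial_derivative_cong[OF assms(1) Cons.prems Cons.IH] by simp
  also have "\<dots> = partial_derivative i (partial_derivative y (foldr partial_derivative (ys @ zs) f)) x"
    by (rule partial_derivative_commute[OF assms(1) smooth_on_foldr[OF assms(2)] Cons.prems])
  finally show ?case by simp
qed simp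

text \<open>The first entry of one list is located in the other and moved to its front, after which
  the tails have equal multisets.\<close>

lemma foldr_partial_derivative_mset:
  assumes "open \<Omega>" "smooth_on \<Omega> f" "x \<in> \<Omega>" "mset is = mset js"
  shows "foldr partial_derivative is f x = foldr partial_derivative js f x"
  using assms(3,4)
proof (induction "is" arbitrary: js x)
  case (Cons i ks)
  then have "i \<in> set js" by (metis list.set_intros(1) mset_eq_setD)
  then obtain ys zs where js: "js = ys @ i # zs" by (auto simp: in_set_conv_decomp)
  then have "mset ks = mset (ys @ zs)" using Cons.prems by simp
  then have "foldr partial_derivative ks f y = foldr partial_derivative (ys @ zs) f y" if "y \<in> \<Omega>" for y
    using Cons.IH that by blast
  from partial_derivative_cong[OF assms(1) Cons.prems(1) this, where i = i]
  show ?case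
    unfolding js foldr_partial_derivative_move[OF assms(1,2) Cons.prems(1)] by simp
qed simp

section \<open>From lists of directions to multi-indices\<close>

lemma ex_list_count:
  fixes \<alpha> :: "'n::finite \<Rightarrow> nat"
  shows "\<exists>is. \<forall>i. count_list is i = \<alpha> i"
proof -
  obtain "is" where "mset is = Abs_multiset \<alpha>" using ex_mset by blast
  then have "count (mset is) i = \<alpha> i" for i by (simp add: count_Abs_multiset)
  then show ?thesis by (metis count_mset)
qed

text \<open>\<open>multi_deriv\<close> uses some list with the prescribed counts. By symmetry of
  mixed derivatives the choice has no influence on smooth functions, so any convenient list may
  replace it.\<close>

lemma multi_deriv_eq_foldr:
  fixes f :: "real^'n \<Rightarrow> complex"
  assumes "open \<Omega>" "smooth_on \<Omega> f" "x \<in> \<Omega>"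
  shows "multi_deriv (count_list is) f x = foldr partial_derivative is f x"
proof -
  define js where "js = (SOME js. \<forall>i. count_list js i = count_list is i)"
  have "\<forall>i. count_list js i = count_list is i"
    unfolding js_def by (rule someI[of _ "is"]) simp
  then have "mset js = mset is" by (intro multiset_eqI) (simp add: count_mset)
  from foldr_partial_derivative_mset[OF assms this]
  show ?thesis by (simp add: multi_deriv_def js_def)
qed

text \<open>The list chosen in the definition is the witness, so this is an equality of operators
  and holds for all functions at once. It reduces statements on a given multi-index to statements on
  lists.\<close>

lemma multi_deriv_foldr_ex: "\<exists>is. (\<forall>i. count_list is i = \<alpha> i) \<and> multi_deriv \<alpha> = foldr partial_derivative is"
  unfolding multi_deriv_def fun_eq_iff by (rule exI[of _ "SOME is. \<forall>i. count_list is i = \<alpha> i"])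
    (use someI_ex[OF ex_list_count[of \<alpha>]] in auto)

lemma multi_deriv_zero: "multi_deriv (\<lambda>_. 0) f = f"
proof -
  have "(\<forall>i. count_list is i = 0) \<longleftrightarrow> is = []" for "is" :: "'a list"
  proof (cases "is")
    case (Cons i js)
    then have "count_list is i \<noteq> 0" by simp
    then show ?thesis using Cons by auto
  qed simp
  then show ?thesis by (simp add: multi_deriv_def)
qed


subsection \<open>Smooth cutoff functions\<close>

text \<open>The single function \<open>exp (- 1 / t)\<close>, extended by zero, is not closed under
  differentiation, but the family with a polynomial factor in \<open>1 / t\<close> is; this turns
  its smoothness into an induction.\<close>

definition flat_exp :: "real poly \<Rightarrow> real \<Rightarrow> real" where
  "flat_exp p t = (if 0 < t then poly p (1 / t) * exp (- (1 / t)) else 0)"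

lemma tendsto_poly_exp_0: "((\<lambda>s. poly p s * exp (- s)) \<longlongrightarrow> (0::real)) at_top"
proof -
  have "((\<lambda>s. \<Sum>i\<le>degree p. coeff p i * (s ^ i / exp s)) \<longlongrightarrow> (\<Sum>i\<le>degree p. coeff p i * 0)) at_top"
    by (intro tendsto_sum tendsto_mult tendsto_const tendsto_power_div_exp_0)
  then show ?thesis
    by (simp add: poly_altdef sum_divide_distrib exp_minus field_simps)
qed

text \<open>With \<open>s = 1 / t\<close>, the derivative of \<open>p(s) exp (- s)\<close> with respect to \<open>t\<close> is
  \<open>s\<^sup>2 (p(s) - p'(s)) exp (- s)\<close>.\<close>

lemma flat_exp_has_real_derivative:
  "(flat_exp p has_real_derivative flat_exp ([:0, 0, 1:] * (p - pderiv p)) t) (at t)"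
proof -
  consider "t > 0" | "t < 0" | "t = 0" by linarith
  then show ?thesis
  proof cases
    case 1
    have "((\<lambda>t. poly p (1 / t) * exp (- (1 / t))) has_real_derivative
        flat_exp ([:0, 0, 1:] * (p - pderiv p)) t) (at t)"
      using 1 by (auto intro!: derivative_eq_intros poly_DERIV[THEN DERIV_chain2]
          simp: flat_exp_def field_simps power2_eq_square)
    then show ?thesis
      by (rule has_field_derivative_transform_within_open[of _ _ _ "{0<..}"])
        (use 1 in \<open>auto simp: flat_exp_def\<close>)
  next
    case 2
    have "((\<lambda>_. 0) has_real_derivative flat_exp ([:0, 0, 1:] * (p - pderiv p)) t) (at t)"
      using 2 by (auto simp: flat_exp_def)
    then show ?thesis
      by (rule has_field_derivative_transform_within_open[of _ _ _ "{..<0}"])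
        (use 2 in \<open>auto simp: flat_exp_def\<close>)
  next
    case 3
    \<comment> \<open>Dividing by \<open>h\<close> at the origin multiplies the polynomial by its
      variable, so the difference quotient is a function of the same kind and tends to 0.\<close>
    have "((\<lambda>h. poly (pCons 0 p) (inverse h) * exp (- inverse h)) \<longlongrightarrow> 0) (at_right 0)"
      by (rule filterlim_compose[OF tendsto_poly_exp_0 filterlim_inverse_at_top_right])
    then have "((\<lambda>h. flat_exp p h / h) \<longlongrightarrow> 0) (at_right 0)"
      by (rule Lim_transform_eventually)
        (auto simp: eventually_at_filter flat_exp_def field_simps intro!: always_eventually)
    moreover have "((\<lambda>h. flat_exp p h / h) \<longlongrightarrow> 0) (at_left 0)"
      by (rule Lim_transform_eventually[OF tendsto_const])
        (auto simp: eventually_at_filter flat_exp_def intro!: always_eventually)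
    ultimately have "((\<lambda>h. flat_exp p h / h) \<longlongrightarrow> 0) (at 0)"
      by (simp add: filterlim_at_split)
    then show ?thesis
      by (simp add: 3 DERIV_def) (simp add: flat_exp_def)
  qed
qed

text \<open>The induction on the order runs over all polynomials at once, because the chain rule
  produces the flat exponential of another polynomial, times a derivative of the inner
  function.\<close>

lemma smooth_on_flat_exp:
  assumes "open \<Omega>" "smooth_on \<Omega> (\<lambda>x. complex_of_real (f x))"
  shows "smooth_on \<Omega> (\<lambda>x. complex_of_real (flat_exp p (f x)))"
proof -
  have diff: "(\<lambda>x. complex_of_real (flat_exp p (f x))) differentiable (at x)"
    and pd: "partial_derivative i (\<lambda>x. complex_of_real (flat_exp p (f x))) x =
      complex_of_real (flat_exp ([:0, 0, 1:] * (p - pderiv p)) (f x)) *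
      complex_of_real (Re (partial_derivative i (\<lambda>x. complex_of_real (f x)) x))"
    if "x \<in> \<Omega>" for x p i
    using partial_derivative_comp_real[OF smooth_on_differentiable[OF assms that, of "[]", simplified],
        of "flat_exp p"] flat_exp_has_real_derivative[of p "f x"] by auto
  have "Ck n \<Omega> (\<lambda>x. complex_of_real (flat_exp p (f x)))" for n
  proof (induction n arbitrary: p)
    case 0
    then show ?case using diff by (simp add: differentiable_on_eq_differentiable_at assms(1))
  next
    case (Suc n)
    have "Ck n \<Omega> (partial_derivative i (\<lambda>x. complex_of_real (f x)))" for i
      using smooth_on_partial_derivative[OF assms(2)] by (auto simp: smooth_on_iff_Ck)
    then have prod: "Ck n \<Omega> (\<lambda>x. complex_of_real (flat_exp ([:0, 0, 1:] * (p - pderiv p)) (f x)) *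
      complex_of_real (Re (partial_derivative i (\<lambda>x. complex_of_real (f x)) x)))" for i
      by (rule Ck_mult[OF assms(1) Suc.IH Ck_linear[OF assms(1)
            bounded_linear_compose[OF bounded_linear_of_real bounded_linear_Re]]])
    have "Ck n \<Omega> (partial_derivative i (\<lambda>x. complex_of_real (flat_exp p (f x))))" for i
      by (rule Ck_cong[OF assms(1) _ prod[of i]]) (simp add: pd)
    then show ?case using diff by (simp add: differentiable_on_eq_differentiable_at assms(1))
  qed
  then show ?thesis by (simp add: smooth_on_iff_Ck)
qed

lemma flat_exp_1: "flat_exp 1 t = (if 0 < t then exp (- (1 / t)) else 0)"
  by (simp add: flat_exp_def)

lemma smooth_on_dist_sq:
  fixes c :: "real^'n"
  shows "smooth_on UNIV (\<lambda>x. complex_of_real (r - (dist c x)\<^sup>2))"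
proof -
  have "complex_of_real (r - (dist c x)\<^sup>2) =
      complex_of_real r - (\<Sum>i\<in>UNIV. (complex_of_real (c $ i) - complex_of_real (x $ i)) *
        (complex_of_real (c $ i) - complex_of_real (x $ i)))" for x
    by (simp add: dist_norm norm_vec_def L2_set_def sum_nonneg power2_eq_square)
  then show ?thesis
    by (simp only:) (intro smooth_on_diff smooth_on_const smooth_on_sum smooth_on_mult smooth_on_coord open_UNIV)
qed

text \<open>Finitely many bumps in balls inside \<Omega> add up to a function \<Psi> that is at
  least some positive \<delta> on \<open>C\<close>; a smooth step between the heights
  \<open>\<delta> / 4\<close> and \<open>\<delta> / 2\<close> flattens it. The result is 1 on a
  whole neighbourhood \<open>W\<close> of \<open>C\<close>, so that multiplication by it changes no
  derivative on \<open>C\<close>.\<close>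

lemma ex_smooth_cutoff:
  fixes C \<Omega> :: "(real^'n) set"
  assumes "compact C" "open \<Omega>" "C \<subseteq> \<Omega>"
  obtains \<kappa> :: "real^'n \<Rightarrow> real" and W D where
    "smooth_on UNIV (\<lambda>x. complex_of_real (\<kappa> x))" "\<And>x. 0 \<le> \<kappa> x"
    "open W" "C \<subseteq> W" "W \<subseteq> D" "compact D" "D \<subseteq> \<Omega>"
    "\<And>x. x \<in> W \<Longrightarrow> \<kappa> x = 1" "\<And>x. x \<notin> D \<Longrightarrow> \<kappa> x = 0"
proof -
  have "\<exists>r>0. cball c r \<subseteq> \<Omega>" if "c \<in> C" for c
    using assms that open_contains_cball by blast
  then obtain r where r: "\<And>c. c \<in> C \<Longrightarrow> r c > 0 \<and> cball c (r c) \<subseteq> \<Omega>" by metis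
  have "C \<subseteq> (\<Union>c\<in>C. ball c (r c))" using r by force
  from compactE_image[OF assms(1) _ this]
  obtain T where T: "T \<subseteq> C" "finite T" "C \<subseteq> (\<Union>c\<in>T. ball c (r c))" by auto
  \<comment> \<open>Each summand is positive exactly in the open ball of radius \<open>r c\<close>,
    since \<open>flat_exp 1\<close> is positive exactly on the positive reals; the squared distance
    keeps it smooth at the centre.\<close>
  define \<Psi> where "\<Psi> x = (\<Sum>c\<in>T. flat_exp 1 ((r c)\<^sup>2 - (dist c x)\<^sup>2))" for x
  have smooth: "smooth_on UNIV (\<lambda>x. complex_of_real (\<Psi> x))"
    unfolding \<Psi>_def of_real_sum
    by (intro smooth_on_sum smooth_on_flat_exp smooth_on_dist_sq open_UNIV)
  have cont: "continuous_on UNIV \<Psi>"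
    using continuous_on_Re[OF smooth_on_continuous_on[OF smooth, of "[]"]] by simp
  have pos: "0 < flat_exp 1 ((r c)\<^sup>2 - (dist c x)\<^sup>2) \<longleftrightarrow> x \<in> ball c (r c)" if "c \<in> T" for c x
  proof -
    have "0 < r c" using r that T(1) by blast
    then have "(dist c x)\<^sup>2 < (r c)\<^sup>2 \<longleftrightarrow> dist c x < r c"
      by (simp add: not_le[symmetric] abs_le_square_iff[symmetric])
    then show ?thesis by (auto simp: flat_exp_1)
  qed
  have nonneg: "0 \<le> flat_exp 1 t" for t by (simp add: flat_exp_1)
  have supp: "x \<in> (\<Union>c\<in>T. cball c (r c))" if "0 < \<Psi> x" for x
  proof (rule ccontr)
    assume "x \<notin> (\<Union>c\<in>T. cball c (r c))"
    then have "x \<notin> ball c (r c)" if "c \<in> T" for c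
      using that ball_subset_cball by blast
    then have "\<not> 0 < flat_exp 1 ((r c)\<^sup>2 - (dist c x)\<^sup>2)" if "c \<in> T" for c
      using pos that by blast
    then have "flat_exp 1 ((r c)\<^sup>2 - (dist c x)\<^sup>2) = 0" if "c \<in> T" for c
      using that nonneg[of "(r c)\<^sup>2 - (dist c x)\<^sup>2"] by (metis order_le_less)
    then show False using that by (simp add: \<Psi>_def)
  qed
  have pos_C: "0 < \<Psi> x" if "x \<in> C" for x
  proof -
    obtain c where "c \<in> T" "x \<in> ball c (r c)" using T(3) \<open>x \<in> C\<close> by blast
    then have "0 < flat_exp 1 ((r c)\<^sup>2 - (dist c x)\<^sup>2)" using pos by blast
    then show ?thesis
      unfolding \<Psi>_def by (rule sum_pos2[OF T(2) \<open>c \<in> T\<close>]) (rule nonneg)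
  qed
  \<comment> \<open>On an empty \<open>C\<close> there is no minimum to take, and any positive
    number serves.\<close>
  obtain \<delta> where \<delta>: "\<delta> > 0" "\<And>x. x \<in> C \<Longrightarrow> \<delta> \<le> \<Psi> x"
  proof (cases "C = {}")
    case False
    then obtain x where "x \<in> C" "\<And>y. y \<in> C \<Longrightarrow> \<Psi> x \<le> \<Psi> y"
      using continuous_attains_inf[OF assms(1)] continuous_on_subset[OF cont] by blast
    then show ?thesis using that[of "\<Psi> x"] pos_C by blast
  qed (use that[of 1] in auto)
  \<comment> \<open>A quotient \<open>a / (a + b)\<close> where \<open>a\<close> vanishes for
    \<open>\<Psi> x \<le> \<delta> / 4\<close> and \<open>b\<close> for
    \<open>\<Psi> x \<ge> \<delta> / 2\<close>. Since \<open>\<delta> / 4 < \<delta> / 2\<close>,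
    the two never vanish together, so the denominator is positive everywhere.\<close>
  define \<kappa> where "\<kappa> x = flat_exp 1 (\<Psi> x - \<delta> / 4) * inverse (flat_exp 1 (\<Psi> x - \<delta> / 4) + flat_exp 1 (\<delta> / 2 - \<Psi> x))" for x
  have den: "0 < flat_exp 1 (\<Psi> x - \<delta> / 4) + flat_exp 1 (\<delta> / 2 - \<Psi> x)" for x
    using \<delta>(1) by (auto simp: flat_exp_1 add_pos_pos)
  define W where "W = {x. \<Psi> x > \<delta> / 2}"
  define D where "D = {x. \<Psi> x \<ge> \<delta> / 4}"
  show thesis
  proof
    have s1: "smooth_on UNIV (\<lambda>x. complex_of_real (flat_exp 1 (\<Psi> x - \<delta> / 4)))"
      by (rule smooth_on_flat_exp) (use smooth in \<open>auto intro: smooth_on_diff smooth_on_const\<close>)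
    have s2: "smooth_on UNIV (\<lambda>x. complex_of_real (flat_exp 1 (\<delta> / 2 - \<Psi> x)))"
      by (rule smooth_on_flat_exp)
        (use smooth smooth_on_diff[OF open_UNIV smooth_on_const smooth] in auto)
    have s3: "smooth_on UNIV (\<lambda>x. inverse (complex_of_real (flat_exp 1 (\<Psi> x - \<delta> / 4)) +
        complex_of_real (flat_exp 1 (\<delta> / 2 - \<Psi> x))))"
      using den by (intro smooth_on_inverse smooth_on_add s1 s2 open_UNIV)
        (simp flip: of_real_add add: less_imp_neq[THEN not_sym])
    show "smooth_on UNIV (\<lambda>x. complex_of_real (\<kappa> x))"
      using smooth_on_mult[OF open_UNIV s1 s3] by (simp add: \<kappa>_def)
    show "0 \<le> \<kappa> x" for x unfolding \<kappa>_def using nonneg den[of x] by simp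
    show "open W" unfolding W_def using cont by (intro open_Collect_less continuous_intros)
    show "C \<subseteq> W" using \<delta> by (force simp: W_def)
    show "W \<subseteq> D" using \<delta> by (auto simp: W_def D_def)
    \<comment> \<open>\<Psi> is positive only on the closed balls, so the closed set
      \<open>D\<close> lies in their compact union.\<close>
    have D: "D \<subseteq> (\<Union>c\<in>T. cball c (r c))" using supp \<delta>(1) by (force simp: D_def)
    have "closed D" unfolding D_def using cont by (intro closed_Collect_le continuous_intros)
    moreover have "compact (\<Union>c\<in>T. cball c (r c))" using T(2) by (intro compact_UN) auto
    ultimately have "compact ((\<Union>c\<in>T. cball c (r c)) \<inter> D)" by (rule compact_Int_closed[rotated])
    then show "compact D" using D by (simp add: Int_absorb1)
    show "D \<subseteq> \<Omega>" using D r T(1) by blast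
    show "\<kappa> x = 1" if "x \<in> W" for x
      using that \<delta>(1) by (auto simp: W_def \<kappa>_def flat_exp_1)
    show "\<kappa> x = 0" if "x \<notin> D" for x
      using that by (auto simp: D_def \<kappa>_def flat_exp_1)
  qed
qed


section \<open>Nets of functions\<close>

lemma eventually_unit_interval: "\<forall>\<^sub>F \<epsilon>::real in at_right 0. \<epsilon> \<in> {0<..1}"
  by (rule eventually_mono[OF eventually_at_right_real[of 0 "1::real"]]) auto

text \<open>One constant for all points replaces the supremum and its boundedness conditions. The
  type of points is left open so that finitely many derivatives can be estimated together, over
  pairs of an index and a point.\<close>

definition unif_O :: "'b set \<Rightarrow> (real \<Rightarrow> 'b \<Rightarrow> complex) \<Rightarrow> real \<Rightarrow> bool" where
  "unif_O K w b \<longleftrightarrow> (\<exists>c. \<forall>\<^sub>F \<epsilon> in at_right 0. \<forall>x\<in>K. cmod (w \<epsilon> x) \<le> c * \<epsilon> powr b)"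

lemma unif_OI:
  "(\<forall>\<^sub>F \<epsilon> in at_right 0. \<forall>x\<in>K. cmod (w \<epsilon> x) \<le> c * \<epsilon> powr b) \<Longrightarrow> unif_O K w b"
  unfolding unif_O_def by blast

lemma unif_OE:
  assumes "unif_O K w b"
  obtains c where "c > 0" "\<forall>\<^sub>F \<epsilon> in at_right 0. \<epsilon> \<in> {0<..1} \<and> (\<forall>x\<in>K. cmod (w \<epsilon> x) \<le> c * \<epsilon> powr b)"
proof -
  obtain c where c: "\<forall>\<^sub>F \<epsilon> in at_right 0. \<forall>x\<in>K. cmod (w \<epsilon> x) \<le> c * \<epsilon> powr b"
    using assms unfolding unif_O_def by blast
  have "\<forall>\<^sub>F \<epsilon> in at_right 0. \<epsilon> \<in> {0<..1} \<and> (\<forall>x\<in>K. cmod (w \<epsilon> x) \<le> (\<bar>c\<bar> + 1) * \<epsilon> powr b)"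
    using c eventually_unit_interval
  proof eventually_elim
    case (elim \<epsilon>)
    have "c * \<epsilon> powr b \<le> (\<bar>c\<bar> + 1) * \<epsilon> powr b" by (intro mult_right_mono) auto
    with elim show ?case by (meson order_trans)
  qed
  then show thesis using that[of "\<bar>c\<bar> + 1"] by simp
qed

lemma unif_O_mono:
  assumes "unif_O K w b" "a \<le> b" "L \<subseteq> K"
  shows "unif_O L w a"
  using assms(1)
proof (rule unif_OE)
  fix c assume c: "c > 0" "\<forall>\<^sub>F \<epsilon> in at_right 0. \<epsilon> \<in> {0<..1} \<and> (\<forall>x\<in>K. cmod (w \<epsilon> x) \<le> c * \<epsilon> powr b)"
  from c(2) show ?thesis
  proof (intro unif_OI[of _ _ c], eventually_elim)
    case (elim \<epsilon>)
    then have "c * \<epsilon> powr b \<le> c * \<epsilon> powr a"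
      using assms(2) c(1) by (intro mult_left_mono powr_mono') auto
    with elim assms(3) show ?case by (meson order_trans subsetD)
  qed
qed

lemma unif_O_cong:
  assumes "unif_O K w b" "\<And>\<epsilon> x. \<epsilon> \<in> {0<..1} \<Longrightarrow> x \<in> K \<Longrightarrow> w \<epsilon> x = w' \<epsilon> x"
  shows "unif_O K w' b"
  using assms(1)
proof (rule unif_OE)
  fix c assume "\<forall>\<^sub>F \<epsilon> in at_right 0. \<epsilon> \<in> {0<..1} \<and> (\<forall>x\<in>K. cmod (w \<epsilon> x) \<le> c * \<epsilon> powr b)"
  then show ?thesis
    by (intro unif_OI[of _ _ c], eventually_elim) (use assms(2) in force)
qed

lemma unif_O_add:
  assumes "unif_O K u b" "unif_O K v b"
  shows "unif_O K (\<lambda>\<epsilon> x. u \<epsilon> x + v \<epsilon> x) b"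
proof -
  obtain c d where "\<forall>\<^sub>F \<epsilon> in at_right 0. \<forall>x\<in>K. cmod (u \<epsilon> x) \<le> c * \<epsilon> powr b"
    "\<forall>\<^sub>F \<epsilon> in at_right 0. \<forall>x\<in>K. cmod (v \<epsilon> x) \<le> d * \<epsilon> powr b"
    using assms unfolding unif_O_def by blast
  then show ?thesis
  proof (intro unif_OI[of _ _ "c + d"], eventually_elim)
    case (elim \<epsilon>)
    show ?case
    proof
      fix x assume "x \<in> K"
      then have "cmod (u \<epsilon> x) + cmod (v \<epsilon> x) \<le> (c + d) * \<epsilon> powr b"
        using elim by (auto simp: distrib_right intro: add_mono)
      then show "cmod (u \<epsilon> x + v \<epsilon> x) \<le> (c + d) * \<epsilon> powr b"
        using norm_triangle_ineq order_trans by blast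
    qed
  qed
qed

lemma unif_O_mult:
  assumes "unif_O K u a" "unif_O K v b"
  shows "unif_O K (\<lambda>\<epsilon> x. u \<epsilon> x * v \<epsilon> x) (a + b)"
proof -
  obtain c where c: "c > 0" "\<forall>\<^sub>F \<epsilon> in at_right 0. \<epsilon> \<in> {0<..1} \<and> (\<forall>x\<in>K. cmod (u \<epsilon> x) \<le> c * \<epsilon> powr a)"
    using assms(1) by (rule unif_OE)
  obtain d where d: "d > 0" "\<forall>\<^sub>F \<epsilon> in at_right 0. \<epsilon> \<in> {0<..1} \<and> (\<forall>x\<in>K. cmod (v \<epsilon> x) \<le> d * \<epsilon> powr b)"
    using assms(2) by (rule unif_OE)
  from c(2) d(2) show ?thesis
  proof (intro unif_OI[of _ _ "c * d"], eventually_elim)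
    case (elim \<epsilon>)
    show ?case
    proof
      fix x assume "x \<in> K"
      then have "cmod (u \<epsilon> x) * cmod (v \<epsilon> x) \<le> (c * \<epsilon> powr a) * (d * \<epsilon> powr b)"
        using elim c(1) d(1) by (intro mult_mono) auto
      then show "cmod (u \<epsilon> x * v \<epsilon> x) \<le> c * d * \<epsilon> powr (a + b)"
        by (simp add: norm_mult powr_add mult_ac)
    qed
  qed
qed

lemma unif_O_const: "order_O (\<lambda>\<epsilon>. cmod (z \<epsilon>)) b \<Longrightarrow> unif_O K (\<lambda>\<epsilon> _. z \<epsilon>) b"
  by (auto elim!: landau_o.bigE intro: unif_OI elim: eventually_mono)

lemma unif_O_zero: "unif_O K (\<lambda>_ _. 0) b"
  by (rule unif_OI[of _ _ 0]) simp

lemma unif_O_UN: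
  assumes "finite I" "\<And>i. i \<in> I \<Longrightarrow> unif_O (K i) w b"
  shows "unif_O (\<Union>i\<in>I. K i) w b"
  using assms
proof (induction I)
  case empty
  then show ?case by (auto intro: unif_OI)
next
  case (insert i I)
  obtain c where c: "c > 0" "\<forall>\<^sub>F \<epsilon> in at_right 0. \<epsilon> \<in> {0<..1} \<and> (\<forall>x\<in>K i. cmod (w \<epsilon> x) \<le> c * \<epsilon> powr b)"
    using insert.prems[of i] by (auto elim: unif_OE)
  obtain d where d: "d > 0" "\<forall>\<^sub>F \<epsilon> in at_right 0. \<epsilon> \<in> {0<..1} \<and>
      (\<forall>x\<in>(\<Union>i\<in>I. K i). cmod (w \<epsilon> x) \<le> d * \<epsilon> powr b)"
    using insert.IH insert.prems by (auto elim: unif_OE)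
  have "c * \<epsilon> powr b \<le> (c + d) * \<epsilon> powr b" "d * \<epsilon> powr b \<le> (c + d) * \<epsilon> powr b" for \<epsilon>
    using c(1) d(1) by (auto intro: mult_right_mono)
  then have le: "cmod z \<le> c * \<epsilon> powr b \<Longrightarrow> cmod z \<le> (c + d) * \<epsilon> powr b"
    "cmod z \<le> d * \<epsilon> powr b \<Longrightarrow> cmod z \<le> (c + d) * \<epsilon> powr b" for z \<epsilon>
    using order_trans by blast+
  from c(2) d(2) show ?case
    by (intro unif_OI[of _ _ "c + d"], eventually_elim) (use le in blast)
qed

text \<open>\<open>Sup\<close> of an unbounded set of reals carries no information, hence the
  assumption; for nets of smooth functions on compact sets it comes from continuity, for small
  \<epsilon>.\<close>

lemma order_O_sup_nonneg:
  assumes "\<forall>\<^sub>F \<epsilon> in at_right 0. bdd_above (X \<epsilon>)"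
  shows "order_O (\<lambda>\<epsilon>. sup_nonneg (X \<epsilon>)) b \<longleftrightarrow> (\<exists>c. \<forall>\<^sub>F \<epsilon> in at_right 0. \<forall>y\<in>X \<epsilon>. y \<le> c * \<epsilon> powr b)"
proof
  assume "order_O (\<lambda>\<epsilon>. sup_nonneg (X \<epsilon>)) b"
  then obtain c where c: "\<forall>\<^sub>F \<epsilon> in at_right 0. norm (sup_nonneg (X \<epsilon>)) \<le> c * norm (\<epsilon> powr b)"
    by (elim landau_o.bigE)
  from c assms have "\<forall>\<^sub>F \<epsilon> in at_right 0. \<forall>y\<in>X \<epsilon>. y \<le> c * \<epsilon> powr b"
  proof eventually_elim
    case (elim \<epsilon>)
    show ?case
    proof
      fix y assume "y \<in> X \<epsilon>"
      then have "y \<le> sup_nonneg (X \<epsilon>)" using elim by (intro cSup_upper) auto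
      then show "y \<le> c * \<epsilon> powr b" using elim by simp
    qed
  qed
  then show "\<exists>c. \<forall>\<^sub>F \<epsilon> in at_right 0. \<forall>y\<in>X \<epsilon>. y \<le> c * \<epsilon> powr b" by blast
next
  assume "\<exists>c. \<forall>\<^sub>F \<epsilon> in at_right 0. \<forall>y\<in>X \<epsilon>. y \<le> c * \<epsilon> powr b"
  then obtain c where c: "\<forall>\<^sub>F \<epsilon> in at_right 0. \<forall>y\<in>X \<epsilon>. y \<le> c * \<epsilon> powr b" by blast
  from c assms have "\<forall>\<^sub>F \<epsilon> in at_right 0. norm (sup_nonneg (X \<epsilon>)) \<le> \<bar>c\<bar> * norm (\<epsilon> powr b)"
  proof eventually_elim
    case (elim \<epsilon>)
    have "c * \<epsilon> powr b \<le> \<bar>c\<bar> * \<epsilon> powr b" by (intro mult_right_mono) auto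
    then have "sup_nonneg (X \<epsilon>) \<le> \<bar>c\<bar> * \<epsilon> powr b"
      using elim(1) by (intro cSup_least) (auto intro: order_trans)
    moreover have "0 \<le> sup_nonneg (X \<epsilon>)" using elim(2) by (intro cSup_upper) auto
    ultimately show ?case by simp
  qed
  then show "order_O (\<lambda>\<epsilon>. sup_nonneg (X \<epsilon>)) b" by (rule bigoI)
qed

section \<open>Moderate, regular and negligible nets through uniform estimates\<close>

lemma smooth_netsD: "u \<in> smooth_nets \<Omega> \<Longrightarrow> \<epsilon> \<in> {0<..1} \<Longrightarrow> smooth_on \<Omega> (u \<epsilon>)"
  by (auto simp: smooth_nets_def)

lemma bdd_above_multi_deriv:
  assumes "smooth_on \<Omega> f" "compact K" "K \<subseteq> \<Omega>"
  shows "bdd_above ((\<lambda>x. cmod (multi_deriv \<alpha> f x)) ` K)"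
proof -
  obtain js where js: "multi_deriv \<alpha> = foldr partial_derivative js"
    using multi_deriv_foldr_ex by blast
  have "continuous_on K (\<lambda>x. cmod (multi_deriv \<alpha> f x))"
    unfolding js using smooth_on_continuous_on[OF assms(1)] assms(3)
    by (intro continuous_on_norm) (rule continuous_on_subset)
  then show ?thesis
    using assms(2) by (intro bounded_imp_bdd_above compact_imp_bounded compact_continuous_image)
qed

lemma order_O_sup_deriv:
  assumes "u \<in> smooth_nets \<Omega>" "compact K" "K \<subseteq> \<Omega>"
  shows "order_O (sup_deriv K \<alpha> u) b \<longleftrightarrow> unif_O K (\<lambda>\<epsilon>. multi_deriv \<alpha> (u \<epsilon>)) b"
proof -
  have "\<forall>\<^sub>F \<epsilon> in at_right 0. bdd_above ((\<lambda>x. cmod (multi_deriv \<alpha> (u \<epsilon>) x)) ` K)"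
    using eventually_unit_interval
    by eventually_elim (rule bdd_above_multi_deriv[OF smooth_netsD[OF assms(1)] assms(2,3)])
  from order_O_sup_nonneg[OF this] show ?thesis
    by (simp add: sup_deriv_def[abs_def] unif_O_def)
qed

lemma unif_O_multi_deriv_iff:
  fixes u :: "('n::finite) net"
  assumes "open \<Omega>" "u \<in> smooth_nets \<Omega>" "K \<subseteq> \<Omega>"
  shows "unif_O K (\<lambda>\<epsilon>. multi_deriv (count_list is) (u \<epsilon>)) b \<longleftrightarrow>
    unif_O K (\<lambda>\<epsilon>. foldr partial_derivative is (u \<epsilon>)) b"
proof -
  have "multi_deriv (count_list is) (u \<epsilon>) x = foldr partial_derivative is (u \<epsilon>) x"
    if "\<epsilon> \<in> {0<..1}" "x \<in> K" for \<epsilon> x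
    using multi_deriv_eq_foldr[OF assms(1) smooth_netsD[OF assms(2) that(1)]] that assms(3) by blast
  then show ?thesis
    by (intro iffI; elim unif_O_cong) simp_all
qed

text \<open>Each multi-index counts the entries of some list, and each list has its counts, so both
  quantifiers range over the same derivatives. The predicate \<open>Q\<close> leaves open where the
  order is quantified: inside for \<open>E_M\<close> and \<open>N_ideal\<close>, outside for
  \<open>E_M_inf\<close>.\<close>

lemma all_multiindex_iff:
  fixes u :: "('n::finite) net"
  assumes "open \<Omega>" "u \<in> smooth_nets \<Omega>" "K \<subseteq> \<Omega>"
  shows "(\<forall>\<alpha>. Q (unif_O K (\<lambda>\<epsilon>. multi_deriv \<alpha> (u \<epsilon>)))) \<longleftrightarrow>
    (\<forall>is. Q (unif_O K (\<lambda>\<epsilon>. foldr partial_derivative is (u \<epsilon>))))"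
proof -
  have eq: "unif_O K (\<lambda>\<epsilon>. multi_deriv (count_list is) (u \<epsilon>)) = unif_O K (\<lambda>\<epsilon>. foldr partial_derivative is (u \<epsilon>))" for "is"
    using unif_O_multi_deriv_iff[OF assms] by blast
  have "\<exists>is. \<alpha> = count_list is" for \<alpha> :: "'n \<Rightarrow> nat"
  proof -
    obtain "is" where "\<forall>i. count_list is i = \<alpha> i" using ex_list_count by blast
    then have "\<alpha> = count_list is" by (simp add: fun_eq_iff)
    then show ?thesis by blast
  qed
  then show ?thesis by (metis eq)
qed

lemma guarded_all_cong:
  assumes "\<And>x. C x \<Longrightarrow> (\<forall>a. P x a) \<longleftrightarrow> (\<forall>b. Q x b)"
  shows "(\<forall>x a. C x \<longrightarrow> P x a) \<longleftrightarrow> (\<forall>x b. C x \<longrightarrow> Q x b)"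
  using assms by blast

lemma E_M_iff:
  assumes "open \<Omega>"
  shows "u \<in> E_M \<Omega> \<longleftrightarrow> u \<in> smooth_nets \<Omega> \<and> (\<forall>K is. compact K \<and> K \<subseteq> \<Omega> \<longrightarrow>
    (\<exists>N::nat. unif_O K (\<lambda>\<epsilon>. foldr partial_derivative is (u \<epsilon>)) (- real N)))"
proof (cases "u \<in> smooth_nets \<Omega>")
  case True
  have "(\<forall>\<alpha>. \<exists>N::nat. order_O (sup_deriv K \<alpha> u) (- real N)) \<longleftrightarrow>
    (\<forall>is. \<exists>N::nat. unif_O K (\<lambda>\<epsilon>. foldr partial_derivative is (u \<epsilon>)) (- real N))"
    if "compact K" "K \<subseteq> \<Omega>" for K
    unfolding order_O_sup_deriv[OF True that]
    by (rule all_multiindex_iff[OF assms True that(2), of "\<lambda>f. \<exists>N::nat. f (- real N)"])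
  then show ?thesis
    unfolding E_M_def mem_Collect_eq using True by (intro conj_cong refl guarded_all_cong) simp
qed (auto simp: E_M_def)

lemma N_ideal_iff:
  assumes "open \<Omega>"
  shows "u \<in> N_ideal \<Omega> \<longleftrightarrow> u \<in> smooth_nets \<Omega> \<and> (\<forall>K is. compact K \<and> K \<subseteq> \<Omega> \<longrightarrow>
    (\<forall>q::nat. unif_O K (\<lambda>\<epsilon>. foldr partial_derivative is (u \<epsilon>)) (real q)))"
proof (cases "u \<in> smooth_nets \<Omega>")
  case True
  have "(\<forall>\<alpha>. \<forall>N::nat. order_O (sup_deriv K \<alpha> u) (real N)) \<longleftrightarrow>
    (\<forall>is. \<forall>N::nat. unif_O K (\<lambda>\<epsilon>. foldr partial_derivative is (u \<epsilon>)) (real N))"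
    if "compact K" "K \<subseteq> \<Omega>" for K
    unfolding order_O_sup_deriv[OF True that]
    by (rule all_multiindex_iff[OF assms True that(2), of "\<lambda>f. \<forall>N::nat. f (real N)"])
  then show ?thesis
    unfolding N_ideal_def mem_Collect_eq using True by (intro conj_cong refl guarded_all_cong) simp
qed (auto simp: N_ideal_def)

lemma E_M_inf_iff:
  assumes "open \<Omega>"
  shows "u \<in> E_M_inf \<Omega> \<longleftrightarrow> u \<in> smooth_nets \<Omega> \<and> (\<forall>K. compact K \<and> K \<subseteq> \<Omega> \<longrightarrow>
    (\<exists>N::nat. \<forall>is. unif_O K (\<lambda>\<epsilon>. foldr partial_derivative is (u \<epsilon>)) (- real N)))"
proof (cases "u \<in> smooth_nets \<Omega>")
  case True
  have "(\<forall>\<alpha>. order_O (sup_deriv K \<alpha> u) (- real N)) \<longleftrightarrow>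
    (\<forall>is. unif_O K (\<lambda>\<epsilon>. foldr partial_derivative is (u \<epsilon>)) (- real N))"
    if "compact K" "K \<subseteq> \<Omega>" for K and N :: nat
    unfolding order_O_sup_deriv[OF True that]
    by (rule all_multiindex_iff[OF assms True that(2), of "\<lambda>f. f (- real N)"])
  then show ?thesis unfolding E_M_inf_def using True by simp
qed (auto simp: E_M_inf_def)

lemma E_M_smooth: "u \<in> E_M \<Omega> \<Longrightarrow> u \<in> smooth_nets \<Omega>"
  and N_ideal_smooth: "u \<in> N_ideal \<Omega> \<Longrightarrow> u \<in> smooth_nets \<Omega>"
  and E_M_inf_smooth: "u \<in> E_M_inf \<Omega> \<Longrightarrow> u \<in> smooth_nets \<Omega>"
  by (auto simp: E_M_def N_ideal_def E_M_inf_def)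

lemma N_ideal_imp_E_M_inf: "N_ideal \<Omega> \<subseteq> E_M_inf \<Omega>"
proof
  fix u assume u: "u \<in> N_ideal \<Omega>"
  have "order_O (sup_deriv K \<alpha> u) (- real 0)" if "compact K" "K \<subseteq> \<Omega>" for K \<alpha>
  proof -
    have "order_O (sup_deriv K \<alpha> u) (real 0)"
      using u that unfolding N_ideal_def mem_Collect_eq by metis
    then show ?thesis by simp
  qed
  moreover have "u \<in> smooth_nets \<Omega>" using u by (simp add: N_ideal_def)
  ultimately show "u \<in> E_M_inf \<Omega>"
    unfolding E_M_inf_def mem_Collect_eq by (intro conjI allI impI exI[of _ 0]) simp_all
qed

lemma E_M_inf_imp_E_M: "E_M_inf \<Omega> \<subseteq> E_M \<Omega>"
  unfolding E_M_inf_def E_M_def by (rule Collect_mono) metis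

lemma smooth_nets_subset: "u \<in> smooth_nets \<Omega> \<Longrightarrow> V \<subseteq> \<Omega> \<Longrightarrow> u \<in> smooth_nets V"
  unfolding smooth_nets_def using smooth_on_subset by blast

lemma E_M_subset: "u \<in> E_M \<Omega> \<Longrightarrow> V \<subseteq> \<Omega> \<Longrightarrow> u \<in> E_M V"
  unfolding E_M_def mem_Collect_eq using smooth_nets_subset subset_trans by metis

lemma N_ideal_subset: "u \<in> N_ideal \<Omega> \<Longrightarrow> V \<subseteq> \<Omega> \<Longrightarrow> u \<in> N_ideal V"
  unfolding N_ideal_def mem_Collect_eq using smooth_nets_subset subset_trans by metis

section \<open>Product rule and closure properties of the sets of nets\<close>

text \<open>Leibniz rule without binomial coefficients: a derivative of the product is a sum of
  products of derivatives of the factors, none longer than \<open>is\<close>. Since the assumption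
  bounds the products only, the lemma serves moderate, regular and negligible nets alike.\<close>

lemma foldr_partial_derivative_mult_unif_O:
  fixes u v :: "('n::finite) net"
  assumes "open \<Omega>" "u \<in> smooth_nets \<Omega>" "v \<in> smooth_nets \<Omega>" "K \<subseteq> \<Omega>"
    and "\<And>js ks. length js \<le> length is \<Longrightarrow> length ks \<le> length is \<Longrightarrow>
      unif_O K (\<lambda>\<epsilon> x. foldr partial_derivative js (u \<epsilon>) x * foldr partial_derivative ks (v \<epsilon>) x) b"
  shows "unif_O K (\<lambda>\<epsilon>. foldr partial_derivative is (\<lambda>x. u \<epsilon> x * v \<epsilon> x)) b"
  using assms(2,3,5)
proof (induction "is" arbitrary: u v rule: rev_induct)
  case Nil
  then show ?case using Nil(3)[of "[]" "[]"] by simp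
next
  case (snoc i js)
  \<comment> \<open>The derivative applied first is split off: the product rule turns it into two
    products of nets, to which the induction hypothesis for the remaining list applies.\<close>
  let ?p = "\<lambda>u \<epsilon>. partial_derivative i (u \<epsilon>) :: real^'n \<Rightarrow> complex"
  have sm: "?p u \<in> smooth_nets \<Omega>" "?p v \<in> smooth_nets \<Omega>"
    using snoc.prems(1,2) by (auto simp: smooth_nets_def intro: smooth_on_partial_derivative)
  have 1: "unif_O K (\<lambda>\<epsilon>. foldr partial_derivative js (\<lambda>x. ?p u \<epsilon> x * v \<epsilon> x)) b"
  proof (rule snoc.IH[OF sm(1) snoc.prems(2)])
    fix ks ls :: "'n list" assume "length ks \<le> length js" "length ls \<le> length js"
    then show "unif_O K (\<lambda>\<epsilon> x. foldr partial_derivative ks (?p u \<epsilon>) x * foldr partial_derivative ls (v \<epsilon>) x) b"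
      using snoc.prems(3)[of "ks @ [i]" ls] by simp
  qed
  have 2: "unif_O K (\<lambda>\<epsilon>. foldr partial_derivative js (\<lambda>x. u \<epsilon> x * ?p v \<epsilon> x)) b"
  proof (rule snoc.IH[OF snoc.prems(1) sm(2)])
    fix ks ls :: "'n list" assume "length ks \<le> length js" "length ls \<le> length js"
    then show "unif_O K (\<lambda>\<epsilon> x. foldr partial_derivative ks (u \<epsilon>) x * foldr partial_derivative ls (?p v \<epsilon>) x) b"
      using snoc.prems(3)[of ks "ls @ [i]"] by simp
  qed
  show ?case
  proof (rule unif_O_cong[OF unif_O_add[OF 1 2]])
    fix \<epsilon> :: real and x assume \<epsilon>: "\<epsilon> \<in> {0<..1}" and "x \<in> K"
    then have x: "x \<in> \<Omega>" using assms(4) by blast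
    note s = smooth_netsD[OF snoc.prems(1) \<epsilon>] smooth_netsD[OF snoc.prems(2) \<epsilon>]
      smooth_netsD[OF sm(1) \<epsilon>] smooth_netsD[OF sm(2) \<epsilon>]
    have "foldr partial_derivative js (\<lambda>x. ?p u \<epsilon> x * v \<epsilon> x) x + foldr partial_derivative js (\<lambda>x. u \<epsilon> x * ?p v \<epsilon> x) x
      = foldr partial_derivative js (\<lambda>x. ?p u \<epsilon> x * v \<epsilon> x + u \<epsilon> x * ?p v \<epsilon> x) x"
      using s x assms(1) by (intro foldr_partial_derivative_add[symmetric] smooth_on_mult)
    also have "\<dots> = foldr partial_derivative js (partial_derivative i (\<lambda>x. u \<epsilon> x * v \<epsilon> x)) x"
    proof (rule foldr_partial_derivative_cong[OF assms(1) _ x])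
      fix y assume "y \<in> \<Omega>"
      from partial_derivative_mult[OF smooth_on_differentiable[OF assms(1) s(1) this, of "[]", simplified]
          smooth_on_differentiable[OF assms(1) s(2) this, of "[]", simplified]]
      show "?p u \<epsilon> y * v \<epsilon> y + u \<epsilon> y * ?p v \<epsilon> y = partial_derivative i (\<lambda>x. u \<epsilon> x * v \<epsilon> x) y"
        by simp
    qed
    finally show "foldr partial_derivative js (\<lambda>x. ?p u \<epsilon> x * v \<epsilon> x) x + foldr partial_derivative js (\<lambda>x. u \<epsilon> x * ?p v \<epsilon> x) x
      = foldr partial_derivative (js @ [i]) (\<lambda>x. u \<epsilon> x * v \<epsilon> x) x" by simp
  qed
qed

lemma smooth_nets_mult:
  "open \<Omega> \<Longrightarrow> u \<in> smooth_nets \<Omega> \<Longrightarrow> v \<in> smooth_nets \<Omega> \<Longrightarrow> (\<lambda>\<epsilon> x. u \<epsilon> x * v \<epsilon> x) \<in> smooth_nets \<Omega>"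
  by (auto simp: smooth_nets_def intro: smooth_on_mult)

lemma smooth_nets_add:
  "open \<Omega> \<Longrightarrow> u \<in> smooth_nets \<Omega> \<Longrightarrow> v \<in> smooth_nets \<Omega> \<Longrightarrow> (\<lambda>\<epsilon> x. u \<epsilon> x + v \<epsilon> x) \<in> smooth_nets \<Omega>"
  by (auto simp: smooth_nets_def intro: smooth_on_add)

text \<open>The order \<open>N\<close> may depend on the derivative; only finitely many derivatives of the factors
  contribute to a given derivative of the product.\<close>

lemma finite_lists_uniform:
  fixes P :: "'n::finite list \<Rightarrow> nat \<Rightarrow> bool"
  assumes "\<And>is. \<exists>N. P is N" "\<And>is N M. P is N \<Longrightarrow> N \<le> M \<Longrightarrow> P is M"
  shows "\<exists>N. \<forall>is. length is \<le> n \<longrightarrow> P is N"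
proof -
  obtain N where N: "\<And>is. P is (N is)" using assms(1) by metis
  have fin: "finite {is :: 'n list. length is \<le> n}"
    using finite_lists_length_le[of "UNIV :: 'n set" n] by simp
  have "P is (Max (N ` {is. length is \<le> n}))" if "length is \<le> n" for "is"
    using N[of "is"] by (rule assms(2)) (use fin that in auto)
  then show ?thesis by blast
qed

lemma E_M_uniform:
  assumes "open \<Omega>" "u \<in> E_M \<Omega>" "compact K" "K \<subseteq> \<Omega>"
  obtains N :: nat where "\<And>is. length is \<le> n \<Longrightarrow> unif_O K (\<lambda>\<epsilon>. foldr partial_derivative is (u \<epsilon>)) (- real N)"
proof -
  have "\<exists>N. \<forall>is. length is \<le> n \<longrightarrow> unif_O K (\<lambda>\<epsilon>. foldr partial_derivative is (u \<epsilon>)) (- real N)"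
    by (rule finite_lists_uniform) (use assms E_M_iff[OF assms(1)] in \<open>auto elim: unif_O_mono\<close>)
  then show thesis using that by blast
qed

lemma E_M_mult:
  fixes u v :: "('n::finite) net"
  assumes "open \<Omega>" "u \<in> E_M \<Omega>" "v \<in> E_M \<Omega>"
  shows "(\<lambda>\<epsilon> x. u \<epsilon> x * v \<epsilon> x) \<in> E_M \<Omega>"
  unfolding E_M_iff[OF assms(1)]
proof (intro conjI allI impI)
  fix K and "is" :: "'n list" assume K: "compact K \<and> K \<subseteq> \<Omega>"
  obtain N :: nat where N: "\<And>js. length js \<le> length is \<Longrightarrow> unif_O K (\<lambda>\<epsilon>. foldr partial_derivative js (u \<epsilon>)) (- real N)"
    using E_M_uniform[OF assms(1,2)] K by blast
  obtain M :: nat where M: "\<And>js. length js \<le> length is \<Longrightarrow> unif_O K (\<lambda>\<epsilon>. foldr partial_derivative js (v \<epsilon>)) (- real M)"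
    using E_M_uniform[OF assms(1,3)] K by blast
  show "\<exists>N::nat. unif_O K (\<lambda>\<epsilon>. foldr partial_derivative is (\<lambda>x. u \<epsilon> x * v \<epsilon> x)) (- real N)"
    by (rule exI[of _ "N + M"], rule foldr_partial_derivative_mult_unif_O[OF assms(1)])
      (use unif_O_mult[OF N M] assms K E_M_smooth in auto)
qed (use assms smooth_nets_mult E_M_smooth in blast)

lemma E_M_inf_mult:
  assumes "open \<Omega>" "u \<in> E_M_inf \<Omega>" "v \<in> E_M_inf \<Omega>"
  shows "(\<lambda>\<epsilon> x. u \<epsilon> x * v \<epsilon> x) \<in> E_M_inf \<Omega>"
  unfolding E_M_inf_iff[OF assms(1)]
proof (intro conjI allI impI)
  fix K assume K: "compact K \<and> K \<subseteq> \<Omega>"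
  obtain N M :: nat where N: "\<And>js. unif_O K (\<lambda>\<epsilon>. foldr partial_derivative js (u \<epsilon>)) (- real N)"
    and M: "\<And>js. unif_O K (\<lambda>\<epsilon>. foldr partial_derivative js (v \<epsilon>)) (- real M)"
    using assms(2,3) K unfolding E_M_inf_iff[OF assms(1)] by meson
  show "\<exists>N::nat. \<forall>is. unif_O K (\<lambda>\<epsilon>. foldr partial_derivative is (\<lambda>x. u \<epsilon> x * v \<epsilon> x)) (- real N)"
    by (rule exI[of _ "N + M"], rule allI, rule foldr_partial_derivative_mult_unif_O[OF assms(1)])
      (use unif_O_mult[OF N M] assms K E_M_inf_smooth in auto)
qed (use assms smooth_nets_mult E_M_inf_smooth in blast)

text \<open>The moderate factor costs at most \<open>\<epsilon> powr (- real M)\<close>, which is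
  made up for by taking the negligible factor at order \<open>q + M\<close>.\<close>

lemma N_ideal_mult:
  fixes u v :: "('n::finite) net"
  assumes "open \<Omega>" "u \<in> N_ideal \<Omega>" "v \<in> E_M \<Omega>"
  shows "(\<lambda>\<epsilon> x. u \<epsilon> x * v \<epsilon> x) \<in> N_ideal \<Omega>"
  unfolding N_ideal_iff[OF assms(1)]
proof (intro conjI allI impI)
  fix K and "is" :: "'n list" and q :: nat assume K: "compact K \<and> K \<subseteq> \<Omega>"
  have N: "unif_O K (\<lambda>\<epsilon>. foldr partial_derivative js (u \<epsilon>)) (real p)" for js and p :: nat
    using assms(2) K N_ideal_iff[OF assms(1)] by blast
  obtain M :: nat where M: "\<And>js. length js \<le> length is \<Longrightarrow> unif_O K (\<lambda>\<epsilon>. foldr partial_derivative js (v \<epsilon>)) (- real M)"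
    using E_M_uniform[OF assms(1,3)] K by blast
  show "unif_O K (\<lambda>\<epsilon>. foldr partial_derivative is (\<lambda>x. u \<epsilon> x * v \<epsilon> x)) (real q)"
    by (rule foldr_partial_derivative_mult_unif_O[OF assms(1)])
      (use unif_O_mult[OF N[of _ "q + M"] M] assms K E_M_smooth N_ideal_smooth in auto)
qed (use assms smooth_nets_mult E_M_smooth N_ideal_smooth in blast)

lemma unif_O_foldr_add:
  assumes "open \<Omega>" "u \<in> smooth_nets \<Omega>" "v \<in> smooth_nets \<Omega>" "K \<subseteq> \<Omega>"
    "unif_O K (\<lambda>\<epsilon>. foldr partial_derivative is (u \<epsilon>)) b" "unif_O K (\<lambda>\<epsilon>. foldr partial_derivative is (v \<epsilon>)) b"
  shows "unif_O K (\<lambda>\<epsilon>. foldr partial_derivative is (\<lambda>x. u \<epsilon> x + v \<epsilon> x)) b"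
proof (rule unif_O_cong[OF unif_O_add[OF assms(5,6)]])
  fix \<epsilon> :: real and x assume *: "\<epsilon> \<in> {0<..1}" "x \<in> K"
  show "foldr partial_derivative is (u \<epsilon>) x + foldr partial_derivative is (v \<epsilon>) x =
      foldr partial_derivative is (\<lambda>x. u \<epsilon> x + v \<epsilon> x) x"
    using *(2) assms(4) by (intro foldr_partial_derivative_add[OF assms(1), symmetric]
        smooth_netsD[OF assms(2) *(1)] smooth_netsD[OF assms(3) *(1)]) blast
qed

lemma E_M_add:
  fixes u v :: "('n::finite) net"
  assumes "open \<Omega>" "u \<in> E_M \<Omega>" "v \<in> E_M \<Omega>"
  shows "(\<lambda>\<epsilon> x. u \<epsilon> x + v \<epsilon> x) \<in> E_M \<Omega>"
  unfolding E_M_iff[OF assms(1)]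
proof (intro conjI allI impI)
  fix K and "is" :: "'n list" assume K: "compact K \<and> K \<subseteq> \<Omega>"
  obtain N M :: nat where "unif_O K (\<lambda>\<epsilon>. foldr partial_derivative is (u \<epsilon>)) (- real N)"
    "unif_O K (\<lambda>\<epsilon>. foldr partial_derivative is (v \<epsilon>)) (- real M)"
    using assms K unfolding E_M_iff[OF assms(1)] by meson
  then have "unif_O K (\<lambda>\<epsilon>. foldr partial_derivative is (u \<epsilon>)) (- real (max N M))"
    "unif_O K (\<lambda>\<epsilon>. foldr partial_derivative is (v \<epsilon>)) (- real (max N M))"
    by (auto elim!: unif_O_mono)
  then show "\<exists>N::nat. unif_O K (\<lambda>\<epsilon>. foldr partial_derivative is (\<lambda>x. u \<epsilon> x + v \<epsilon> x)) (- real N)"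
    using unif_O_foldr_add[OF assms(1) E_M_smooth[OF assms(2)] E_M_smooth[OF assms(3)]] K by blast
qed (use assms smooth_nets_add E_M_smooth in blast)

lemma E_M_inf_add:
  assumes "open \<Omega>" "u \<in> E_M_inf \<Omega>" "v \<in> E_M_inf \<Omega>"
  shows "(\<lambda>\<epsilon> x. u \<epsilon> x + v \<epsilon> x) \<in> E_M_inf \<Omega>"
  unfolding E_M_inf_iff[OF assms(1)]
proof (intro conjI allI impI)
  fix K assume K: "compact K \<and> K \<subseteq> \<Omega>"
  obtain N M :: nat where "\<And>is. unif_O K (\<lambda>\<epsilon>. foldr partial_derivative is (u \<epsilon>)) (- real N)"
    "\<And>is. unif_O K (\<lambda>\<epsilon>. foldr partial_derivative is (v \<epsilon>)) (- real M)"
    using assms K unfolding E_M_inf_iff[OF assms(1)] by meson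
  then have "unif_O K (\<lambda>\<epsilon>. foldr partial_derivative is (u \<epsilon>)) (- real (max N M))"
    "unif_O K (\<lambda>\<epsilon>. foldr partial_derivative is (v \<epsilon>)) (- real (max N M))" for "is"
    by (meson max.cobounded1 max.cobounded2 of_nat_mono neg_le_iff_le order_refl unif_O_mono)+
  then show "\<exists>N::nat. \<forall>is. unif_O K (\<lambda>\<epsilon>. foldr partial_derivative is (\<lambda>x. u \<epsilon> x + v \<epsilon> x)) (- real N)"
    using unif_O_foldr_add[OF assms(1) E_M_inf_smooth[OF assms(2)] E_M_inf_smooth[OF assms(3)]] K by blast
qed (use assms smooth_nets_add E_M_inf_smooth in blast)

lemma N_ideal_add:
  fixes u v :: "('n::finite) net"
  assumes "open \<Omega>" "u \<in> N_ideal \<Omega>" "v \<in> N_ideal \<Omega>"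
  shows "(\<lambda>\<epsilon> x. u \<epsilon> x + v \<epsilon> x) \<in> N_ideal \<Omega>"
  unfolding N_ideal_iff[OF assms(1)]
proof (intro conjI allI impI)
  fix K and "is" :: "'n list" and q :: nat assume K: "compact K \<and> K \<subseteq> \<Omega>"
  have "unif_O K (\<lambda>\<epsilon>. foldr partial_derivative is (u \<epsilon>)) (real q)"
    "unif_O K (\<lambda>\<epsilon>. foldr partial_derivative is (v \<epsilon>)) (real q)"
    using assms(2,3) K unfolding N_ideal_iff[OF assms(1)] by meson+
  then show "unif_O K (\<lambda>\<epsilon>. foldr partial_derivative is (\<lambda>x. u \<epsilon> x + v \<epsilon> x)) (real q)"
    using unif_O_foldr_add[OF assms(1) N_ideal_smooth[OF assms(2)] N_ideal_smooth[OF assms(3)]] K by blast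
qed (use assms smooth_nets_add N_ideal_smooth in blast)

lemma foldr_partial_derivative_const:
  "foldr partial_derivative is (\<lambda>_. c) = (\<lambda>_. if is = [] then c else 0)"
proof (induction "is" rule: rev_induct)
  case (snoc i js)
  have "foldr partial_derivative js (\<lambda>_. 0) = (\<lambda>_. 0)" by (induction js) auto
  then show ?case by simp
qed simp

lemma E_M_inf_const:
  assumes "open \<Omega>" "moderate z"
  shows "(\<lambda>\<epsilon> _. z \<epsilon>) \<in> E_M_inf \<Omega>"
proof -
  obtain N :: nat where "order_O (\<lambda>\<epsilon>. cmod (z \<epsilon>)) (- real N)" using assms(2) by (auto simp: moderate_def)
  then have "unif_O K (\<lambda>\<epsilon>. foldr partial_derivative is (\<lambda>_. z \<epsilon>)) (- real N)" for K :: "(real^'n) set" and "is"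
    by (cases "is = []") (auto simp: foldr_partial_derivative_const intro: unif_O_const unif_O_zero)
  then show ?thesis unfolding E_M_inf_iff[OF assms(1)] smooth_nets_def
    using smooth_on_const by blast
qed

lemma N_ideal_const:
  assumes "open \<Omega>" "negligible z"
  shows "(\<lambda>\<epsilon> _. z \<epsilon>) \<in> N_ideal \<Omega>"
proof -
  have "unif_O K (\<lambda>\<epsilon>. foldr partial_derivative is (\<lambda>_. z \<epsilon>)) (real q)"
    for K :: "(real^'n) set" and "is" and q :: nat
    using assms(2) by (cases "is = []") (auto simp: foldr_partial_derivative_const negligible_def intro: unif_O_const unif_O_zero)
  then show ?thesis unfolding N_ideal_iff[OF assms(1)] smooth_nets_def
    using smooth_on_const by blast
qed

lemma E_M_const: "open \<Omega> \<Longrightarrow> moderate z \<Longrightarrow> (\<lambda>\<epsilon> _. z \<epsilon>) \<in> E_M \<Omega>"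
  by (rule subsetD[OF E_M_inf_imp_E_M E_M_inf_const])

lemma N_ideal_smult:
  assumes "open \<Omega>" "u \<in> N_ideal \<Omega>" "moderate z"
  shows "(\<lambda>\<epsilon> x. z \<epsilon> * u \<epsilon> x) \<in> N_ideal \<Omega>"
  using N_ideal_mult[OF assms(1,2) E_M_const[OF assms(1,3)]] by (simp add: mult.commute)

lemma E_M_smult:
  assumes "open \<Omega>" "u \<in> E_M \<Omega>" "moderate z"
  shows "(\<lambda>\<epsilon> x. z \<epsilon> * u \<epsilon> x) \<in> E_M \<Omega>"
  using E_M_mult[OF assms(1) E_M_const[OF assms(1,3)] assms(2)] .

lemma E_M_inf_smult:
  assumes "open \<Omega>" "u \<in> E_M_inf \<Omega>" "moderate z"
  shows "(\<lambda>\<epsilon> x. z \<epsilon> * u \<epsilon> x) \<in> E_M_inf \<Omega>"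
  using E_M_inf_mult[OF assms(1) E_M_inf_const[OF assms(1,3)] assms(2)] .

lemma E_M_diff:
  assumes "open \<Omega>" "u \<in> E_M \<Omega>" "v \<in> E_M \<Omega>"
  shows "(\<lambda>\<epsilon> x. u \<epsilon> x - v \<epsilon> x) \<in> E_M \<Omega>"
  using E_M_add[OF assms(1,2) E_M_smult[OF assms(1,3) moderate_const[of "- 1"]]] by simp


section \<open>Exponential valuations\<close>

text \<open>The common form of all seminorms here, with \<open>S\<close> the set of admissible
  orders of a net. For empty \<open>S\<close> the supremum is minus infinity and
  \<open>exp_neg\<close> returns the meaningless value 1; this is why lower bounds below assume
  \<open>S\<close> nonempty, which expresses moderateness.\<close>

definition expnorm :: "real set \<Rightarrow> real" where
  "expnorm S = exp_neg (SUP b\<in>S. ereal b)"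

lemma expnorm_nonneg: "0 \<le> expnorm S"
  by (simp add: expnorm_def exp_neg_def)

lemma expnorm_le:
  assumes "b \<in> S"
  shows "expnorm S \<le> exp (- b)"
proof -
  have "ereal b \<le> (SUP b\<in>S. ereal b)" using assms by (rule SUP_upper)
  then have "expnorm S \<le> exp_neg (ereal b)" unfolding expnorm_def by (intro exp_neg_antimono) auto
  then show ?thesis by (simp add: exp_neg_def)
qed

text \<open>For positive \<open>c\<close> the bound says that \<open>- ln c\<close> is an upper
  bound of \<open>S\<close>; for the other values of \<open>c\<close> there is nothing but
  nonnegativity to show.\<close>

lemma expnorm_ge:
  assumes "S \<noteq> {}" "\<And>b. b \<in> S \<Longrightarrow> c \<le> exp (- b)"
  shows "c \<le> expnorm S"
proof (cases "c \<le> 0")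
  case True
  then show ?thesis using expnorm_nonneg order_trans by blast
next
  case False
  have "b \<le> - ln c" if "b \<in> S" for b
    using assms(2)[OF that] False ln_le_cancel_iff[of c "exp (- b)"] by simp
  then have le: "(SUP b\<in>S. ereal b) \<le> ereal (- ln c)" by (intro SUP_least) simp
  obtain b where "b \<in> S" using assms(1) by blast
  then have "ereal b \<le> (SUP b\<in>S. ereal b)" by (rule SUP_upper)
  then have "exp_neg (ereal (- ln c)) \<le> expnorm S"
    unfolding expnorm_def using le by (intro exp_neg_antimono) auto
  then show ?thesis using False by (simp add: exp_neg_def)
qed

lemma expnorm_antimono: "S \<noteq> {} \<Longrightarrow> S \<subseteq> T \<Longrightarrow> expnorm T \<le> expnorm S"
  by (rule expnorm_ge) (auto intro: expnorm_le)

text \<open>The suprema need not be attained, so they are taken one after the other: first over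
  \<open>S\<close> with \<open>b\<close> fixed, then over \<open>T\<close> after division by
  \<open>expnorm S\<close>. The division is why the value 0 is treated apart.\<close>

lemma expnorm_mult:
  assumes "S \<noteq> {}" "T \<noteq> {}" "\<And>a b. a \<in> S \<Longrightarrow> b \<in> T \<Longrightarrow> a + b \<in> R"
  shows "expnorm R \<le> expnorm S * expnorm T"
proof -
  have *: "expnorm R \<le> expnorm S * exp (- b)" if "b \<in> T" for b
  proof -
    have "expnorm R * exp b \<le> expnorm S"
    proof (rule expnorm_ge[OF assms(1)])
      fix a assume "a \<in> S"
      then have "expnorm R \<le> exp (- (a + b))" using assms(3) that by (intro expnorm_le)
      then have "expnorm R * exp b \<le> exp (- (a + b)) * exp b" by (rule mult_right_mono) simp
      then show "expnorm R * exp b \<le> exp (- a)" by (simp add: exp_add[symmetric])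
    qed
    then show ?thesis by (simp add: exp_minus field_simps)
  qed
  show ?thesis
  proof (cases "expnorm S = 0")
    case True
    then show ?thesis using * assms(2) by auto
  next
    case False
    then have pos: "0 < expnorm S" using expnorm_nonneg[of S] by simp
    have "expnorm R / expnorm S \<le> expnorm T"
      by (rule expnorm_ge[OF assms(2)]) (use * pos in \<open>simp add: field_simps\<close>)
    then show ?thesis using pos by (simp add: field_simps)
  qed
qed

text \<open>Two downward closed sets of reals are comparable by inclusion, so their intersection is
  one of them. The ultrametric inequality of the function space seminorms rests on this.\<close>

lemma expnorm_max:
  assumes "S \<noteq> {}" "T \<noteq> {}" "S \<inter> T \<subseteq> R"
    and "\<And>a b. b \<in> S \<Longrightarrow> a \<le> b \<Longrightarrow> a \<in> S" "\<And>a b. b \<in> T \<Longrightarrow> a \<le> b \<Longrightarrow> a \<in> T"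
  shows "expnorm R \<le> max (expnorm S) (expnorm T)"
proof -
  have "S \<subseteq> T \<or> T \<subseteq> S" using assms(4,5) by (meson linear subsetI)
  then have "S \<subseteq> R \<or> T \<subseteq> R" using assms(3) by blast
  then show ?thesis
    using expnorm_antimono[OF assms(1), of R] expnorm_antimono[OF assms(2), of R]
    by (auto simp: le_max_iff_disj)
qed

lemma expnorm_eq_0:
  assumes "\<And>q::nat. real q \<in> S"
  shows "expnorm S = 0"
proof (rule ccontr)
  assume "expnorm S \<noteq> 0"
  then have pos: "0 < expnorm S" using expnorm_nonneg[of S] by simp
  obtain q :: nat where "- ln (expnorm S) < real q" using reals_Archimedean2 by blast
  then have "exp (- real q) < exp (ln (expnorm S))" by simp
  then show False using expnorm_le[OF assms, of q] pos by simp
qed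

text \<open>If some order were missing, downward closure would make it an upper bound of
  \<open>S\<close>, and the value would be positive.\<close>

lemma expnorm_0_imp:
  assumes "expnorm S = 0" "S \<noteq> {}" "\<And>a b. b \<in> S \<Longrightarrow> a \<le> b \<Longrightarrow> a \<in> S"
  shows "b \<in> S"
proof (rule ccontr)
  assume b: "b \<notin> S"
  have "exp (- b) \<le> expnorm S"
  proof (rule expnorm_ge[OF assms(2)])
    fix s assume "s \<in> S"
    then have "s < b" using assms(3) b by (meson not_le)
    then show "exp (- b) \<le> exp (- s)" by simp
  qed
  then show False using assms(1) by (simp add: not_le[symmetric])
qed

section \<open>The ultrametric norm of generalized numbers\<close>

lemma gnorm_abs: "moderate z \<Longrightarrow> gnorm (abs_gcomplex z) = expnorm {b. order_O (\<lambda>\<epsilon>. cmod (z \<epsilon>)) b}"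
  by (simp add: gnorm_def expnorm_def gval_abs)

lemma gnorm_eq_expnorm: "gnorm z = expnorm {b. order_O (\<lambda>\<epsilon>. cmod (rep_gcomplex z \<epsilon>)) b}"
  by (simp add: gnorm_def expnorm_def gval_def)

lemma moderate_orders: "moderate z \<Longrightarrow> {b. order_O (\<lambda>\<epsilon>. cmod (z \<epsilon>)) b} \<noteq> {}"
  by (auto simp: moderate_def)

lemma moderate_order_O:
  assumes "order_O (\<lambda>\<epsilon>. cmod (z \<epsilon>)) b"
  shows "moderate z"
proof -
  obtain N :: nat where "- b \<le> real N" using real_arch_simple by blast
  then show ?thesis unfolding moderate_def using order_O_mono[OF assms, of "- real N"] by auto
qed

lemma times_abs_gcomplex:
  "moderate z \<Longrightarrow> moderate w \<Longrightarrow> abs_gcomplex z * abs_gcomplex w = abs_gcomplex (\<lambda>\<epsilon>. z \<epsilon> * w \<epsilon>)"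
  by (rule times_gcomplex.abs_eq) (simp_all add: gc_rel_def negligible_zero eq_onp_def)

lemma plus_abs_gcomplex:
  "moderate z \<Longrightarrow> moderate w \<Longrightarrow> abs_gcomplex z + abs_gcomplex w = abs_gcomplex (\<lambda>\<epsilon>. z \<epsilon> + w \<epsilon>)"
  by (rule plus_gcomplex.abs_eq) (simp_all add: gc_rel_def negligible_zero eq_onp_def)

lemma abs_gcomplex_eq_iff:
  assumes "moderate z" "moderate w"
  shows "abs_gcomplex z = abs_gcomplex w \<longleftrightarrow> negligible (\<lambda>\<epsilon>. z \<epsilon> - w \<epsilon>)"
  using Quotient3_rel[OF Quotient3_gcomplex, of z w] assms negligible_zero by (auto simp: gc_rel_def)

lemma gnorm_mult: "gnorm (z * w) \<le> gnorm z * gnorm w"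
proof -
  have "z * w = abs_gcomplex (\<lambda>\<epsilon>. rep_gcomplex z \<epsilon> * rep_gcomplex w \<epsilon>)"
    by (simp add: times_gcomplex_def)
  then show ?thesis
    unfolding gnorm_eq_expnorm[of z] gnorm_eq_expnorm[of w]
    by (simp only: gnorm_abs moderate_mult rep_gcomplex_moderate)
      (intro expnorm_mult moderate_orders rep_gcomplex_moderate; use order_O_mult in simp)
qed

lemma gnorm_zero [simp]: "gnorm 0 = 0"
  by (simp add: gnorm_eq_0_iff)

lemma order_O_monomial: "order_O (\<lambda>\<epsilon>. cmod (c * complex_of_real (\<epsilon> powr a))) a"
  by (rule bigoI[of _ "cmod c"]) (simp add: norm_mult)

lemma gnorm_monomial_le: "gnorm (abs_gcomplex (\<lambda>\<epsilon>. c * complex_of_real (\<epsilon> powr a))) \<le> exp (- a)"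
  unfolding gnorm_abs[OF moderate_order_O[OF order_O_monomial]]
  by (intro expnorm_le) (simp add: order_O_monomial)

lemma gnorm_one_le: "gnorm 1 \<le> 1"
proof -
  have "order_O (\<lambda>_. cmod 1) 0"
    by (rule bigoI[of _ 1]) (auto intro: eventually_mono[OF eventually_at_right_less])
  then have "gnorm (abs_gcomplex (\<lambda>_. 1)) \<le> exp (- 0)"
    unfolding gnorm_abs[OF moderate_const] by (intro expnorm_le) simp
  then show ?thesis by (simp add: one_gcomplex_def)
qed

text \<open>Monomials are units whose inverses are monomials. This is what derives the equality
  clause in the definition of an ultra-pseudo-seminorm from the inequality.\<close>

lemma monomial_inverse:
  assumes "c \<noteq> 0"
  shows "abs_gcomplex (\<lambda>\<epsilon>. inverse c * complex_of_real (\<epsilon> powr (- a))) *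
    abs_gcomplex (\<lambda>\<epsilon>. c * complex_of_real (\<epsilon> powr a)) = 1"
proof -
  let ?f = "\<lambda>\<epsilon>. inverse c * complex_of_real (\<epsilon> powr (- a)) * (c * complex_of_real (\<epsilon> powr a))"
  have m: "moderate ?f" by (intro moderate_mult moderate_order_O[OF order_O_monomial])
  have "\<forall>\<^sub>F \<epsilon> in at_right 0. cmod (?f \<epsilon> - 1) = 0"
    using eventually_at_right_less[of "0::real"]
    by eventually_elim (use assms in \<open>simp add: powr_minus field_simps\<close>)
  then have "negligible (\<lambda>\<epsilon>. ?f \<epsilon> - 1)"
    unfolding negligible_def by (auto intro!: bigoI[of _ 0] elim: eventually_mono)
  then have "abs_gcomplex ?f = abs_gcomplex (\<lambda>_. 1)"
    by (simp add: abs_gcomplex_eq_iff[OF m moderate_const])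
  then show ?thesis
    by (simp add: times_abs_gcomplex moderate_order_O[OF order_O_monomial] one_gcomplex_def)
qed


section \<open>Modules over the generalized numbers\<close>

text \<open>The scalars form a type and not a ring record with a carrier, so the module axioms are
  stated for \<open>gcomplex\<close> directly, on top of an abelian group.\<close>

locale gc_module = abelian_group M for M :: "'a lc_module" (structure) +
  assumes smult_closed: "u \<in> carrier M \<Longrightarrow> z \<odot> u \<in> carrier M"
    and smult_add_left: "u \<in> carrier M \<Longrightarrow> (z + w) \<odot> u = z \<odot> u \<oplus> w \<odot> u"
    and smult_add_right: "u \<in> carrier M \<Longrightarrow> v \<in> carrier M \<Longrightarrow> z \<odot> (u \<oplus> v) = z \<odot> u \<oplus> z \<odot> v"
    and smult_mult: "u \<in> carrier M \<Longrightarrow> (z * w) \<odot> u = z \<odot> (w \<odot> u)"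
    and smult_one: "u \<in> carrier M \<Longrightarrow> 1 \<odot> u = u"
begin

lemma smult_zero_left: "u \<in> carrier M \<Longrightarrow> 0 \<odot> u = \<zero>"
  using smult_add_left[of u 0 0] add.l_cancel_one'[of "0 \<odot> u" "0 \<odot> u"] smult_closed[of u 0]
  by simp

lemma smult_minus_one: "u \<in> carrier M \<Longrightarrow> (- 1) \<odot> u = \<ominus> u"
  using smult_add_left[of u "- 1" 1] smult_zero_left[of u] smult_one[of u] smult_closed[of u "- 1"]
    minus_equality[of "(- 1) \<odot> u" u] by simp

lemma minus_decompose:
  "u \<in> carrier M \<Longrightarrow> v \<in> carrier M \<Longrightarrow> w \<in> carrier M \<Longrightarrow> u \<ominus> w = (u \<ominus> v) \<oplus> (v \<ominus> w)"
  by (simp add: a_minus_def a_assoc r_neg1 r_neg2 a_closed)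

lemma minus_eq_zero_iff: "u \<in> carrier M \<Longrightarrow> v \<in> carrier M \<Longrightarrow> u \<ominus> v = \<zero> \<longleftrightarrow> u = v"
  by (simp add: a_minus_def) (metis add.inv_solve_right' a_inv_closed l_zero minus_equality minus_minus r_neg)

lemma ups_uminus:
  assumes "ultra_pseudo_seminorm M P" "u \<in> carrier M"
  shows "P (\<ominus> u) \<le> P u"
proof -
  have "P ((- 1) \<odot> u) \<le> gnorm (- 1) * P u" "0 \<le> P u"
    using assms unfolding ultra_pseudo_seminorm_def by blast+
  moreover have "gnorm (- 1) * P u \<le> 1 * P u"
    using gnorm_one_le \<open>0 \<le> P u\<close> by (intro mult_right_mono) (simp_all add: gnorm_uminus)
  ultimately show ?thesis using smult_minus_one[OF assms(2)] by simp
qed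

lemma ups_minus_commute:
  assumes "ultra_pseudo_seminorm M P" "u \<in> carrier M" "v \<in> carrier M"
  shows "P (u \<ominus> v) = P (v \<ominus> u)"
proof -
  have "\<ominus> (u \<ominus> v) = v \<ominus> u" if "u \<in> carrier M" "v \<in> carrier M" for u v
    using that by (simp add: a_minus_def minus_add a_comm)
  then show ?thesis
    using ups_uminus[OF assms(1), of "u \<ominus> v"] ups_uminus[OF assms(1), of "v \<ominus> u"] assms
    by (intro antisym) (simp_all add: minus_closed)
qed

lemma ups_triangle:
  assumes "ultra_pseudo_seminorm M P" "u \<in> carrier M" "v \<in> carrier M" "w \<in> carrier M"
  shows "P (u \<ominus> w) \<le> max (P (u \<ominus> v)) (P (v \<ominus> w))"
  using assms unfolding minus_decompose[OF assms(2-4)] ultra_pseudo_seminorm_def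
  by (simp add: minus_closed)

lemma ups_minus_self: "ultra_pseudo_seminorm M P \<Longrightarrow> u \<in> carrier M \<Longrightarrow> P (u \<ominus> u) = 0"
  by (simp add: a_minus_def r_neg ultra_pseudo_seminorm_def)

text \<open>Equality on monomials comes for free: the inequality is applied to \<open>z\<close> and
  then to the inverse monomial, which undoes the multiplication.\<close>

lemma upsI:
  assumes "\<And>u. u \<in> carrier M \<Longrightarrow> 0 \<le> P u" "P \<zero> = 0"
    and le: "\<And>z u. u \<in> carrier M \<Longrightarrow> P (z \<odot> u) \<le> gnorm z * P u"
    and "\<And>u v. u \<in> carrier M \<Longrightarrow> v \<in> carrier M \<Longrightarrow> P (u \<oplus> v) \<le> max (P u) (P v)"
  shows "ultra_pseudo_seminorm M P"
proof -
  have eq: "P (z \<odot> u) = gnorm z * P u"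
    if "c \<noteq> 0" "u \<in> carrier M" and z: "z = abs_gcomplex (\<lambda>\<epsilon>. c * complex_of_real (\<epsilon> powr a))" for c a u z
  proof (rule antisym[OF le[OF that(2)]])
    define w where "w = abs_gcomplex (\<lambda>\<epsilon>. inverse c * complex_of_real (\<epsilon> powr (- a)))"
    have w: "w * z = 1" unfolding w_def z by (rule monomial_inverse[OF that(1)])
    have "P u = P (w \<odot> (z \<odot> u))"
      using smult_mult[OF that(2), of w z] smult_one[OF that(2)] by (simp add: w)
    also have "\<dots> \<le> gnorm w * P (z \<odot> u)" by (rule le[OF smult_closed[OF that(2)]])
    \<comment> \<open>The upper bounds \<open>exp a\<close> for the norm of the inverse and
      \<open>exp (- a)\<close> for that of \<open>z\<close> are reciprocal, so no loss
      occurs.\<close>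
    also have "\<dots> \<le> exp a * P (z \<odot> u)"
      using gnorm_monomial_le[of "inverse c" "- a"] assms(1)[OF smult_closed[OF that(2)]]
      by (intro mult_right_mono) (simp_all add: w_def)
    finally have "P u \<le> exp a * P (z \<odot> u)" .
    then have "exp (- a) * P u \<le> P (z \<odot> u)" by (simp add: exp_minus field_simps)
    moreover have "gnorm z * P u \<le> exp (- a) * P u"
      using gnorm_monomial_le[of c a] assms(1)[OF that(2)] by (intro mult_right_mono) (simp_all add: z)
    ultimately show "gnorm z * P u \<le> P (z \<odot> u)" by linarith
  qed
  show ?thesis
    unfolding ultra_pseudo_seminorm_def Let_def
    by (intro conjI ballI allI impI assms eq[OF _ _ refl])
qed

end

text \<open>Additive inverses are supplied by the scalar \<open>- 1\<close>, once multiplication by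
  the scalar 0 is known to give the zero element.\<close>

lemma gc_moduleI:
  fixes M :: "'a lc_module" (structure)
  assumes "\<And>u v. u \<in> carrier M \<Longrightarrow> v \<in> carrier M \<Longrightarrow> u \<oplus> v \<in> carrier M" "\<zero> \<in> carrier M"
    "\<And>u v w. u \<in> carrier M \<Longrightarrow> v \<in> carrier M \<Longrightarrow> w \<in> carrier M \<Longrightarrow> (u \<oplus> v) \<oplus> w = u \<oplus> (v \<oplus> w)"
    "\<And>u v. u \<in> carrier M \<Longrightarrow> v \<in> carrier M \<Longrightarrow> u \<oplus> v = v \<oplus> u"
    "\<And>u. u \<in> carrier M \<Longrightarrow> \<zero> \<oplus> u = u"
    "\<And>u z. u \<in> carrier M \<Longrightarrow> z \<odot> u \<in> carrier M"
    "\<And>u z w. u \<in> carrier M \<Longrightarrow> (z + w) \<odot> u = z \<odot> u \<oplus> w \<odot> u"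
    "\<And>u v z. u \<in> carrier M \<Longrightarrow> v \<in> carrier M \<Longrightarrow> z \<odot> (u \<oplus> v) = z \<odot> u \<oplus> z \<odot> v"
    "\<And>u z w. u \<in> carrier M \<Longrightarrow> (z * w) \<odot> u = z \<odot> (w \<odot> u)"
    "\<And>u. u \<in> carrier M \<Longrightarrow> 1 \<odot> u = u"
    "\<And>u. u \<in> carrier M \<Longrightarrow> 0 \<odot> u = \<zero>"
  shows "gc_module M"
proof -
  have inv: "(- 1) \<odot> u \<oplus> u = \<zero>" if "u \<in> carrier M" for u
    using assms(7)[OF that, of "- 1" 1] assms(10,11)[OF that] by simp
  have "abelian_group M"
  proof (rule abelian_groupI)
    fix u assume "u \<in> carrier M"
    then show "\<exists>y\<in>carrier M. y \<oplus> u = \<zero>" using inv assms(6) by blast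
  qed (use assms in auto)
  then show ?thesis
    by (intro gc_module.intro gc_module_axioms.intro) (use assms in auto)
qed

text \<open>Purely algebraic: the seminorms of the two records are unrelated. The operations are
  required to agree on all arguments, which is true of records that arise from one another by
  replacing carrier and seminorms, and which makes rewriting unconditional.\<close>

definition lc_submodule :: "'a lc_module \<Rightarrow> 'a lc_module \<Rightarrow> bool" where
  "lc_submodule N M \<longleftrightarrow> gc_module N \<and> gc_module M \<and> carrier N \<subseteq> carrier M \<and> \<zero>\<^bsub>N\<^esub> = \<zero>\<^bsub>M\<^esub> \<and>
     (\<forall>u v. u \<oplus>\<^bsub>N\<^esub> v = u \<oplus>\<^bsub>M\<^esub> v) \<and> (\<forall>z u. z \<odot>\<^bsub>N\<^esub> u = z \<odot>\<^bsub>M\<^esub> u)"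

lemma lc_submoduleI:
  fixes M N :: "'a lc_module"
  assumes "gc_module M" "carrier N \<subseteq> carrier M" "\<zero>\<^bsub>N\<^esub> = \<zero>\<^bsub>M\<^esub>"
    "\<And>u v. u \<oplus>\<^bsub>N\<^esub> v = u \<oplus>\<^bsub>M\<^esub> v" "\<And>z u. z \<odot>\<^bsub>N\<^esub> u = z \<odot>\<^bsub>M\<^esub> u"
    "\<zero>\<^bsub>M\<^esub> \<in> carrier N" "\<And>u v. u \<in> carrier N \<Longrightarrow> v \<in> carrier N \<Longrightarrow> u \<oplus>\<^bsub>M\<^esub> v \<in> carrier N"
    "\<And>z u. u \<in> carrier N \<Longrightarrow> z \<odot>\<^bsub>M\<^esub> u \<in> carrier N"
  shows "lc_submodule N M"
proof -
  interpret gc_module M by fact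
  note sub = subsetD[OF assms(2)]
  have "gc_module N"
    by (rule gc_moduleI)
      (simp_all add: assms(3-8) sub a_assoc a_comm a_lcomm smult_add_left smult_add_right smult_mult
        smult_one smult_zero_left)
  then show ?thesis using assms unfolding lc_submodule_def by blast
qed

text \<open>The negative is chosen inside the carrier and so could a priori change with it;
  expressed as \<open>(- 1) \<odot> v\<close> it is seen to be the same. Balls of the two topologies
  are thereby comparable.\<close>

lemma lc_submodule_minus:
  assumes "lc_submodule N M" "u \<in> carrier N" "v \<in> carrier N"
  shows "u \<ominus>\<^bsub>N\<^esub> v = u \<ominus>\<^bsub>M\<^esub> v"
proof -
  interpret M: gc_module M using assms(1) by (simp add: lc_submodule_def)
  interpret N: gc_module N using assms(1) by (simp add: lc_submodule_def)
  have "\<ominus>\<^bsub>N\<^esub> v = \<ominus>\<^bsub>M\<^esub> v"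
    using N.smult_minus_one[OF assms(3)] M.smult_minus_one[of v] assms by (auto simp: lc_submodule_def)
  then show ?thesis using assms(1) by (simp add: a_minus_def lc_submodule_def)
qed

lemma ups_lc_submodule:
  assumes "lc_submodule N M" "ultra_pseudo_seminorm M P"
  shows "ultra_pseudo_seminorm N P"
proof -
  have eqs: "\<zero>\<^bsub>N\<^esub> = \<zero>\<^bsub>M\<^esub>" "\<And>u v. u \<oplus>\<^bsub>N\<^esub> v = u \<oplus>\<^bsub>M\<^esub> v" "\<And>z u. z \<odot>\<^bsub>N\<^esub> u = z \<odot>\<^bsub>M\<^esub> u"
    and sub: "carrier N \<subseteq> carrier M"
    using assms(1) by (simp_all add: lc_submodule_def)
  show ?thesis
    using assms(2) sub unfolding ultra_pseudo_seminorm_def Let_def eqs by blast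
qed

section \<open>Topologies generated by seminorms and continuous maps\<close>

lemma openin_seminorm_ball:
  assumes "P \<in> F" "u \<in> carrier M" "0 < r"
  shows "openin (seminorm_topology M F) {v \<in> carrier M. P (v \<ominus>\<^bsub>M\<^esub> u) < r}"
  unfolding seminorm_topology_def using assms by (intro topology_generated_by_Basis) blast

text \<open>The balls are only a subbase, so a neighbourhood is controlled by finitely many
  seminorms at once. The ultrametric inequality recentres a ball at any of its points with the same
  radius.\<close>

lemma openin_seminorm_topology_nbhd:
  fixes M :: "'a lc_module"
  assumes "gc_module M" "\<And>P. P \<in> F \<Longrightarrow> ultra_pseudo_seminorm M P"
    and "openin (seminorm_topology M F) U" "u \<in> U"
  shows "\<exists>F0 r. finite F0 \<and> F0 \<subseteq> F \<and> 0 < r \<and> (\<forall>v\<in>carrier M. (\<forall>P\<in>F0. P (v \<ominus>\<^bsub>M\<^esub> u) < r) \<longrightarrow> v \<in> U)"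
proof -
  interpret gc_module M by fact
  from assms(3) show ?thesis
    using assms(4)
    unfolding seminorm_topology_def openin_topology_generated_by_iff
  proof (induction arbitrary: u rule: generate_topology_on.induct)
    case (Int U V)
    obtain F1 r1 where 1: "finite F1" "F1 \<subseteq> F" "0 < r1"
      "\<And>v. v \<in> carrier M \<Longrightarrow> \<forall>P\<in>F1. P (v \<ominus>\<^bsub>M\<^esub> u) < r1 \<Longrightarrow> v \<in> U"
      using Int.IH(1)[of u] Int.prems by auto
    obtain F2 r2 where 2: "finite F2" "F2 \<subseteq> F" "0 < r2"
      "\<And>v. v \<in> carrier M \<Longrightarrow> \<forall>P\<in>F2. P (v \<ominus>\<^bsub>M\<^esub> u) < r2 \<Longrightarrow> v \<in> V"
      using Int.IH(2)[of u] Int.prems by auto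
    show ?case
      using 1 2 by (intro exI[of _ "F1 \<union> F2"] exI[of _ "min r1 r2"]) auto
  next
    case (UN \<U>)
    then obtain U where U: "U \<in> \<U>" "u \<in> U" by blast
    show ?case using UN.IH[OF U] U(1) by blast
  next
    case (Basis s)
    show ?case
    proof (cases "s = carrier M")
      case True
      then show ?thesis by (intro exI[of _ "{}"] exI[of _ 1]) auto
    next
      case False
      then obtain P w r where P: "P \<in> F" "w \<in> carrier M" "s = {v \<in> carrier M. P (v \<ominus>\<^bsub>M\<^esub> w) < r}" "0 < r"
        using Basis.hyps by auto
      have u: "u \<in> carrier M" "P (u \<ominus>\<^bsub>M\<^esub> w) < r" using Basis.prems P(3) by auto
      have "v \<in> s" if "v \<in> carrier M" "P (v \<ominus>\<^bsub>M\<^esub> u) < r" for v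
        using ups_triangle[OF assms(2)[OF P(1)] that(1) u(1) P(2)] that u(2) unfolding P(3) by simp
      then show ?thesis using P(1,4) by (intro exI[of _ "{P}"] exI[of _ r]) auto
    qed
  qed auto
qed

lemma continuous_map_dist_iff:
  fixes f :: "'a \<Rightarrow> 'b::metric_space"
  shows "continuous_map X euclidean f \<longleftrightarrow>
    (\<forall>x\<in>topspace X. \<forall>e>0. \<exists>U. openin X U \<and> x \<in> U \<and> (\<forall>y\<in>U. dist (f y) (f x) < e))"
proof
  assume f: "continuous_map X euclidean f"
  show "\<forall>x\<in>topspace X. \<forall>e>0. \<exists>U. openin X U \<and> x \<in> U \<and> (\<forall>y\<in>U. dist (f y) (f x) < e)"
  proof (intro ballI allI impI)
    fix x and e :: real assume "x \<in> topspace X" "0 < e"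
    moreover have "openin X {y \<in> topspace X. f y \<in> ball (f x) e}"
      using f by (rule openin_continuous_map_preimage) simp
    ultimately show "\<exists>U. openin X U \<and> x \<in> U \<and> (\<forall>y\<in>U. dist (f y) (f x) < e)"
      by (intro exI[of _ "{y \<in> topspace X. f y \<in> ball (f x) e}"]) (auto simp: dist_commute)
  qed
next
  assume *: "\<forall>x\<in>topspace X. \<forall>e>0. \<exists>U. openin X U \<and> x \<in> U \<and> (\<forall>y\<in>U. dist (f y) (f x) < e)"
  show "continuous_map X euclidean f"
    unfolding continuous_map
  proof (intro conjI allI impI)
    fix V :: "'b set" assume "openin euclidean V"
    then have V: "open V" by simp
    show "openin X {x \<in> topspace X. f x \<in> V}"
    proof (subst openin_subopen, intro ballI)
      fix x assume x: "x \<in> {x \<in> topspace X. f x \<in> V}"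
      then obtain e where e: "0 < e" "ball (f x) e \<subseteq> V" using V by (auto simp: open_contains_ball)
      from x e(1) * obtain U where "openin X U" "x \<in> U" "\<forall>y\<in>U. dist (f y) (f x) < e" by blast
      then show "\<exists>T. openin X T \<and> x \<in> T \<and> T \<subseteq> {x \<in> topspace X. f x \<in> V}"
        using e(2) openin_subset[of X U] by (intro exI[of _ U]) (auto simp: dist_commute)
    qed
  qed auto
qed

lemma continuous_map_seminorm_bound:
  fixes f :: "'a \<Rightarrow> 'b::metric_space" and M :: "'a lc_module"
  assumes "gc_module M" "ultra_pseudo_seminorm M P" "P \<in> F"
    and le: "\<And>u v. u \<in> carrier M \<Longrightarrow> v \<in> carrier M \<Longrightarrow> dist (f u) (f v) \<le> C * P (u \<ominus>\<^bsub>M\<^esub> v)"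
  shows "continuous_map (seminorm_topology M F) euclidean f"
  unfolding continuous_map_dist_iff topspace_seminorm_topology
proof (intro ballI allI impI)
  interpret gc_module M by fact
  fix u and e :: real assume u: "u \<in> carrier M" and e: "0 < e"
  \<comment> \<open>The denominator \<open>\<bar>C\<bar> + 1\<close> is positive whatever the sign
    of \<open>C\<close>.\<close>
  define \<delta> where "\<delta> = e / (\<bar>C\<bar> + 1)"
  have \<delta>: "\<delta> > 0" using e by (simp add: \<delta>_def)
  show "\<exists>U. openin (seminorm_topology M F) U \<and> u \<in> U \<and> (\<forall>v\<in>U. dist (f v) (f u) < e)"
  proof (intro exI conjI ballI)
    show "openin (seminorm_topology M F) {v \<in> carrier M. P (v \<ominus>\<^bsub>M\<^esub> u) < \<delta>}"
      by (rule openin_seminorm_ball[OF assms(3) u \<delta>])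
    show "u \<in> {v \<in> carrier M. P (v \<ominus>\<^bsub>M\<^esub> u) < \<delta>}"
      using u \<delta> ups_minus_self[OF assms(2) u] by simp
    fix v assume v: "v \<in> {v \<in> carrier M. P (v \<ominus>\<^bsub>M\<^esub> u) < \<delta>}"
    have nn: "0 \<le> P (v \<ominus>\<^bsub>M\<^esub> u)" using assms(2) u v by (simp add: ultra_pseudo_seminorm_def minus_closed)
    have "dist (f v) (f u) \<le> C * P (v \<ominus>\<^bsub>M\<^esub> u)" using le u v by simp
    also have "\<dots> \<le> (\<bar>C\<bar> + 1) * P (v \<ominus>\<^bsub>M\<^esub> u)" using nn by (intro mult_right_mono) auto
    also have "\<dots> < (\<bar>C\<bar> + 1) * \<delta>" using v by (intro mult_strict_left_mono) auto
    also have "\<dots> = e" by (simp add: \<delta>_def add_nonneg_eq_0_iff)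
    finally show "dist (f v) (f u) < e" .
  qed
qed

text \<open>One dominating seminorm for each seminorm of the target gives continuity at zero, and
  additivity moves it to every base point. All continuity claims about maps between modules go
  through this criterion.\<close>

lemma continuous_map_seminorm_linear:
  fixes M :: "'a lc_module" and N :: "'b lc_module"
  assumes "gc_module M" "gc_module N" "f \<in> carrier M \<rightarrow> carrier N"
    and add: "\<And>u v. u \<in> carrier M \<Longrightarrow> v \<in> carrier M \<Longrightarrow> f (u \<oplus>\<^bsub>M\<^esub> v) = f u \<oplus>\<^bsub>N\<^esub> f v"
    and F: "\<And>P. P \<in> F \<Longrightarrow> ultra_pseudo_seminorm M P" and G: "\<And>Q. Q \<in> G \<Longrightarrow> ultra_pseudo_seminorm N Q"
    and le: "\<And>Q. Q \<in> G \<Longrightarrow> \<exists>P\<in>F. \<exists>C. \<forall>u\<in>carrier M. Q (f u) \<le> C * P u"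
  shows "continuous_map (seminorm_topology M F) (seminorm_topology N G) f"
  unfolding seminorm_topology_def[of N G]
proof (rule continuous_on_generated_topo)
  interpret M: gc_module M by fact
  interpret N: gc_module N by fact
  have f: "f u \<in> carrier N" if "u \<in> carrier M" for u using assms(3) that by blast
  have diff: "f (u \<ominus>\<^bsub>M\<^esub> v) = f u \<ominus>\<^bsub>N\<^esub> f v" if "u \<in> carrier M" "v \<in> carrier M" for u v
  proof -
    have "f u = f (u \<ominus>\<^bsub>M\<^esub> v) \<oplus>\<^bsub>N\<^esub> f v"
      using add[of "u \<ominus>\<^bsub>M\<^esub> v" v] that by (simp add: M.minus_closed a_minus_def M.a_assoc M.l_neg)
    then show ?thesis
      using f[OF that(2)] f[OF M.minus_closed[OF that]] by (simp add: a_minus_def N.a_assoc N.r_neg)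
  qed
  show "f ` topspace (seminorm_topology M F) \<subseteq> \<Union> (insert (carrier N)
      {{v \<in> carrier N. P (v \<ominus>\<^bsub>N\<^esub> u) < r} | P u r. P \<in> G \<and> u \<in> carrier N \<and> 0 < r})"
    using f by (auto simp: topspace_seminorm_topology)
  fix U assume U: "U \<in> insert (carrier N)
      {{v \<in> carrier N. P (v \<ominus>\<^bsub>N\<^esub> u) < r} | P u r. P \<in> G \<and> u \<in> carrier N \<and> 0 < r}"
  show "openin (seminorm_topology M F) (f -` U \<inter> topspace (seminorm_topology M F))"
  proof (cases "U = carrier N")
    case True
    then have "f -` U \<inter> topspace (seminorm_topology M F) = topspace (seminorm_topology M F)"
      using f by (auto simp: topspace_seminorm_topology)
    then show ?thesis by simp
  next
    case False
    then obtain Q w r where Q: "Q \<in> G" "w \<in> carrier N" "0 < r" "U = {v \<in> carrier N. Q (v \<ominus>\<^bsub>N\<^esub> w) < r}"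
      using U by auto
    obtain P C where P: "P \<in> F" "\<And>u. u \<in> carrier M \<Longrightarrow> Q (f u) \<le> C * P u" using le[OF Q(1)] by blast
    define \<delta> where "\<delta> = r / (\<bar>C\<bar> + 1)"
    have \<delta>: "\<delta> > 0" using Q(3) by (simp add: \<delta>_def)
    show ?thesis
    proof (subst openin_subopen, intro ballI)
      fix u assume "u \<in> f -` U \<inter> topspace (seminorm_topology M F)"
      then have u: "u \<in> carrier M" "Q (f u \<ominus>\<^bsub>N\<^esub> w) < r" by (auto simp: Q(4) topspace_seminorm_topology)
      have sub: "v \<in> f -` U" if v: "v \<in> carrier M" "P (v \<ominus>\<^bsub>M\<^esub> u) < \<delta>" for v
      proof -
        have nn: "0 \<le> P (v \<ominus>\<^bsub>M\<^esub> u)"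
          using F[OF P(1)] u v by (simp add: ultra_pseudo_seminorm_def M.minus_closed)
        have "Q (f v \<ominus>\<^bsub>N\<^esub> f u) \<le> C * P (v \<ominus>\<^bsub>M\<^esub> u)"
          using P(2)[OF M.minus_closed[OF v(1) u(1)]] diff v u by simp
        also have "\<dots> \<le> (\<bar>C\<bar> + 1) * P (v \<ominus>\<^bsub>M\<^esub> u)" using nn by (intro mult_right_mono) auto
        also have "\<dots> < (\<bar>C\<bar> + 1) * \<delta>" using v by (intro mult_strict_left_mono) auto
        also have "\<dots> = r" by (simp add: \<delta>_def add_nonneg_eq_0_iff)
        finally have "Q (f v \<ominus>\<^bsub>N\<^esub> f u) < r" .
        then have "Q (f v \<ominus>\<^bsub>N\<^esub> w) < r"
          using N.ups_triangle[OF G[OF Q(1)] f[OF v(1)] f[OF u(1)] Q(2)] u(2) by simp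
        then show ?thesis using f[OF v(1)] by (simp add: Q(4))
      qed
      have "u \<in> {v \<in> carrier M. P (v \<ominus>\<^bsub>M\<^esub> u) < \<delta>}"
        using u(1) \<delta> M.ups_minus_self[OF F[OF P(1)] u(1)] by simp
      moreover have "{v \<in> carrier M. P (v \<ominus>\<^bsub>M\<^esub> u) < \<delta>} \<subseteq>
          f -` U \<inter> topspace (seminorm_topology M F)"
        unfolding topspace_seminorm_topology using sub by blast
      ultimately show "\<exists>T. openin (seminorm_topology M F) T \<and> u \<in> T \<and>
          T \<subseteq> f -` U \<inter> topspace (seminorm_topology M F)"
        using openin_seminorm_ball[OF P(1) u(1) \<delta>] by meson
    qed
  qed
qed

section \<open>Sets of admissible orders of a net\<close>

text \<open>An order must be admissible for all derivatives in \<open>A\<close> simultaneously. The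
  multi-indices up to a given order yield the seminorms of \<open>\<G> \<Omega>\<close>, and
  \<open>A = UNIV\<close> those of \<open>\<G>_inf \<Omega>\<close>.\<close>

definition ord_set :: "(real^'n) set \<Rightarrow> ('n \<Rightarrow> nat) set \<Rightarrow> 'n net \<Rightarrow> real set" where
  "ord_set K A u = {b. \<forall>\<alpha>\<in>A. unif_O K (\<lambda>\<epsilon>. multi_deriv \<alpha> (u \<epsilon>)) b}"

lemma ord_set_down: "b \<in> ord_set K A u \<Longrightarrow> a \<le> b \<Longrightarrow> a \<in> ord_set K A u"
  unfolding ord_set_def using unif_O_mono by blast

lemma ord_set_mono: "L \<subseteq> K \<Longrightarrow> B \<subseteq> A \<Longrightarrow> ord_set K A u \<subseteq> ord_set L B u"
  unfolding ord_set_def using unif_O_mono by blast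

lemma ord_set_add:
  assumes "open \<Omega>" "u \<in> smooth_nets \<Omega>" "v \<in> smooth_nets \<Omega>" "K \<subseteq> \<Omega>"
  shows "ord_set K A u \<inter> ord_set K A v \<subseteq> ord_set K A (\<lambda>\<epsilon> x. u \<epsilon> x + v \<epsilon> x)"
proof
  fix b assume b: "b \<in> ord_set K A u \<inter> ord_set K A v"
  have "unif_O K (\<lambda>\<epsilon>. multi_deriv \<alpha> (\<lambda>x. u \<epsilon> x + v \<epsilon> x)) b" if "\<alpha> \<in> A" for \<alpha>
  proof -
    obtain js where js: "multi_deriv \<alpha> = foldr partial_derivative js" using multi_deriv_foldr_ex by blast
    show ?thesis
      unfolding js
      by (rule unif_O_foldr_add[OF assms]) (use b that in \<open>auto simp: ord_set_def js[symmetric]\<close>)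
  qed
  then show "b \<in> ord_set K A (\<lambda>\<epsilon> x. u \<epsilon> x + v \<epsilon> x)" by (simp add: ord_set_def)
qed

lemma ord_set_smult:
  assumes "open \<Omega>" "u \<in> smooth_nets \<Omega>" "K \<subseteq> \<Omega>" "order_O (\<lambda>\<epsilon>. cmod (z \<epsilon>)) a" "b \<in> ord_set K A u"
  shows "a + b \<in> ord_set K A (\<lambda>\<epsilon> x. z \<epsilon> * u \<epsilon> x)"
proof -
  have "unif_O K (\<lambda>\<epsilon>. multi_deriv \<alpha> (\<lambda>x. z \<epsilon> * u \<epsilon> x)) (a + b)" if "\<alpha> \<in> A" for \<alpha>
  proof -
    obtain js where js: "multi_deriv \<alpha> = foldr partial_derivative js" using multi_deriv_foldr_ex by blast
    have "unif_O K (\<lambda>\<epsilon>. multi_deriv \<alpha> (u \<epsilon>)) b" using assms(5) that by (auto simp: ord_set_def)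
    from unif_O_mult[OF unif_O_const[OF assms(4)] this]
    show ?thesis
    proof (rule unif_O_cong)
      fix \<epsilon> :: real and x assume "\<epsilon> \<in> {0<..1}" "x \<in> K"
      then show "z \<epsilon> * multi_deriv \<alpha> (u \<epsilon>) x = multi_deriv \<alpha> (\<lambda>x. z \<epsilon> * u \<epsilon> x) x"
        unfolding js using assms(3)
        by (intro foldr_partial_derivative_linear[OF assms(1) bounded_linear_mult_right, symmetric]
            smooth_netsD[OF assms(2)]) auto
    qed
  qed
  then show ?thesis by (simp add: ord_set_def)
qed

lemma ord_set_N_ideal:
  assumes "open \<Omega>" "u \<in> N_ideal \<Omega>" "compact K" "K \<subseteq> \<Omega>"
  shows "ord_set K A u = UNIV"
proof -
  have "unif_O K (\<lambda>\<epsilon>. multi_deriv \<alpha> (u \<epsilon>)) b" for \<alpha> b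
  proof -
    obtain js where js: "multi_deriv \<alpha> = foldr partial_derivative js" using multi_deriv_foldr_ex by blast
    obtain q :: nat where q: "b \<le> real q" using real_arch_simple by blast
    have "unif_O K (\<lambda>\<epsilon>. multi_deriv \<alpha> (u \<epsilon>)) (real q)"
      unfolding js using assms(2-4) unfolding N_ideal_iff[OF assms(1)] by meson
    then show ?thesis using q by (rule unif_O_mono) simp
  qed
  then show ?thesis by (simp add: ord_set_def)
qed

lemma expnorm_ord_set_zero:
  assumes "open W" "u \<in> N_ideal W" "compact L" "L \<subseteq> W"
  shows "expnorm (ord_set L A u) = 0"
  using ord_set_N_ideal[OF assms] by (simp add: expnorm_eq_0)

lemma N_ideal_minus_commute:
  assumes "open \<Omega>" "(\<lambda>\<epsilon> x. u \<epsilon> x - v \<epsilon> x) \<in> N_ideal \<Omega>"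
  shows "(\<lambda>\<epsilon> x. v \<epsilon> x - u \<epsilon> x) \<in> N_ideal \<Omega>"
  using N_ideal_smult[OF assms moderate_const[of "- 1"]] by simp

text \<open>Independence of the representative: adding a net for which every real number is an
  admissible order changes nothing.\<close>

lemma ord_set_cong:
  assumes "open \<Omega>" "u \<in> smooth_nets \<Omega>" "v \<in> smooth_nets \<Omega>" "(\<lambda>\<epsilon> x. u \<epsilon> x - v \<epsilon> x) \<in> N_ideal \<Omega>"
    "compact K" "K \<subseteq> \<Omega>"
  shows "ord_set K A u = ord_set K A v"
proof -
  have *: "ord_set K A v \<subseteq> ord_set K A u"
    if "u \<in> smooth_nets \<Omega>" "v \<in> smooth_nets \<Omega>" "(\<lambda>\<epsilon> x. u \<epsilon> x - v \<epsilon> x) \<in> N_ideal \<Omega>" for u v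
    using ord_set_add[OF assms(1) N_ideal_smooth[OF that(3)] that(2) assms(6), of A]
      ord_set_N_ideal[OF assms(1) that(3) assms(5,6), of A] by simp
  show ?thesis
    using *[OF assms(2,3,4)] *[OF assms(3,2) N_ideal_minus_commute[OF assms(1,4)]] by blast
qed

text \<open>For a moderate net the exponent depends on the derivative, so a common one exists
  because \<open>A\<close> is finite; the sum of the exponents dominates each of them.\<close>

lemma ord_set_nonempty:
  assumes "open \<Omega>" "u \<in> E_M \<Omega>" "compact K" "K \<subseteq> \<Omega>" "finite A"
  shows "ord_set K A u \<noteq> {}"
proof -
  have "\<exists>N::nat. unif_O K (\<lambda>\<epsilon>. multi_deriv \<alpha> (u \<epsilon>)) (- real N)" for \<alpha>
  proof -
    obtain js where js: "multi_deriv \<alpha> = foldr partial_derivative js" using multi_deriv_foldr_ex by blast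
    show ?thesis unfolding js using assms(2-4) unfolding E_M_iff[OF assms(1)] by meson
  qed
  then obtain N :: "_ \<Rightarrow> nat" where N: "\<And>\<alpha>. unif_O K (\<lambda>\<epsilon>. multi_deriv \<alpha> (u \<epsilon>)) (- real (N \<alpha>))" by metis
  have le: "N \<alpha> \<le> (\<Sum>\<alpha>\<in>A. N \<alpha>)" if "\<alpha> \<in> A" for \<alpha> using assms(5) that by (simp add: member_le_sum)
  have "unif_O K (\<lambda>\<epsilon>. multi_deriv \<alpha> (u \<epsilon>)) (- real (\<Sum>\<alpha>\<in>A. N \<alpha>))" if "\<alpha> \<in> A" for \<alpha>
    by (rule unif_O_mono[OF N[of \<alpha>]]) (use le[OF that] in \<open>simp_all del: of_nat_sum\<close>)
  then show ?thesis unfolding ord_set_def by blast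
qed

lemma ord_set_nonempty_inf:
  assumes "open \<Omega>" "u \<in> E_M_inf \<Omega>" "compact K" "K \<subseteq> \<Omega>"
  shows "ord_set K A u \<noteq> {}"
proof -
  obtain N :: nat where N: "\<And>is. unif_O K (\<lambda>\<epsilon>. foldr partial_derivative is (u \<epsilon>)) (- real N)"
    using assms(2-4) unfolding E_M_inf_iff[OF assms(1)] by meson
  have "unif_O K (\<lambda>\<epsilon>. multi_deriv \<alpha> (u \<epsilon>)) (- real N)" for \<alpha>
  proof -
    obtain js where js: "multi_deriv \<alpha> = foldr partial_derivative js" using multi_deriv_foldr_ex by blast
    show ?thesis unfolding js by (rule N)
  qed
  then show ?thesis unfolding ord_set_def by blast
qed

lemma finite_order_multiindex: "finite {\<alpha> :: 'n::finite \<Rightarrow> nat. order_multiindex \<alpha> \<le> j}"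
proof (rule finite_subset)
  have "\<alpha> i \<le> order_multiindex \<alpha>" for \<alpha> :: "'n \<Rightarrow> nat" and i
    unfolding order_multiindex_def by (simp add: member_le_sum)
  then show "{\<alpha> :: 'n \<Rightarrow> nat. order_multiindex \<alpha> \<le> j} \<subseteq> Pi\<^sub>E UNIV (\<lambda>_. {..j})"
    using order_trans by fastforce
  show "finite (Pi\<^sub>E (UNIV :: 'n set) (\<lambda>_. {..j}))" by (intro finite_PiE) auto
qed

text \<open>The supremum runs over points and multi-indices together. Read as a uniform estimate
  over pairs, it splits into one estimate for each of the finitely many multi-indices.\<close>

lemma order_O_sup_multiindex:
  fixes u :: "('n::finite) net"
  assumes "u \<in> smooth_nets \<Omega>" "compact K" "K \<subseteq> \<Omega>"
  shows "order_O (\<lambda>\<epsilon>. sup_nonneg {cmod (multi_deriv \<alpha> (u \<epsilon>) x) | x \<alpha>. x \<in> K \<and> order_multiindex \<alpha> \<le> j}) b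
    \<longleftrightarrow> b \<in> ord_set K {\<alpha>. order_multiindex \<alpha> \<le> j} u"
proof -
  define A where "A = {\<alpha> :: 'n \<Rightarrow> nat. order_multiindex \<alpha> \<le> j}"
  define X where "X \<epsilon> = {cmod (multi_deriv \<alpha> (u \<epsilon>) x) | x \<alpha>. x \<in> K \<and> order_multiindex \<alpha> \<le> j}" for \<epsilon>
  have X: "X \<epsilon> = (\<Union>\<alpha>\<in>A. (\<lambda>x. cmod (multi_deriv \<alpha> (u \<epsilon>) x)) ` K)" for \<epsilon>
    unfolding X_def A_def by blast
  have finA: "finite A" unfolding A_def by (rule finite_order_multiindex)
  have "\<forall>\<^sub>F \<epsilon> in at_right 0. bdd_above (X \<epsilon>)"
    using eventually_unit_interval
    by eventually_elim
      (simp only: X bdd_above_UN[OF finA], intro ballI bdd_above_multi_deriv[OF smooth_netsD[OF assms(1)] assms(2,3)])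
  from order_O_sup_nonneg[OF this, of b]
  have "order_O (\<lambda>\<epsilon>. sup_nonneg (X \<epsilon>)) b \<longleftrightarrow> (\<exists>c. \<forall>\<^sub>F \<epsilon> in at_right 0. \<forall>y\<in>X \<epsilon>. y \<le> c * \<epsilon> powr b)" .
  also have "\<dots> \<longleftrightarrow> unif_O (\<Union>\<alpha>\<in>A. {\<alpha>} \<times> K) (\<lambda>\<epsilon> (\<alpha>, x). multi_deriv \<alpha> (u \<epsilon>) x) b"
    unfolding unif_O_def X by simp
  also have "\<dots> \<longleftrightarrow> (\<forall>\<alpha>\<in>A. unif_O ({\<alpha>} \<times> K) (\<lambda>\<epsilon> (\<alpha>, x). multi_deriv \<alpha> (u \<epsilon>) x) b)"
  proof
    assume *: "unif_O (\<Union>\<alpha>\<in>A. {\<alpha>} \<times> K) (\<lambda>\<epsilon> (\<alpha>, x). multi_deriv \<alpha> (u \<epsilon>) x) b"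
    show "\<forall>\<alpha>\<in>A. unif_O ({\<alpha>} \<times> K) (\<lambda>\<epsilon> (\<alpha>, x). multi_deriv \<alpha> (u \<epsilon>) x) b"
      using unif_O_mono[OF * order_refl] by blast
  qed (rule unif_O_UN[OF finA], simp)
  also have "\<dots> \<longleftrightarrow> b \<in> ord_set K A u"
    unfolding ord_set_def unif_O_def by simp
  finally show ?thesis unfolding X_def A_def .
qed

lemma P_\<G>_eq_expnorm:
  "representative U \<in> smooth_nets \<Omega> \<Longrightarrow> compact K \<Longrightarrow> K \<subseteq> \<Omega> \<Longrightarrow>
    P_\<G> K j U = expnorm (ord_set K {\<alpha>. order_multiindex \<alpha> \<le> j} (representative U))"
  by (simp add: P_\<G>_def expnorm_def order_O_sup_multiindex)

lemma P_\<G>_inf_eq_expnorm: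
  "representative U \<in> smooth_nets \<Omega> \<Longrightarrow> compact K \<Longrightarrow> K \<subseteq> \<Omega> \<Longrightarrow>
    P_\<G>_inf K U = expnorm (ord_set K UNIV (representative U))"
  by (simp add: P_\<G>_inf_def expnorm_def order_O_sup_deriv ord_set_def)


section \<open>Colombeau classes\<close>

lemma gclass_eqI:
  assumes "open \<Omega>" "(\<lambda>\<epsilon> x. u \<epsilon> x - v \<epsilon> x) \<in> N_ideal \<Omega>"
  shows "gclass \<Omega> u = gclass \<Omega> v"
proof -
  have *: "(\<lambda>\<epsilon> x. u \<epsilon> x - w \<epsilon> x) \<in> N_ideal \<Omega>"
    if "(\<lambda>\<epsilon> x. u \<epsilon> x - v \<epsilon> x) \<in> N_ideal \<Omega>" "(\<lambda>\<epsilon> x. v \<epsilon> x - w \<epsilon> x) \<in> N_ideal \<Omega>" for u v w :: "'a net"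
    using N_ideal_add[OF assms(1) that] by simp
  show ?thesis
    unfolding gclass_def using *[OF assms(2)] *[OF N_ideal_minus_commute[OF assms]] by blast
qed

lemma in_gclass:
  assumes "open \<Omega>" "u \<in> E_M \<Omega>"
  shows "u \<in> gclass \<Omega> u"
  using assms N_ideal_const[OF assms(1) negligible_zero] by (simp add: gclass_def)

lemma representative_gclass:
  assumes "open \<Omega>" "u \<in> E_M \<Omega>"
  shows "representative (gclass \<Omega> u) \<in> E_M \<Omega>"
    "(\<lambda>\<epsilon> x. u \<epsilon> x - representative (gclass \<Omega> u) \<epsilon> x) \<in> N_ideal \<Omega>"
    "(\<lambda>\<epsilon> x. representative (gclass \<Omega> u) \<epsilon> x - u \<epsilon> x) \<in> N_ideal \<Omega>"
proof -
  have "representative (gclass \<Omega> u) \<in> gclass \<Omega> u"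
    unfolding representative_def by (rule someI[of "\<lambda>w. w \<in> gclass \<Omega> u", OF in_gclass[OF assms]])
  then show 1: "representative (gclass \<Omega> u) \<in> E_M \<Omega>"
    "(\<lambda>\<epsilon> x. u \<epsilon> x - representative (gclass \<Omega> u) \<epsilon> x) \<in> N_ideal \<Omega>"
    by (simp_all add: gclass_def)
  show "(\<lambda>\<epsilon> x. representative (gclass \<Omega> u) \<epsilon> x - u \<epsilon> x) \<in> N_ideal \<Omega>"
    by (rule N_ideal_minus_commute[OF assms(1) 1(2)])
qed

lemma gclass_eqD:
  assumes "open \<Omega>" "v \<in> E_M \<Omega>" "gclass \<Omega> u = gclass \<Omega> v"
  shows "(\<lambda>\<epsilon> x. u \<epsilon> x - v \<epsilon> x) \<in> N_ideal \<Omega>"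
  using in_gclass[OF assms(1,2)] unfolding assms(3)[symmetric] by (simp add: gclass_def)

lemma gclass_eq_zero_iff:
  assumes "open \<Omega>"
  shows "gclass \<Omega> u = gclass \<Omega> (\<lambda>_ _. 0) \<longleftrightarrow> u \<in> N_ideal \<Omega>"
proof -
  have "(\<lambda>_ _. 0) \<in> E_M \<Omega>" using E_M_const[OF assms moderate_const[of 0]] .
  then show ?thesis
    using gclass_eqD[OF assms, of "\<lambda>_ _. 0" u] gclass_eqI[OF assms, of u "\<lambda>_ _. 0"] by auto
qed

lemma P_\<G>_gclass:
  assumes "open \<Omega>" "u \<in> E_M \<Omega>" "compact K" "K \<subseteq> \<Omega>"
  shows "P_\<G> K j (gclass \<Omega> u) = expnorm (ord_set K {\<alpha>. order_multiindex \<alpha> \<le> j} u)"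
proof -
  note r = representative_gclass[OF assms(1,2)]
  show ?thesis
    unfolding P_\<G>_eq_expnorm[OF E_M_smooth[OF r(1)] assms(3,4)]
      ord_set_cong[OF assms(1) E_M_smooth[OF r(1)] E_M_smooth[OF assms(2)] r(3) assms(3,4)] ..
qed

lemma P_\<G>_inf_gclass:
  assumes "open \<Omega>" "u \<in> E_M \<Omega>" "compact K" "K \<subseteq> \<Omega>"
  shows "P_\<G>_inf K (gclass \<Omega> u) = expnorm (ord_set K UNIV u)"
proof -
  note r = representative_gclass[OF assms(1,2)]
  show ?thesis
    unfolding P_\<G>_inf_eq_expnorm[OF E_M_smooth[OF r(1)] assms(3,4)]
      ord_set_cong[OF assms(1) E_M_smooth[OF r(1)] E_M_smooth[OF assms(2)] r(3) assms(3,4)] ..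
qed

lemma carrier_\<G>: "carrier (\<G> \<Omega>) = gclass \<Omega> ` E_M \<Omega>"
  and zero_\<G>: "\<zero>\<^bsub>\<G> \<Omega>\<^esub> = gclass \<Omega> (\<lambda>_ _. 0)"
  and seminorms_\<G>: "seminorms (\<G> \<Omega>) = {P_\<G> K j | K j. compact K \<and> K \<subseteq> \<Omega>}"
  by (simp_all add: \<G>_def)

lemma add_gclass:
  assumes "open \<Omega>" "u \<in> E_M \<Omega>" "v \<in> E_M \<Omega>"
  shows "gclass \<Omega> u \<oplus>\<^bsub>\<G> \<Omega>\<^esub> gclass \<Omega> v = gclass \<Omega> (\<lambda>\<epsilon> x. u \<epsilon> x + v \<epsilon> x)"
  using N_ideal_add[OF assms(1) representative_gclass(3)[OF assms(1,2)] representative_gclass(3)[OF assms(1,3)]]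
  by (simp add: \<G>_def) (intro gclass_eqI[OF assms(1)], simp add: algebra_simps)

text \<open>With \<open>r\<close> and \<open>s\<close> the chosen representatives,
  \<open>r * s - u * v = (r - u) * s + (s - v) * u\<close>, and both summands are a negligible net
  times a moderate one.\<close>

lemma gmult_gclass:
  assumes "open \<Omega>" "u \<in> E_M \<Omega>" "v \<in> E_M \<Omega>"
  shows "gmult \<Omega> (gclass \<Omega> u) (gclass \<Omega> v) = gclass \<Omega> (\<lambda>\<epsilon> x. u \<epsilon> x * v \<epsilon> x)"
  using N_ideal_add[OF assms(1)
      N_ideal_mult[OF assms(1) representative_gclass(3)[OF assms(1,2)] representative_gclass(1)[OF assms(1,3)]]
      N_ideal_mult[OF assms(1) representative_gclass(3)[OF assms(1,3)] assms(2)]]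
  unfolding gmult_def by (intro gclass_eqI[OF assms(1)]) (simp add: algebra_simps)

lemma smult_gclass:
  assumes "open \<Omega>" "u \<in> E_M \<Omega>" "moderate z"
  shows "abs_gcomplex z \<odot>\<^bsub>\<G> \<Omega>\<^esub> gclass \<Omega> u = gclass \<Omega> (\<lambda>\<epsilon> x. z \<epsilon> * u \<epsilon> x)"
proof -
  let ?r = "rep_gcomplex (abs_gcomplex z)"
  have "negligible (\<lambda>\<epsilon>. ?r \<epsilon> - z \<epsilon>)" using rep_abs_gcomplex[OF assms(3)] by (simp add: gc_rel_def)
  from N_ideal_add[OF assms(1)
      N_ideal_mult[OF assms(1) N_ideal_const[OF assms(1) this] representative_gclass(1)[OF assms(1,2)]]
      N_ideal_smult[OF assms(1) representative_gclass(3)[OF assms(1,2)] assms(3)]]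
  show ?thesis
    by (simp add: \<G>_def) (intro gclass_eqI[OF assms(1)], simp add: algebra_simps)
qed

lemma gcomplexE:
  obtains z' where "moderate z'" "z = abs_gcomplex z'"
  using rep_gcomplex_moderate abs_rep_gcomplex by metis

lemma gc_module_\<G>:
  fixes \<Omega> :: "(real^'n) set"
  assumes "open \<Omega>"
  shows "gc_module (\<G> \<Omega>)"
proof -
  note [simp] = carrier_\<G> zero_\<G> add_gclass[OF assms] smult_gclass[OF assms] E_M_add[OF assms]
    E_M_smult[OF assms] E_M_const[OF assms moderate_const] plus_abs_gcomplex times_abs_gcomplex
    moderate_add moderate_mult
  have smult: "z \<odot>\<^bsub>\<G> \<Omega>\<^esub> gclass \<Omega> u \<in> carrier (\<G> \<Omega>)"
    "(z + w) \<odot>\<^bsub>\<G> \<Omega>\<^esub> gclass \<Omega> u = z \<odot>\<^bsub>\<G> \<Omega>\<^esub> gclass \<Omega> u \<oplus>\<^bsub>\<G> \<Omega>\<^esub> w \<odot>\<^bsub>\<G> \<Omega>\<^esub> gclass \<Omega> u"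
    "(z * w) \<odot>\<^bsub>\<G> \<Omega>\<^esub> gclass \<Omega> u = z \<odot>\<^bsub>\<G> \<Omega>\<^esub> (w \<odot>\<^bsub>\<G> \<Omega>\<^esub> gclass \<Omega> u)"
    "z \<odot>\<^bsub>\<G> \<Omega>\<^esub> (gclass \<Omega> u \<oplus>\<^bsub>\<G> \<Omega>\<^esub> gclass \<Omega> v) = z \<odot>\<^bsub>\<G> \<Omega>\<^esub> gclass \<Omega> u \<oplus>\<^bsub>\<G> \<Omega>\<^esub> z \<odot>\<^bsub>\<G> \<Omega>\<^esub> gclass \<Omega> v"
    if "u \<in> E_M \<Omega>" "v \<in> E_M \<Omega>" for u v z w
  proof -
    obtain z' where z: "moderate z'" "z = abs_gcomplex z'" by (rule gcomplexE)
    obtain w' where w: "moderate w'" "w = abs_gcomplex w'" by (rule gcomplexE)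
    show "z \<odot>\<^bsub>\<G> \<Omega>\<^esub> gclass \<Omega> u \<in> carrier (\<G> \<Omega>)"
      "(z + w) \<odot>\<^bsub>\<G> \<Omega>\<^esub> gclass \<Omega> u = z \<odot>\<^bsub>\<G> \<Omega>\<^esub> gclass \<Omega> u \<oplus>\<^bsub>\<G> \<Omega>\<^esub> w \<odot>\<^bsub>\<G> \<Omega>\<^esub> gclass \<Omega> u"
      "(z * w) \<odot>\<^bsub>\<G> \<Omega>\<^esub> gclass \<Omega> u = z \<odot>\<^bsub>\<G> \<Omega>\<^esub> (w \<odot>\<^bsub>\<G> \<Omega>\<^esub> gclass \<Omega> u)"
      "z \<odot>\<^bsub>\<G> \<Omega>\<^esub> (gclass \<Omega> u \<oplus>\<^bsub>\<G> \<Omega>\<^esub> gclass \<Omega> v) = z \<odot>\<^bsub>\<G> \<Omega>\<^esub> gclass \<Omega> u \<oplus>\<^bsub>\<G> \<Omega>\<^esub> z \<odot>\<^bsub>\<G> \<Omega>\<^esub> gclass \<Omega> v"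
      using z(1) w(1) that by (simp_all add: z(2) w(2) distrib_left distrib_right mult.assoc)
  qed
  have one: "1 \<odot>\<^bsub>\<G> \<Omega>\<^esub> gclass \<Omega> u = gclass \<Omega> u" "0 \<odot>\<^bsub>\<G> \<Omega>\<^esub> gclass \<Omega> u = gclass \<Omega> (\<lambda>_ _. 0)"
    if "u \<in> E_M \<Omega>" for u
    using smult_gclass[OF assms that moderate_const[of 1]] smult_gclass[OF assms that moderate_const[of 0]]
    by (simp_all add: one_gcomplex_def zero_gcomplex_def)
  show ?thesis
  proof (rule gc_moduleI)
    fix U assume "U \<in> carrier (\<G> \<Omega>)"
    then obtain u where u: "u \<in> E_M \<Omega>" "U = gclass \<Omega> u" by auto
    show "1 \<odot>\<^bsub>\<G> \<Omega>\<^esub> U = U" "0 \<odot>\<^bsub>\<G> \<Omega>\<^esub> U = \<zero>\<^bsub>\<G> \<Omega>\<^esub>" "\<zero>\<^bsub>\<G> \<Omega>\<^esub> \<oplus>\<^bsub>\<G> \<Omega>\<^esub> U = U"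
      "z \<odot>\<^bsub>\<G> \<Omega>\<^esub> U \<in> carrier (\<G> \<Omega>)"
      "(z + w) \<odot>\<^bsub>\<G> \<Omega>\<^esub> U = z \<odot>\<^bsub>\<G> \<Omega>\<^esub> U \<oplus>\<^bsub>\<G> \<Omega>\<^esub> w \<odot>\<^bsub>\<G> \<Omega>\<^esub> U"
      "(z * w) \<odot>\<^bsub>\<G> \<Omega>\<^esub> U = z \<odot>\<^bsub>\<G> \<Omega>\<^esub> (w \<odot>\<^bsub>\<G> \<Omega>\<^esub> U)" for z w
      using one[OF u(1)] smult(1-3)[OF u(1) u(1)] u(1) by (simp_all add: u(2))
    fix V assume "V \<in> carrier (\<G> \<Omega>)"
    then obtain v where v: "v \<in> E_M \<Omega>" "V = gclass \<Omega> v" by auto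
    show "U \<oplus>\<^bsub>\<G> \<Omega>\<^esub> V \<in> carrier (\<G> \<Omega>)" "U \<oplus>\<^bsub>\<G> \<Omega>\<^esub> V = V \<oplus>\<^bsub>\<G> \<Omega>\<^esub> U"
      using u(1) v(1) by (simp_all add: u(2) v(2) add.commute)
    show "z \<odot>\<^bsub>\<G> \<Omega>\<^esub> (U \<oplus>\<^bsub>\<G> \<Omega>\<^esub> V) = z \<odot>\<^bsub>\<G> \<Omega>\<^esub> U \<oplus>\<^bsub>\<G> \<Omega>\<^esub> z \<odot>\<^bsub>\<G> \<Omega>\<^esub> V" for z
      unfolding u(2) v(2) by (rule smult(4)[OF u(1) v(1)])
    fix W assume "W \<in> carrier (\<G> \<Omega>)"
    then obtain w where w: "w \<in> E_M \<Omega>" "W = gclass \<Omega> w" by auto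
    show "(U \<oplus>\<^bsub>\<G> \<Omega>\<^esub> V) \<oplus>\<^bsub>\<G> \<Omega>\<^esub> W = U \<oplus>\<^bsub>\<G> \<Omega>\<^esub> (V \<oplus>\<^bsub>\<G> \<Omega>\<^esub> W)"
      using u(1) v(1) w(1) by (simp add: u(2) v(2) w(2) add.assoc)
  next
    show "\<zero>\<^bsub>\<G> \<Omega>\<^esub> \<in> carrier (\<G> \<Omega>)" by simp
  qed
qed

lemma minus_gclass:
  assumes "open \<Omega>" "u \<in> E_M \<Omega>" "v \<in> E_M \<Omega>"
  shows "gclass \<Omega> u \<ominus>\<^bsub>\<G> \<Omega>\<^esub> gclass \<Omega> v = gclass \<Omega> (\<lambda>\<epsilon> x. u \<epsilon> x - v \<epsilon> x)"
proof -
  interpret gc_module "\<G> \<Omega>" by (rule gc_module_\<G>[OF assms(1)])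
  have "- 1 = abs_gcomplex (\<lambda>_. - 1)" by (simp add: one_gcomplex_def uminus_gcomplex.abs_eq
        gc_rel_def moderate_const negligible_zero eq_onp_def)
  then have "\<ominus>\<^bsub>\<G> \<Omega>\<^esub> gclass \<Omega> v = gclass \<Omega> (\<lambda>\<epsilon> x. - 1 * v \<epsilon> x)"
    using smult_minus_one[of "gclass \<Omega> v"] smult_gclass[OF assms(1,3) moderate_const[of "- 1"]] assms(3)
    by (simp add: carrier_\<G>)
  then show ?thesis
    using add_gclass[OF assms(1,2) E_M_smult[OF assms(1,3) moderate_const[of "- 1"]]]
    by (simp add: a_minus_def)
qed

text \<open>Nonempty order sets are asked for classes in \<open>N\<close> only: with
  \<open>A = UNIV\<close> a net that is moderate but not regular may have none, so
  \<open>P_\<G>_inf\<close> is a seminorm on modules of regular classes.\<close>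

lemma ups_expnorm:
  assumes "open \<Omega>" "lc_submodule N (\<G> \<Omega>)" "compact K" "K \<subseteq> \<Omega>"
    and P: "\<And>u. u \<in> E_M \<Omega> \<Longrightarrow> P (gclass \<Omega> u) = expnorm (ord_set K A u)"
    and ne: "\<And>u. u \<in> E_M \<Omega> \<Longrightarrow> gclass \<Omega> u \<in> carrier N \<Longrightarrow> ord_set K A u \<noteq> {}"
  shows "ultra_pseudo_seminorm N P"
proof -
  interpret gc_module N using assms(2) by (simp add: lc_submodule_def)
  have ops: "\<zero>\<^bsub>N\<^esub> = \<zero>\<^bsub>\<G> \<Omega>\<^esub>" "\<And>u v. u \<oplus>\<^bsub>N\<^esub> v = u \<oplus>\<^bsub>\<G> \<Omega>\<^esub> v" "\<And>z u. z \<odot>\<^bsub>N\<^esub> u = z \<odot>\<^bsub>\<G> \<Omega>\<^esub> u"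
    and sub: "carrier N \<subseteq> gclass \<Omega> ` E_M \<Omega>"
    using assms(2) by (simp_all add: lc_submodule_def carrier_\<G>)
  show ?thesis
  proof (rule upsI)
    have "ord_set K A (\<lambda>_ _. 0) = UNIV"
      using ord_set_N_ideal[OF assms(1) N_ideal_const[OF assms(1) negligible_zero] assms(3,4)] .
    then have "expnorm (ord_set K A (\<lambda>_ _. 0)) = 0" by (intro expnorm_eq_0) simp
    then show "P \<zero>\<^bsub>N\<^esub> = 0"
      by (simp add: ops zero_\<G> P E_M_const[OF assms(1) moderate_const])
  next
    fix U assume U: "U \<in> carrier N"
    then obtain u where u: "u \<in> E_M \<Omega>" "U = gclass \<Omega> u" using sub by blast
    show "0 \<le> P U" by (simp add: u P expnorm_nonneg)
    show "P (z \<odot>\<^bsub>N\<^esub> U) \<le> gnorm z * P U" for z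
    proof -
      obtain z' where z: "moderate z'" "z = abs_gcomplex z'" by (rule gcomplexE)
      have "expnorm (ord_set K A (\<lambda>\<epsilon> x. z' \<epsilon> * u \<epsilon> x)) \<le>
          expnorm {b. order_O (\<lambda>\<epsilon>. cmod (z' \<epsilon>)) b} * expnorm (ord_set K A u)"
        by (rule expnorm_mult[OF moderate_orders[OF z(1)] ne[OF u(1)]])
          (use U u ord_set_smult[OF assms(1) E_M_smooth[OF u(1)] assms(4)] in auto)
      then show ?thesis
        by (simp add: z gnorm_abs u ops smult_gclass[OF assms(1)] P E_M_smult[OF assms(1)])
    qed
    fix V assume V: "V \<in> carrier N"
    then obtain v where v: "v \<in> E_M \<Omega>" "V = gclass \<Omega> v" using sub by blast
    have "expnorm (ord_set K A (\<lambda>\<epsilon> x. u \<epsilon> x + v \<epsilon> x)) \<le>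
        max (expnorm (ord_set K A u)) (expnorm (ord_set K A v))"
      by (rule expnorm_max[OF ne[OF u(1)] ne[OF v(1)]
            ord_set_add[OF assms(1) E_M_smooth[OF u(1)] E_M_smooth[OF v(1)] assms(4)]])
        (use U V u v ord_set_down in blast)+
    then show "P (U \<oplus>\<^bsub>N\<^esub> V) \<le> max (P U) (P V)"
      by (simp add: u v ops add_gclass[OF assms(1)] P E_M_add[OF assms(1)])
  qed
qed


section \<open>Duals and inductive limits\<close>

lemma sup_nonneg_le: "0 \<le> c \<Longrightarrow> (\<And>y. y \<in> A \<Longrightarrow> y \<le> c) \<Longrightarrow> sup_nonneg A \<le> c"
  by (rule cSup_least) auto

lemma sup_nonneg_upper: "bdd_above A \<Longrightarrow> y \<in> A \<Longrightarrow> y \<le> sup_nonneg A"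
  by (rule cSup_upper) auto

lemma sup_nonneg_nonneg: "bdd_above A \<Longrightarrow> 0 \<le> sup_nonneg A"
  by (rule cSup_upper) auto

lemma linear_functional_add:
  "linear_functional M T \<Longrightarrow> u \<in> carrier M \<Longrightarrow> v \<in> carrier M \<Longrightarrow> T (u \<oplus>\<^bsub>M\<^esub> v) = T u + T v"
  and linear_functional_smult:
  "linear_functional M T \<Longrightarrow> u \<in> carrier M \<Longrightarrow> T (z \<odot>\<^bsub>M\<^esub> u) = z * T u"
  by (simp_all add: linear_functional_def)

lemma linear_functional_zero:
  assumes "gc_module M" "linear_functional M T"
  shows "T \<zero>\<^bsub>M\<^esub> = 0"
proof -
  interpret gc_module M by fact
  show ?thesis using linear_functional_add[OF assms(2), of "\<zero>\<^bsub>M\<^esub>" "\<zero>\<^bsub>M\<^esub>"] by simp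
qed

lemma linear_functional_minus:
  assumes "gc_module M" "linear_functional M T" "u \<in> carrier M" "v \<in> carrier M"
  shows "T (u \<ominus>\<^bsub>M\<^esub> v) = T u - T v"
proof -
  interpret gc_module M by fact
  have "T (\<ominus>\<^bsub>M\<^esub> v) = - T v"
    using linear_functional_smult[OF assms(2,4), of "- 1"] smult_minus_one[OF assms(4)] by simp
  then show ?thesis
    using linear_functional_add[OF assms(2,3), of "\<ominus>\<^bsub>M\<^esub> v"] assms(4) by (simp add: a_minus_def)
qed

lemma ups_gnorm_functional:
  assumes "gc_module M" "linear_functional M T"
  shows "ultra_pseudo_seminorm M (\<lambda>u. gnorm (T u))"
proof -
  interpret gc_module M by fact
  show ?thesis
    by (rule upsI) (simp_all add: gnorm_nonneg linear_functional_zero[OF assms]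
        linear_functional_add[OF assms(2)] linear_functional_smult[OF assms(2)] gnorm_mult gnorm_add)
qed

lemma continuous_functional_bound:
  assumes "gc_module M" "linear_functional M T" "ultra_pseudo_seminorm M P" "P \<in> F"
    "\<And>u. u \<in> carrier M \<Longrightarrow> gnorm (T u) \<le> C * P u"
  shows "continuous_map (seminorm_topology M F) euclidean T"
proof -
  interpret gc_module M by fact
  show ?thesis
  proof (rule continuous_map_seminorm_bound[OF assms(1,3,4), of _ C])
    fix u v assume "u \<in> carrier M" "v \<in> carrier M"
    then show "dist (T u) (T v) \<le> C * P (u \<ominus>\<^bsub>M\<^esub> v)"
      using assms(5)[of "u \<ominus>\<^bsub>M\<^esub> v"]
      by (simp add: dist_gcomplex_def linear_functional_minus[OF assms(1,2)] minus_closed)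
  qed
qed

text \<open>By the ultrametric inequality, with the maximum bounded by the sum, a seminorm is
  1-Lipschitz with respect to itself.\<close>

lemma continuous_ups:
  assumes "gc_module M" "ultra_pseudo_seminorm M P" "P \<in> F"
  shows "continuous_map (seminorm_topology M F) euclideanreal P"
proof -
  interpret gc_module M by fact
  have nn: "0 \<le> P u" if "u \<in> carrier M" for u
    using assms(2) that by (simp add: ultra_pseudo_seminorm_def)
  have le: "P u \<le> P v + P (u \<ominus>\<^bsub>M\<^esub> v)" if "u \<in> carrier M" "v \<in> carrier M" for u v
  proof -
    have "u = (u \<ominus>\<^bsub>M\<^esub> v) \<oplus>\<^bsub>M\<^esub> v" using that by (simp add: a_minus_def a_assoc l_neg)
    then have "P u \<le> max (P (u \<ominus>\<^bsub>M\<^esub> v)) (P v)"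
      using assms(2) minus_closed[OF that] that(2) unfolding ultra_pseudo_seminorm_def by metis
    then show ?thesis using nn[of v] nn[OF minus_closed[OF that]] that by auto
  qed
  show ?thesis
  proof (rule continuous_map_seminorm_bound[OF assms, of _ 1])
    fix u v assume "u \<in> carrier M" "v \<in> carrier M"
    then show "dist (P u) (P v) \<le> 1 * P (u \<ominus>\<^bsub>M\<^esub> v)"
      using le[of u v] le[of v u] ups_minus_commute[OF assms(2), of u v] by (simp add: dist_real_def)
  qed
qed

lemma continuous_gnorm:
  assumes "continuous_map X euclidean T"
  shows "continuous_map X euclideanreal (\<lambda>u. gnorm (T u))"
proof -
  have "continuous_on UNIV (\<lambda>z::gcomplex. dist z 0)" by (intro continuous_intros)
  then have "continuous_map euclidean euclideanreal gnorm" by (simp add: dist_gcomplex_def)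
  from continuous_map_compose[OF assms this] show ?thesis by (simp add: o_def)
qed

section \<open>The dual as a module with seminorms\<close>

lemma dual_carrier:
  "T \<in> carrier (dual M) \<longleftrightarrow> T \<in> extensional (carrier M) \<and> linear_functional M T \<and>
    continuous_map (lc_topology M) euclidean T"
  by (simp add: dual_def)

lemma dual_ops:
  "\<zero>\<^bsub>dual M\<^esub> = (\<lambda>u\<in>carrier M. 0)"
  "S \<oplus>\<^bsub>dual M\<^esub> T = (\<lambda>u\<in>carrier M. S u + T u)"
  "z \<odot>\<^bsub>dual M\<^esub> T = (\<lambda>u\<in>carrier M. z * T u)"
  "seminorms (dual M) = {(\<lambda>T. sup_nonneg ((\<lambda>u. gnorm (T u)) ` B)) | B. bounded_in M B}"
  by (simp_all add: dual_def)

lemma topspace_lc_topology: "topspace (lc_topology M) = carrier M"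
  by (simp add: lc_topology_def topspace_seminorm_topology)

lemma restrict_in_dual:
  assumes "gc_module M" "linear_functional M T" "continuous_map (lc_topology M) euclidean T"
  shows "restrict T (carrier M) \<in> carrier (dual M)"
proof -
  interpret gc_module M by fact
  have "continuous_map (lc_topology M) euclidean (restrict T (carrier M))"
    by (rule continuous_map_eq[OF assms(3)]) (simp add: topspace_lc_topology)
  then show ?thesis
    using assms(2) by (simp add: dual_carrier linear_functional_def smult_closed)
qed

text \<open>The ultrametric inequality keeps \<open>e\<close> as it is, without halving.\<close>

lemma continuous_gcomplex_add:
  fixes f g :: "'a \<Rightarrow> gcomplex"
  assumes "continuous_map X euclidean f" "continuous_map X euclidean g"
  shows "continuous_map X euclidean (\<lambda>x. f x + g x)"
  unfolding continuous_map_dist_iff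
proof (intro ballI allI impI)
  fix x and e :: real assume x: "x \<in> topspace X" "0 < e"
  obtain U where U: "openin X U" "x \<in> U" "\<And>y. y \<in> U \<Longrightarrow> dist (f y) (f x) < e"
    using assms(1) x unfolding continuous_map_dist_iff by meson
  obtain V where V: "openin X V" "x \<in> V" "\<And>y. y \<in> V \<Longrightarrow> dist (g y) (g x) < e"
    using assms(2) x unfolding continuous_map_dist_iff by meson
  have "dist (f y + g y) (f x + g x) < e" if "y \<in> U \<inter> V" for y
    using gnorm_add[of "f y - f x" "g y - g x"] U(3)[of y] V(3)[of y] that
    by (simp add: dist_gcomplex_def algebra_simps)
  then show "\<exists>U. openin X U \<and> x \<in> U \<and> (\<forall>y\<in>U. dist (f y + g y) (f x + g x) < e)"
    using U V by (intro exI[of _ "U \<inter> V"]) auto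
qed

lemma continuous_gcomplex_smult:
  fixes f :: "'a \<Rightarrow> gcomplex"
  assumes "continuous_map X euclidean f"
  shows "continuous_map X euclidean (\<lambda>x. z * f x)"
  unfolding continuous_map_dist_iff
proof (intro ballI allI impI)
  fix x and e :: real assume x: "x \<in> topspace X" "0 < e"
  have pos: "0 < gnorm z + 1" using gnorm_nonneg[of z] by simp
  then obtain U where U: "openin X U" "x \<in> U" "\<And>y. y \<in> U \<Longrightarrow> dist (f y) (f x) < e / (gnorm z + 1)"
    using assms x unfolding continuous_map_dist_iff by (meson divide_pos_pos)
  have "dist (z * f y) (z * f x) < e" if "y \<in> U" for y
  proof -
    have "dist (z * f y) (z * f x) = gnorm (z * (f y - f x))" by (simp add: dist_gcomplex_def algebra_simps)
    also have "\<dots> \<le> gnorm z * gnorm (f y - f x)" by (rule gnorm_mult)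
    also have "\<dots> \<le> (gnorm z + 1) * gnorm (f y - f x)" by (intro mult_right_mono gnorm_nonneg) simp
    also have "\<dots> < (gnorm z + 1) * (e / (gnorm z + 1))"
      using U(3)[OF that] pos by (intro mult_strict_left_mono) (simp_all add: dist_gcomplex_def)
    also have "\<dots> = e" using pos by simp
    finally show ?thesis .
  qed
  then show "\<exists>U. openin X U \<and> x \<in> U \<and> (\<forall>y\<in>U. dist (z * f y) (z * f x) < e)"
    using U by blast
qed

lemma extensional_eqI:
  "S \<in> extensional A \<Longrightarrow> (\<And>u. u \<in> A \<Longrightarrow> S u = T u) \<Longrightarrow> restrict T A = S"
  by (auto simp: extensional_def restrict_def fun_eq_iff)

lemma gc_module_dual:
  assumes "gc_module M"
  shows "gc_module (dual M)"
proof -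
  interpret gc_module M by fact
  show ?thesis
  proof (rule gc_moduleI)
    fix S T assume S: "S \<in> carrier (dual M)" and T: "T \<in> carrier (dual M)"
    show "S \<oplus>\<^bsub>dual M\<^esub> T \<in> carrier (dual M)"
      unfolding dual_ops
      by (rule restrict_in_dual[OF assms])
        (use S T in \<open>simp_all add: dual_carrier continuous_gcomplex_add linear_functional_def algebra_simps\<close>)
    show "S \<oplus>\<^bsub>dual M\<^esub> T = T \<oplus>\<^bsub>dual M\<^esub> S" by (simp add: dual_ops add.commute)
    show "\<zero>\<^bsub>dual M\<^esub> \<oplus>\<^bsub>dual M\<^esub> T = T"
      unfolding dual_ops by (rule extensional_eqI) (use T in \<open>simp_all add: dual_carrier\<close>)
    show "1 \<odot>\<^bsub>dual M\<^esub> T = T"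
      unfolding dual_ops by (rule extensional_eqI) (use T in \<open>simp_all add: dual_carrier\<close>)
    show "0 \<odot>\<^bsub>dual M\<^esub> T = \<zero>\<^bsub>dual M\<^esub>" by (simp add: dual_ops)
    show "z \<odot>\<^bsub>dual M\<^esub> T \<in> carrier (dual M)" for z
      unfolding dual_ops
      by (rule restrict_in_dual[OF assms])
        (use T in \<open>simp_all add: dual_carrier continuous_gcomplex_smult linear_functional_def algebra_simps\<close>)
    show "(z + w) \<odot>\<^bsub>dual M\<^esub> T = z \<odot>\<^bsub>dual M\<^esub> T \<oplus>\<^bsub>dual M\<^esub> w \<odot>\<^bsub>dual M\<^esub> T" for z w
      by (simp add: dual_ops restrict_def fun_eq_iff algebra_simps)
    show "z \<odot>\<^bsub>dual M\<^esub> (S \<oplus>\<^bsub>dual M\<^esub> T) = z \<odot>\<^bsub>dual M\<^esub> S \<oplus>\<^bsub>dual M\<^esub> z \<odot>\<^bsub>dual M\<^esub> T" for z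
      by (simp add: dual_ops restrict_def fun_eq_iff algebra_simps)
    show "(z * w) \<odot>\<^bsub>dual M\<^esub> T = z \<odot>\<^bsub>dual M\<^esub> (w \<odot>\<^bsub>dual M\<^esub> T)" for z w
      by (simp add: dual_ops restrict_def fun_eq_iff algebra_simps)
    show "(S \<oplus>\<^bsub>dual M\<^esub> T) \<oplus>\<^bsub>dual M\<^esub> R = S \<oplus>\<^bsub>dual M\<^esub> (T \<oplus>\<^bsub>dual M\<^esub> R)" for R
      by (simp add: dual_ops restrict_def fun_eq_iff algebra_simps)
  next
    show "\<zero>\<^bsub>dual M\<^esub> \<in> carrier (dual M)"
      unfolding dual_ops by (rule restrict_in_dual[OF assms]) (simp_all add: linear_functional_def)
  qed
qed

text \<open>The absolute value of a continuous functional is a continuous seminorm, hence bounded on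
  bounded sets by definition. This makes the suprema in \<open>dual\<close> genuine ones.\<close>

lemma bdd_above_functional:
  assumes "gc_module M" "T \<in> carrier (dual M)" "bounded_in M B"
  shows "bdd_above ((\<lambda>u. gnorm (T u)) ` B)"
proof -
  have "\<exists>C. \<forall>u\<in>B. gnorm (T u) \<le> C"
    using assms(3) ups_gnorm_functional[OF assms(1), of T] continuous_gnorm[of "lc_topology M" T] assms(2)
    unfolding bounded_in_def dual_carrier by blast
  then show ?thesis by (auto simp: bdd_above_def)
qed

lemma ups_dual_seminorms:
  assumes "gc_module M" "Q \<in> seminorms (dual M)"
  shows "ultra_pseudo_seminorm (dual M) Q"
proof -
  obtain B where B: "bounded_in M B" "Q = (\<lambda>T. sup_nonneg ((\<lambda>u. gnorm (T u)) ` B))"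
    using assms(2) by (auto simp: dual_ops)
  have sub: "u \<in> carrier M" if "u \<in> B" for u using B(1) that by (auto simp: bounded_in_def)
  note bdd = bdd_above_functional[OF assms(1) _ B(1)]
  interpret D: gc_module "dual M" by (rule gc_module_dual[OF assms(1)])
  have nn: "0 \<le> Q T" if "T \<in> carrier (dual M)" for T
    unfolding B(2) by (rule sup_nonneg_nonneg[OF bdd[OF that]])
  have up: "gnorm (T u) \<le> Q T" if "T \<in> carrier (dual M)" "u \<in> B" for T u
    unfolding B(2) by (rule sup_nonneg_upper[OF bdd[OF that(1)]]) (use that in auto)
  have le: "Q T \<le> c" if "0 \<le> c" "\<And>u. u \<in> B \<Longrightarrow> gnorm (T u) \<le> c" for T c
    unfolding B(2) using that by (intro sup_nonneg_le) auto
  show ?thesis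
  proof (rule D.upsI)
    show "Q \<zero>\<^bsub>dual M\<^esub> = 0"
      using le[of 0 "\<zero>\<^bsub>dual M\<^esub>"] nn[OF D.zero_closed] sub by (intro antisym) (auto simp: dual_ops)
  next
    fix z T assume T: "T \<in> carrier (dual M)"
    show "Q (z \<odot>\<^bsub>dual M\<^esub> T) \<le> gnorm z * Q T"
    proof (rule le)
      fix u assume u: "u \<in> B"
      have "gnorm (z * T u) \<le> gnorm z * gnorm (T u)" by (rule gnorm_mult)
      also have "\<dots> \<le> gnorm z * Q T" by (intro mult_left_mono up T u gnorm_nonneg)
      finally show "gnorm ((z \<odot>\<^bsub>dual M\<^esub> T) u) \<le> gnorm z * Q T" using sub[OF u] by (simp add: dual_ops)
    qed (use nn[OF T] gnorm_nonneg in simp)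
  next
    fix S T assume S: "S \<in> carrier (dual M)" and T: "T \<in> carrier (dual M)"
    show "Q (S \<oplus>\<^bsub>dual M\<^esub> T) \<le> max (Q S) (Q T)"
    proof (rule le)
      fix u assume u: "u \<in> B"
      have "gnorm (S u + T u) \<le> max (gnorm (S u)) (gnorm (T u))" by (rule gnorm_add)
      also have "\<dots> \<le> max (Q S) (Q T)" by (intro max.mono up S T u)
      finally show "gnorm ((S \<oplus>\<^bsub>dual M\<^esub> T) u) \<le> max (Q S) (Q T)" using sub[OF u] by (simp add: dual_ops)
    qed (use nn[OF T] in simp)
  qed (rule nn)
qed

section \<open>Criteria for embeddings into duals and between duals\<close>

text \<open>A bilinear map induces a continuous map into the dual if, for each bounded
  \<open>B\<close>, one seminorm of \<open>M\<close> controls it uniformly for second arguments in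
  \<open>B\<close>. Injectivity is asked at zero and spreads by additivity in the first
  argument.\<close>

lemma embedding_into_dual:
  fixes M :: "'a lc_module" and N :: "'b lc_module" and \<beta> :: "'a \<Rightarrow> 'b \<Rightarrow> gcomplex"
  assumes M: "gc_module M" "\<And>P. P \<in> seminorms M \<Longrightarrow> ultra_pseudo_seminorm M P" and N: "gc_module N"
    and lin: "\<And>u. u \<in> carrier M \<Longrightarrow> linear_functional N (\<beta> u)"
    and add: "\<And>u u' v. u \<in> carrier M \<Longrightarrow> u' \<in> carrier M \<Longrightarrow> v \<in> carrier N \<Longrightarrow>
      \<beta> (u \<oplus>\<^bsub>M\<^esub> u') v = \<beta> u v + \<beta> u' v"
    and smult: "\<And>u z v. u \<in> carrier M \<Longrightarrow> v \<in> carrier N \<Longrightarrow> \<beta> (z \<odot>\<^bsub>M\<^esub> u) v = z * \<beta> u v"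
    and cont: "\<And>u. u \<in> carrier M \<Longrightarrow> continuous_map (lc_topology N) euclidean (\<beta> u)"
    and bound: "\<And>B. bounded_in N B \<Longrightarrow>
      \<exists>P\<in>seminorms M. \<exists>C\<ge>0. \<forall>u\<in>carrier M. \<forall>v\<in>B. gnorm (\<beta> u v) \<le> C * P u"
    and inj: "\<And>u. u \<in> carrier M \<Longrightarrow> (\<And>v. v \<in> carrier N \<Longrightarrow> \<beta> u v = 0) \<Longrightarrow> u = \<zero>\<^bsub>M\<^esub>"
  shows "continuous_linear_embedding M (dual N) (\<lambda>u. \<lambda>v\<in>carrier N. \<beta> u v)"
proof -
  interpret M: gc_module M by fact
  interpret N: gc_module N by fact
  have lin1: "linear_functional M (\<lambda>u. \<beta> u v)" if "v \<in> carrier N" for v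
    using that by (simp add: linear_functional_def add smult)
  have maps: "(\<lambda>u. \<lambda>v\<in>carrier N. \<beta> u v) \<in> carrier M \<rightarrow> carrier (dual N)"
    using restrict_in_dual[OF N(1) lin cont] by blast
  have addf: "(\<lambda>v\<in>carrier N. \<beta> (u \<oplus>\<^bsub>M\<^esub> u') v) =
      (\<lambda>v\<in>carrier N. \<beta> u v) \<oplus>\<^bsub>dual N\<^esub> (\<lambda>v\<in>carrier N. \<beta> u' v)"
    if "u \<in> carrier M" "u' \<in> carrier M" for u u'
    using that by (auto simp: dual_ops add restrict_def fun_eq_iff)
  have smultf: "(\<lambda>v\<in>carrier N. \<beta> (z \<odot>\<^bsub>M\<^esub> u) v) = z \<odot>\<^bsub>dual N\<^esub> (\<lambda>v\<in>carrier N. \<beta> u v)"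
    if "u \<in> carrier M" for u z
    using that by (auto simp: dual_ops smult restrict_def fun_eq_iff)
  have injf: "inj_on (\<lambda>u. \<lambda>v\<in>carrier N. \<beta> u v) (carrier M)"
  proof (rule inj_onI)
    fix u u' assume u: "u \<in> carrier M" "u' \<in> carrier M"
      and eq: "(\<lambda>v\<in>carrier N. \<beta> u v) = (\<lambda>v\<in>carrier N. \<beta> u' v)"
    have "\<beta> (u \<ominus>\<^bsub>M\<^esub> u') v = 0" if "v \<in> carrier N" for v
      using linear_functional_minus[OF M(1) lin1[OF that] u] fun_cong[OF eq, of v] that by simp
    then have "u \<ominus>\<^bsub>M\<^esub> u' = \<zero>\<^bsub>M\<^esub>" by (intro inj M.minus_closed u)
    then show "u = u'" using M.minus_eq_zero_iff[OF u] by simp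
  qed
  have "continuous_map (lc_topology M) (lc_topology (dual N)) (\<lambda>u. \<lambda>v\<in>carrier N. \<beta> u v)"
    unfolding lc_topology_def
  proof (rule continuous_map_seminorm_linear[OF M(1) gc_module_dual[OF N(1)] maps addf M(2)
        ups_dual_seminorms[OF N(1)]])
    fix Q assume "Q \<in> seminorms (dual N)"
    then obtain B where B: "bounded_in N B" "Q = (\<lambda>T. sup_nonneg ((\<lambda>u. gnorm (T u)) ` B))"
      by (auto simp: dual_ops)
    obtain P C where P: "P \<in> seminorms M" "0 \<le> C"
      "\<And>u v. u \<in> carrier M \<Longrightarrow> v \<in> B \<Longrightarrow> gnorm (\<beta> u v) \<le> C * P u"
      using bound[OF B(1)] by blast
    have "Q (\<lambda>v\<in>carrier N. \<beta> u v) \<le> C * P u" if "u \<in> carrier M" for u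
    proof -
      have "0 \<le> P u" using M(2)[OF P(1)] that by (simp add: ultra_pseudo_seminorm_def)
      then show ?thesis
        unfolding B(2) using P(2,3) that B(1) by (intro sup_nonneg_le) (auto simp: bounded_in_def)
    qed
    then show "\<exists>P\<in>seminorms M. \<exists>C. \<forall>u\<in>carrier M. Q (\<lambda>v\<in>carrier N. \<beta> u v) \<le> C * P u"
      using P(1) by blast
  qed
  then show ?thesis
    unfolding continuous_linear_embedding_def using maps addf smultf injf by blast
qed

lemma continuous_map_inclusion:
  assumes "lc_submodule N M" "\<And>P. P \<in> F \<Longrightarrow> ultra_pseudo_seminorm M P"
    "\<And>Q. Q \<in> G \<Longrightarrow> ultra_pseudo_seminorm N Q"
    "\<And>P. P \<in> F \<Longrightarrow> \<exists>Q\<in>G. \<exists>C. \<forall>u\<in>carrier N. P u \<le> C * Q u"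
  shows "continuous_map (seminorm_topology N G) (seminorm_topology M F) id"
  by (rule continuous_map_seminorm_linear) (use assms in \<open>auto simp: lc_submodule_def\<close>)

text \<open>The singleton family \<open>{P}\<close> is the witness: it determines a locally convex
  topology, and the inclusion of a step is continuous for it once \<open>P\<close> is dominated by a
  seminorm of that step.\<close>

lemma ind_lim_seminormsI:
  assumes "ultra_pseudo_seminorm M P"
    and "\<And>S. S \<in> \<S> \<Longrightarrow> lc_submodule S M"
    and "\<And>S Q. S \<in> \<S> \<Longrightarrow> Q \<in> seminorms S \<Longrightarrow> ultra_pseudo_seminorm S Q"
    and "\<And>S. S \<in> \<S> \<Longrightarrow> \<exists>Q\<in>seminorms S. \<exists>C. \<forall>u\<in>carrier S. P u \<le> C * Q u"
  shows "P \<in> ind_lim_seminorms M \<S>"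
proof -
  have "continuous_map (lc_topology S) (seminorm_topology M {P}) id" if "S \<in> \<S>" for S
    unfolding lc_topology_def
    by (rule continuous_map_inclusion) (use assms that in auto)
  then show ?thesis unfolding ind_lim_seminorms_def using assms(1) by blast
qed

lemma bounded_in_lc_submodule:
  assumes "lc_submodule N M" "continuous_map (lc_topology N) (lc_topology M) id" "bounded_in N B"
  shows "bounded_in M B"
  unfolding bounded_in_def
proof (intro conjI allI impI)
  show "B \<subseteq> carrier M" using assms(1,3) by (auto simp: bounded_in_def lc_submodule_def)
  fix P assume P: "ultra_pseudo_seminorm M P \<and> continuous_map (lc_topology M) euclideanreal P"
  have "continuous_map (lc_topology N) euclideanreal P"
    using continuous_map_compose[OF assms(2) conjunct2[OF P]] by (simp add: o_def)
  then show "\<exists>C. \<forall>u\<in>B. P u \<le> C"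
    using assms(3) ups_lc_submodule[OF assms(1) conjunct1[OF P]] unfolding bounded_in_def by blast
qed

text \<open>Injectivity is density of \<open>N\<close> in \<open>M\<close>, in the strong form that
  finitely many seminorms can be made exactly zero. Continuity holds because a set bounded in
  \<open>N\<close> is bounded in \<open>M\<close>, so that a seminorm of \<open>dual N\<close> is
  also one of \<open>dual M\<close>.\<close>

lemma restriction_embedding:
  fixes M N :: "'a lc_module"
  assumes sub: "lc_submodule N M"
    and upsM: "\<And>P. P \<in> seminorms M \<Longrightarrow> ultra_pseudo_seminorm M P"
    and upsN: "\<And>P. P \<in> seminorms N \<Longrightarrow> ultra_pseudo_seminorm N P"
    and incl: "seminorms M \<subseteq> seminorms N"
    and dense: "\<And>u F. u \<in> carrier M \<Longrightarrow> finite F \<Longrightarrow> F \<subseteq> seminorms M \<Longrightarrow>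
      \<exists>w\<in>carrier N. \<forall>P\<in>F. P (w \<ominus>\<^bsub>M\<^esub> u) = 0"
  shows "continuous_linear_embedding (dual M) (dual N) (\<lambda>T. restrict T (carrier N))"
proof -
  have M: "gc_module M" and N: "gc_module N" and subset: "carrier N \<subseteq> carrier M"
    using sub by (simp_all add: lc_submodule_def)
  interpret M: gc_module M by fact
  interpret N: gc_module N by fact
  have id: "continuous_map (lc_topology N) (lc_topology M) id"
    unfolding lc_topology_def
  proof (rule continuous_map_inclusion[OF sub upsM upsN])
    fix P assume "P \<in> seminorms M"
    then show "\<exists>Q\<in>seminorms N. \<exists>C. \<forall>u\<in>carrier N. P u \<le> C * Q u"
      using incl by (intro bexI[of _ P] exI[of _ 1]) auto
  qed
  have lin: "linear_functional N T" if "linear_functional M T" for T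
  proof -
    have "u \<oplus>\<^bsub>N\<^esub> v = u \<oplus>\<^bsub>M\<^esub> v" "z \<odot>\<^bsub>N\<^esub> u = z \<odot>\<^bsub>M\<^esub> u" for u v z
      using sub by (simp_all add: lc_submodule_def)
    then show ?thesis
      using linear_functional_add[OF that] linear_functional_smult[OF that] subsetD[OF subset]
      by (simp add: linear_functional_def)
  qed
  have maps: "(\<lambda>T. restrict T (carrier N)) \<in> carrier (dual M) \<rightarrow> carrier (dual N)"
  proof
    fix T assume T: "T \<in> carrier (dual M)"
    then have "continuous_map (lc_topology N) euclidean T"
      using continuous_map_compose[OF id, of euclidean T] by (simp add: dual_carrier o_def)
    then show "restrict T (carrier N) \<in> carrier (dual N)"
      using T lin by (intro restrict_in_dual N) (simp_all add: dual_carrier)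
  qed
  have addf: "restrict (S \<oplus>\<^bsub>dual M\<^esub> T) (carrier N) =
      restrict S (carrier N) \<oplus>\<^bsub>dual N\<^esub> restrict T (carrier N)" for S T
    using subset by (auto simp: dual_ops restrict_def fun_eq_iff)
  have smultf: "restrict (z \<odot>\<^bsub>dual M\<^esub> T) (carrier N) = z \<odot>\<^bsub>dual N\<^esub> restrict T (carrier N)" for z T
    using subset by (auto simp: dual_ops restrict_def fun_eq_iff)
  have injf: "inj_on (\<lambda>T. restrict T (carrier N)) (carrier (dual M))"
  proof (rule inj_onI)
    fix S T assume ST: "S \<in> carrier (dual M)" "T \<in> carrier (dual M)"
      and eq: "restrict S (carrier N) = restrict T (carrier N)"
    have "S u = T u" if u: "u \<in> carrier M" for u
    proof (rule ccontr)
      assume ne: "S u \<noteq> T u"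
      \<comment> \<open>The difference is written as a sum with a multiple by \<open>- 1\<close>, to
        which the continuity results for sums and scalar multiples apply.\<close>
      define D where "D v = S v + (- 1) * T v" for v
      have "continuous_map (lc_topology M) euclidean D"
        unfolding D_def using ST by (intro continuous_gcomplex_add continuous_gcomplex_smult) (simp_all add: dual_carrier)
      then have "openin (lc_topology M) {v \<in> topspace (lc_topology M). D v \<in> - {0}}"
        by (rule openin_continuous_map_preimage) (simp add: open_Compl)
      then have "openin (seminorm_topology M (seminorms M)) {v \<in> carrier M. D v \<noteq> 0}"
        by (simp add: topspace_seminorm_topology lc_topology_def)
      from openin_seminorm_topology_nbhd[OF M upsM this, of u]
      obtain F r where F: "finite F" "F \<subseteq> seminorms M" "0 < r"
        "\<And>v. v \<in> carrier M \<Longrightarrow> \<forall>P\<in>F. P (v \<ominus>\<^bsub>M\<^esub> u) < r \<Longrightarrow> D v \<noteq> 0"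
        using u ne by (auto simp: D_def)
      \<comment> \<open>\<open>D\<close> has no zero where the finitely many seminorms in
        \<open>F\<close> are close to their values at \<open>u\<close>; but \<open>N\<close> reaches
        into that region, and \<open>D\<close> vanishes on \<open>N\<close>.\<close>
      obtain w where w: "w \<in> carrier N" "\<forall>P\<in>F. P (w \<ominus>\<^bsub>M\<^esub> u) = 0"
        using dense[OF u F(1,2)] by blast
      have "D w \<noteq> 0" using F(3) w subset by (intro F(4)) auto
      moreover have "S w = T w" using fun_cong[OF eq, of w] w(1) by simp
      ultimately show False by (simp add: D_def)
    qed
    then show "S = T"
      using ST extensionalityI[of S "carrier M" T] by (simp add: dual_carrier)
  qed
  have "continuous_map (lc_topology (dual M)) (lc_topology (dual N)) (\<lambda>T. restrict T (carrier N))"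
    unfolding lc_topology_def
  proof (rule continuous_map_seminorm_linear[OF gc_module_dual[OF M] gc_module_dual[OF N] maps addf
        ups_dual_seminorms[OF M] ups_dual_seminorms[OF N]])
    fix Q assume "Q \<in> seminorms (dual N)"
    then obtain B where B: "bounded_in N B" "Q = (\<lambda>T. sup_nonneg ((\<lambda>u. gnorm (T u)) ` B))"
      by (auto simp: dual_ops)
    have "bounded_in M B" by (rule bounded_in_lc_submodule[OF sub id B(1)])
    then have "Q \<in> seminorms (dual M)" by (auto simp: dual_ops B(2))
    moreover have "(\<lambda>u. gnorm (restrict T (carrier N) u)) ` B = (\<lambda>u. gnorm (T u)) ` B" for T
      using B(1) by (auto simp: bounded_in_def intro!: image_cong)
    then have "Q (restrict T (carrier N)) = Q T" for T by (simp add: B(2))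
    ultimately show "\<exists>P\<in>seminorms (dual M). \<exists>C. \<forall>T\<in>carrier (dual M). Q (restrict T (carrier N)) \<le> C * P T"
      by (intro bexI[of _ Q] exI[of _ 1]) auto
  qed
  then show ?thesis
    unfolding continuous_linear_embedding_def using maps addf smultf injf by blast
qed

text \<open>In the definition of \<open>\<G>_c\<close> and \<open>\<G>_inf_c\<close> the family is
  formed over a record whose \<open>seminorms\<close> field is not yet the final one. This allows it
  to be formed over the finished module.\<close>

lemma ind_lim_seminorms_cong:
  fixes M M' :: "'a lc_module"
  assumes "lc_submodule M M'" "carrier M = carrier M'"
  shows "ind_lim_seminorms M \<S> = ind_lim_seminorms M' \<S>"
proof -
  have sub: "lc_submodule M' M"
    using assms by (simp add: lc_submodule_def)
  have "ultra_pseudo_seminorm M P \<longleftrightarrow> ultra_pseudo_seminorm M' P" for P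
    using ups_lc_submodule[OF sub] ups_lc_submodule[OF assms(1)] by blast
  moreover have "seminorm_topology M F = seminorm_topology M' F" for F
  proof -
    have "v \<ominus>\<^bsub>M\<^esub> u = v \<ominus>\<^bsub>M'\<^esub> u" if "u \<in> carrier M'" "v \<in> carrier M'" for u v
      using lc_submodule_minus[OF assms(1)] that assms(2) by simp
    then have *: "{v \<in> carrier M'. P (v \<ominus>\<^bsub>M\<^esub> u) < r} = {v \<in> carrier M'. P (v \<ominus>\<^bsub>M'\<^esub> u) < r}"
      if "u \<in> carrier M'" for P :: "'a \<Rightarrow> real" and u r
      using that by auto
    have "{{v \<in> carrier M'. P (v \<ominus>\<^bsub>M\<^esub> u) < r} | P u r. P \<in> F \<and> u \<in> carrier M' \<and> 0 < r} =
        {{v \<in> carrier M'. P (v \<ominus>\<^bsub>M'\<^esub> u) < r} | P u r. P \<in> F \<and> u \<in> carrier M' \<and> 0 < r}"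
      by (intro Collect_cong ex_cong1 iffI) (auto simp: *)
    then show ?thesis unfolding seminorm_topology_def assms(2) by simp
  qed
  ultimately show ?thesis unfolding ind_lim_seminorms_def by simp
qed

lemma ups_pullback:
  assumes "gc_module M" "gc_module N" "ultra_pseudo_seminorm N Q" "\<And>u. u \<in> carrier M \<Longrightarrow> f u \<in> carrier N"
    "\<And>u v. u \<in> carrier M \<Longrightarrow> v \<in> carrier M \<Longrightarrow> f (u \<oplus>\<^bsub>M\<^esub> v) = f u \<oplus>\<^bsub>N\<^esub> f v"
    "\<And>u z. u \<in> carrier M \<Longrightarrow> f (z \<odot>\<^bsub>M\<^esub> u) = z \<odot>\<^bsub>N\<^esub> f u"
  shows "ultra_pseudo_seminorm M (\<lambda>u. Q (f u))"
proof -
  interpret M: gc_module M by fact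
  interpret N: gc_module N by fact
  have Q: "0 \<le> Q u" "Q (z \<odot>\<^bsub>N\<^esub> u) \<le> gnorm z * Q u" "v \<in> carrier N \<Longrightarrow> Q (u \<oplus>\<^bsub>N\<^esub> v) \<le> max (Q u) (Q v)"
    if "u \<in> carrier N" for u v z
    using assms(3) that unfolding ultra_pseudo_seminorm_def by blast+
  have "f \<zero>\<^bsub>M\<^esub> = \<zero>\<^bsub>N\<^esub>"
    using assms(6)[OF M.zero_closed, of 0] M.smult_zero_left[OF M.zero_closed]
      N.smult_zero_left[OF assms(4)[OF M.zero_closed]] by simp
  then have "Q (f \<zero>\<^bsub>M\<^esub>) = 0" using assms(3) by (simp add: ultra_pseudo_seminorm_def)
  then show ?thesis
    by (intro M.upsI) (simp_all add: assms(4-6) Q)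
qed

lemma bounded_seminorm:
  assumes "gc_module M" "bounded_in M B" "P \<in> seminorms M" "ultra_pseudo_seminorm M P"
  obtains C where "0 \<le> C" "\<And>u. u \<in> B \<Longrightarrow> P u \<le> C"
proof -
  have "continuous_map (lc_topology M) euclideanreal P"
    unfolding lc_topology_def by (rule continuous_ups[OF assms(1,4,3)])
  then obtain C where "\<And>u. u \<in> B \<Longrightarrow> P u \<le> C" using assms(2,4) unfolding bounded_in_def by blast
  then show thesis using that[of "max 0 C"] by force
qed


section \<open>Negligible values imply negligible derivatives\<close>

text \<open>Interpolation inequality of Landau type: a Taylor expansion along the axis bounds the
  first derivative by the values divided by \<open>h\<close> plus \<open>h\<close> times the second
  derivative. With \<open>h\<close> a power of \<epsilon>, small values outweigh moderate second
  derivatives.\<close>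

lemma partial_derivative_interpolation:
  fixes f :: "real^'n \<Rightarrow> complex"
  assumes "open \<Omega>" "smooth_on \<Omega> f" "0 < h" "cball x h \<subseteq> \<Omega>"
    and B: "\<And>y. y \<in> cball x h \<Longrightarrow> cmod (partial_derivative i (partial_derivative i f) y) \<le> B"
    and A: "\<And>y. y \<in> cball x h \<Longrightarrow> cmod (f y) \<le> A"
  shows "cmod (partial_derivative i f x) \<le> 2 * A / h + 3 * h * B"
proof -
  define p where "p t = x + t *\<^sub>R axis i (1::real)" for t
  have p: "p t \<in> cball x h" if "t \<in> {0..h}" for t
    using that by (simp add: p_def dist_norm)
  have der: "((\<lambda>t. foldr partial_derivative is f (p t)) has_vector_derivative
      partial_derivative i (foldr partial_derivative is f) (p t)) (at t within {0..h})"
    if "t \<in> {0..h}" for t "is"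
    unfolding p_def
    by (rule has_vector_derivative_at_within, rule has_vector_derivative_partial_derivative)
      (use smooth_on_differentiable[OF assms(1,2)] p[OF that] assms(4) in \<open>auto simp: p_def\<close>)
  \<comment> \<open>The second derivative varies by at most \<open>2 * B\<close>, so linearizing the
    first derivative leaves an error \<open>2 * B * t\<close>; the linear term contributes another
    \<open>B * t\<close>. This is the origin of the factor 3.\<close>
  have first: "cmod (partial_derivative i f (p t) - partial_derivative i f (p 0)) \<le> 3 * h * B"
    if t: "t \<in> {0..h}" for t
  proof -
    have "norm (partial_derivative i f (p t) - partial_derivative i f (p 0) -
        (t - 0) *\<^sub>R partial_derivative i (partial_derivative i f) (p 0)) \<le> norm (t - 0) * (2 * B)"
    proof (rule vector_differentiable_bound_linearization[where S = "{0..h}"])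
      fix s assume s: "s \<in> {0..h}"
      show "((\<lambda>s. partial_derivative i f (p s)) has_vector_derivative
          partial_derivative i (partial_derivative i f) (p s)) (at s within {0..h})"
        using der[OF s, of "[i]"] by simp
      show "cmod (partial_derivative i (partial_derivative i f) (p s) -
          partial_derivative i (partial_derivative i f) (p 0)) \<le> 2 * B"
        using norm_triangle_ineq4[of "partial_derivative i (partial_derivative i f) (p s)"
            "partial_derivative i (partial_derivative i f) (p 0)"]
          B[OF p[OF s]] B[OF p[of 0]] assms(3) by simp
    qed (use t assms(3) in \<open>auto simp: closed_segment_eq_real_ivl\<close>)
    then have "cmod (partial_derivative i f (p t) - partial_derivative i f (p 0) -
        t *\<^sub>R partial_derivative i (partial_derivative i f) (p 0)) \<le> t * (2 * B)"
      using t by simp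
    moreover have "cmod (t *\<^sub>R partial_derivative i (partial_derivative i f) (p 0)) \<le> t * B"
      using t B[OF p[of 0]] assms(3) by (simp add: mult_left_mono)
    ultimately have "cmod (partial_derivative i f (p t) - partial_derivative i f (p 0)) \<le> t * (2 * B) + t * B"
      using norm_triangle_sub[of "partial_derivative i f (p t) - partial_derivative i f (p 0)"
          "t *\<^sub>R partial_derivative i (partial_derivative i f) (p 0)"] by linarith
    also have "\<dots> = t * (3 * B)" by simp
    also have "\<dots> \<le> h * (3 * B)"
      using t order_trans[OF norm_ge_zero B[OF p[of 0]]] assms(3) by (intro mult_right_mono) auto
    finally show ?thesis by (simp add: mult_ac)
  qed
  \<comment> \<open>Linearization once more, now of \<open>f\<close> itself, with the variation of
    its derivative just found.\<close>
  have "norm (f (p h) - f (p 0) - (h - 0) *\<^sub>R partial_derivative i f (p 0)) \<le> norm (h - 0) * (3 * h * B)"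
    by (rule vector_differentiable_bound_linearization[where S = "{0..h}" and f = "\<lambda>t. f (p t)"
          and f' = "\<lambda>t. partial_derivative i f (p t)"])
      (use der[of _ "[]"] first assms(3) in \<open>auto simp: closed_segment_eq_real_ivl\<close>)
  then have "cmod (f (p h) - f (p 0) - h *\<^sub>R partial_derivative i f (p 0)) \<le> h * (3 * h * B)"
    using assms(3) by simp
  moreover have "cmod (f (p h) - f (p 0)) \<le> 2 * A"
    using norm_triangle_ineq4[of "f (p h)" "f (p 0)"] A[OF p[of h]] A[OF p[of 0]] assms(3) by simp
  ultimately have "cmod (h *\<^sub>R partial_derivative i f (p 0)) \<le> 2 * A + h * (3 * h * B)"
    using norm_triangle_sub[of "h *\<^sub>R partial_derivative i f (p 0)" "f (p h) - f (p 0)"]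
    by (simp add: norm_minus_commute)
  then have "h * cmod (partial_derivative i f x) \<le> 2 * A + h * (3 * h * B)"
    using assms(3) by (simp add: p_def)
  then show ?thesis using assms(3) by (simp add: field_simps)
qed

lemma eventually_powr_le:
  assumes "0 < a" "0 < (\<delta>::real)"
  shows "\<forall>\<^sub>F \<epsilon> in at_right 0. \<epsilon> powr a \<le> \<delta>"
proof -
  have "((\<lambda>\<epsilon>::real. \<epsilon> powr a) \<longlongrightarrow> 0 powr a) (at_right 0)"
    by (rule tendsto_powr') (use assms(1) in \<open>auto intro!: tendsto_intros intro: eventually_mono[OF eventually_at_right_less[of 0]]\<close>)
  then have "\<forall>\<^sub>F \<epsilon> in at_right 0. \<epsilon> powr a < \<delta>"
    using assms by (intro order_tendstoD) auto
  then show ?thesis by (rule eventually_mono) simp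
qed

lemma compact_neighbourhood:
  fixes C :: "(real^'n) set"
  assumes "compact C" "open \<Omega>" "C \<subseteq> \<Omega>"
  obtains \<delta> L where "0 < \<delta>" "compact L" "L \<subseteq> \<Omega>" "\<And>x. x \<in> C \<Longrightarrow> cball x \<delta> \<subseteq> L"
proof -
  obtain \<delta> where "\<delta> > 0" "(\<Union>x\<in>C. cball x \<delta>) \<subseteq> \<Omega>"
    using compact_subset_open_imp_cball_epsilon_subset[OF assms] by blast
  then show thesis using that[of \<delta> "\<Union>x\<in>C. cball x \<delta>"] compact_minkowski_sum_cball[OF assms(1)] by blast
qed

lemma E_M_foldr:
  assumes "open \<Omega>" "u \<in> E_M \<Omega>"
  shows "(\<lambda>\<epsilon>. foldr partial_derivative is (u \<epsilon>)) \<in> E_M \<Omega>"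
  unfolding E_M_iff[OF assms(1)]
proof (intro conjI allI impI)
  show "(\<lambda>\<epsilon>. foldr partial_derivative is (u \<epsilon>)) \<in> smooth_nets \<Omega>"
    using E_M_smooth[OF assms(2)] by (auto simp: smooth_nets_def intro: smooth_on_foldr)
  fix K and js :: "'a list" assume "compact K \<and> K \<subseteq> \<Omega>"
  then have "\<exists>N::nat. unif_O K (\<lambda>\<epsilon>. foldr partial_derivative (js @ is) (u \<epsilon>)) (- real N)"
    using assms(2) unfolding E_M_iff[OF assms(1)] by meson
  then show "\<exists>N::nat. unif_O K (\<lambda>\<epsilon>. foldr partial_derivative js (foldr partial_derivative is (u \<epsilon>))) (- real N)"
    by simp
qed

text \<open>Interpolation uses a segment around each point, so values are taken from a compact
  neighbourhood \<open>L\<close> of \<open>K\<close>; hence negligibility is assumed on all compact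
  sets.\<close>

lemma negligible_partial_derivative:
  fixes u :: "('n::finite) net"
  assumes "open \<Omega>" "u \<in> E_M \<Omega>" "compact K" "K \<subseteq> \<Omega>"
    and negl: "\<And>L (q::nat). compact L \<Longrightarrow> L \<subseteq> \<Omega> \<Longrightarrow> unif_O L u (real q)"
  shows "unif_O K (\<lambda>\<epsilon>. partial_derivative i (u \<epsilon>)) (real q)"
proof -
  obtain \<delta> L where L: "0 < \<delta>" "compact L" "L \<subseteq> \<Omega>" "\<And>x. x \<in> K \<Longrightarrow> cball x \<delta> \<subseteq> L"
    using compact_neighbourhood[OF assms(3,1,4)] by metis
  obtain N :: nat where "unif_O L (\<lambda>\<epsilon>. foldr partial_derivative [i, i] (u \<epsilon>)) (- real N)"
    using assms(2) L unfolding E_M_iff[OF assms(1)] by meson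
  then obtain c where c: "c > 0" "\<forall>\<^sub>F \<epsilon> in at_right 0. \<epsilon> \<in> {0<..1} \<and>
      (\<forall>x\<in>L. cmod (foldr partial_derivative [i, i] (u \<epsilon>) x) \<le> c * \<epsilon> powr (- real N))"
    by (rule unif_OE)
  \<comment> \<open>The step will be \<open>h = \<epsilon> powr real m\<close>. Values of order
    \<open>q + m\<close> divided by \<open>h\<close> have order \<open>q\<close>, and second
    derivatives of order \<open>- N\<close> multiplied by \<open>h\<close> have order
    \<open>q + 1\<close>.\<close>
  define m where "m = q + N + 1"
  have "unif_O L u (real (q + m))" by (rule negl[OF L(2,3)])
  then obtain d where d: "d > 0" "\<forall>\<^sub>F \<epsilon> in at_right 0. \<epsilon> \<in> {0<..1} \<and>
      (\<forall>x\<in>L. cmod (u \<epsilon> x) \<le> d * \<epsilon> powr real (q + m))"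
    by (rule unif_OE)
  have "\<forall>\<^sub>F \<epsilon>::real in at_right 0. \<epsilon> powr real m \<le> \<delta>"
    by (rule eventually_powr_le) (use L(1) in \<open>simp_all add: m_def\<close>)
  with c(2) d(2) have "\<forall>\<^sub>F \<epsilon> in at_right 0. \<forall>x\<in>K. cmod (partial_derivative i (u \<epsilon>) x) \<le> (2 * d + 3 * c) * \<epsilon> powr real q"
  proof eventually_elim
    case (elim \<epsilon>)
    then have \<epsilon>: "0 < \<epsilon>" "\<epsilon> \<le> 1" by auto
    show ?case
    proof
      fix x assume x: "x \<in> K"
      define h where "h = \<epsilon> powr real m"
      have h: "0 < h" using \<epsilon> by (simp add: h_def)
      have sub: "cball x h \<subseteq> L" using L(4)[OF x] elim by (auto simp: h_def)
      have "cmod (partial_derivative i (u \<epsilon>) x) \<le>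
          2 * (d * \<epsilon> powr real (q + m)) / h + 3 * h * (c * \<epsilon> powr (- real N))"
        by (rule partial_derivative_interpolation[OF assms(1) smooth_netsD[OF E_M_smooth[OF assms(2)]] h])
          (use sub L(3) elim in auto)
      also have "\<dots> = 2 * d * \<epsilon> powr real q + 3 * c * \<epsilon> powr (real q + 1)"
      proof -
        have "2 * (d * \<epsilon> powr real (q + m)) / h = 2 * d * \<epsilon> powr real q"
          using \<epsilon> by (simp add: h_def powr_add)
        moreover have "h * \<epsilon> powr (- real N) = \<epsilon> powr (real q + 1)"
          by (simp add: h_def m_def powr_add[symmetric] add.commute)
        ultimately show ?thesis by simp
      qed
      also have "\<dots> \<le> 2 * d * \<epsilon> powr real q + 3 * c * \<epsilon> powr real q"
        using \<epsilon> c(1) by (intro add_left_mono mult_left_mono powr_mono') auto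
      finally show "cmod (partial_derivative i (u \<epsilon>) x) \<le> (2 * d + 3 * c) * \<epsilon> powr real q"
        by (simp add: distrib_right)
    qed
  qed
  then show ?thesis by (rule unif_OI)
qed

text \<open>Derivatives of a moderate net are moderate nets, so the passage from values to first
  derivatives can be iterated along the list.\<close>

lemma N_ideal_if_values_negligible:
  fixes u :: "('n::finite) net"
  assumes "open \<Omega>" "u \<in> E_M \<Omega>"
    and negl: "\<And>L (q::nat). compact L \<Longrightarrow> L \<subseteq> \<Omega> \<Longrightarrow> unif_O L u (real q)"
  shows "u \<in> N_ideal \<Omega>"
proof -
  have "unif_O L (\<lambda>\<epsilon>. foldr partial_derivative is (u \<epsilon>)) (real q)"
    if "compact L" "L \<subseteq> \<Omega>" for L "is" and q :: nat
    using that
  proof (induction "is" arbitrary: L q)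
    case (Cons i js)
    have "unif_O L (\<lambda>\<epsilon>. partial_derivative i (foldr partial_derivative js (u \<epsilon>))) (real q)"
      by (rule negligible_partial_derivative[OF assms(1) E_M_foldr[OF assms(1,2)] Cons.prems Cons.IH])
    then show ?case by simp
  qed (simp add: negl)
  then show ?thesis unfolding N_ideal_iff[OF assms(1)] using E_M_smooth[OF assms(2)] by blast
qed


section \<open>Supports\<close>

text \<open>The locality that makes a largest open set of vanishing exist: a compact subset of the
  union is covered by finitely many closed balls, each inside one member of the family, and finitely
  many estimates combine.\<close>

lemma N_ideal_Union:
  fixes u :: "('n::finite) net"
  assumes "\<And>V. V \<in> \<V> \<Longrightarrow> open V \<and> u \<in> N_ideal V"
  shows "u \<in> N_ideal (\<Union>\<V>)"
proof -
  have op: "open (\<Union>\<V>)" using assms by blast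
  have "smooth_on (\<Union>\<V>) (u \<epsilon>)" if "\<epsilon> \<in> {0<..1}" for \<epsilon>
    by (rule smooth_on_Union) (use assms smooth_netsD[OF N_ideal_smooth _ ] that in blast)
  moreover have "unif_O K (\<lambda>\<epsilon>. foldr partial_derivative is (u \<epsilon>)) (real q)"
    if K: "compact K" "K \<subseteq> \<Union>\<V>" for K "is" and q :: nat
  proof -
    have "\<exists>r>0. \<exists>V\<in>\<V>. cball x r \<subseteq> V" if "x \<in> K" for x
    proof -
      obtain V where V: "V \<in> \<V>" "x \<in> V" using K(2) \<open>x \<in> K\<close> by blast
      then obtain r where "r > 0" "cball x r \<subseteq> V" using assms[OF V(1)] open_contains_cball by blast
      then show ?thesis using V(1) by blast
    qed
    then obtain r where r: "\<And>x. x \<in> K \<Longrightarrow> r x > 0 \<and> (\<exists>V\<in>\<V>. cball x (r x) \<subseteq> V)" by metis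
    have "K \<subseteq> (\<Union>x\<in>K. ball x (r x))" using r by force
    from compactE_image[OF K(1) _ this]
    obtain T where T: "T \<subseteq> K" "finite T" "K \<subseteq> (\<Union>x\<in>T. ball x (r x))" by auto
    have "unif_O (\<Union>x\<in>T. cball x (r x)) (\<lambda>\<epsilon>. foldr partial_derivative is (u \<epsilon>)) (real q)"
    proof (rule unif_O_UN[OF T(2)])
      fix x assume "x \<in> T"
      then obtain V where V: "V \<in> \<V>" "cball x (r x) \<subseteq> V" using r T(1) by blast
      then have "open V" "u \<in> N_ideal V" using assms by auto
      then show "unif_O (cball x (r x)) (\<lambda>\<epsilon>. foldr partial_derivative is (u \<epsilon>)) (real q)"
        using N_ideal_iff[of V u] V(2) compact_cball by blast
    qed
    then show ?thesis
      by (rule unif_O_mono[OF _ order_refl]) (use T(3) ball_subset_cball in blast)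
  qed
  ultimately show ?thesis unfolding N_ideal_iff[OF op] smooth_nets_def by blast
qed

lemma N_ideal_gclass:
  assumes "open \<Omega>" "u \<in> E_M \<Omega>" "open V" "V \<subseteq> \<Omega>"
  shows "representative (gclass \<Omega> u) \<in> N_ideal V \<longleftrightarrow> u \<in> N_ideal V"
proof -
  note r = representative_gclass[OF assms(1,2)]
  show ?thesis
    using N_ideal_add[OF assms(3) N_ideal_subset[OF r(2) assms(4)], of "representative (gclass \<Omega> u)"]
      N_ideal_add[OF assms(3) N_ideal_subset[OF r(3) assms(4)], of u] by auto
qed

lemma N_ideal_off_gsupport:
  fixes u :: "('n::finite) net"
  assumes "open \<Omega>" "u \<in> E_M \<Omega>"
  shows "open (\<Omega> - gsupport \<Omega> (gclass \<Omega> u))" "u \<in> N_ideal (\<Omega> - gsupport \<Omega> (gclass \<Omega> u))"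
proof -
  define \<V> where "\<V> = {V. open V \<and> V \<subseteq> \<Omega> \<and> representative (gclass \<Omega> u) \<in> N_ideal V}"
  have eq: "\<Omega> - gsupport \<Omega> (gclass \<Omega> u) = \<Union>\<V>"
    unfolding gsupport_def \<V>_def by blast
  have V: "open V \<and> u \<in> N_ideal V" if "V \<in> \<V>" for V
    using that N_ideal_gclass[OF assms] unfolding \<V>_def by blast
  show "open (\<Omega> - gsupport \<Omega> (gclass \<Omega> u))" unfolding eq using V by blast
  show "u \<in> N_ideal (\<Omega> - gsupport \<Omega> (gclass \<Omega> u))" unfolding eq by (rule N_ideal_Union[OF V])
qed

text \<open>Supports are henceforth handled as ideal membership of an arbitrary representative,
  which presents modules of classes with restricted support as images of sets of nets.\<close>

lemma gsupport_subset_iff: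
  fixes u :: "('n::finite) net"
  assumes "open \<Omega>" "u \<in> E_M \<Omega>" "closed C"
  shows "gsupport \<Omega> (gclass \<Omega> u) \<subseteq> C \<longleftrightarrow> u \<in> N_ideal (\<Omega> - C)"
proof
  assume "gsupport \<Omega> (gclass \<Omega> u) \<subseteq> C"
  then show "u \<in> N_ideal (\<Omega> - C)" by (intro N_ideal_subset[OF N_ideal_off_gsupport(2)[OF assms(1,2)]]) blast
next
  assume "u \<in> N_ideal (\<Omega> - C)"
  moreover have "open (\<Omega> - C)" using assms by auto
  ultimately have "representative (gclass \<Omega> u) \<in> N_ideal (\<Omega> - C)"
    using N_ideal_gclass[OF assms(1,2)] by blast
  then show "gsupport \<Omega> (gclass \<Omega> u) \<subseteq> C"
    unfolding gsupport_def using \<open>open (\<Omega> - C)\<close> by blast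
qed

section \<open>Exhausting sequences and compact supports\<close>

lemma exhausting_facts:
  assumes "exhausting \<Omega> K"
  shows "compact (K n)" "K n \<subseteq> interior (K (Suc n))" "K n \<subseteq> \<Omega>" "closed (K n)"
  using assms compact_imp_closed unfolding exhausting_def by blast+

lemma exhausting_mono:
  assumes "exhausting \<Omega> K" "m \<le> n"
  shows "K m \<subseteq> K n"
  using assms(2)
proof (rule lift_Suc_mono_le[rotated])
  show "K n \<subseteq> K (Suc n)" for n using exhausting_facts(2)[OF assms(1)] interior_subset by blast
qed

text \<open>The interiors of the \<open>K (Suc n)\<close> already cover \<Omega>, so compactness
  applies.\<close>

lemma exhausting_absorbs:
  assumes "exhausting \<Omega> K" "compact C" "C \<subseteq> \<Omega>"
  shows "\<exists>n. C \<subseteq> K n"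
proof -
  have "C \<subseteq> (\<Union>n. interior (K (Suc n)))"
    using assms(1,3) exhausting_facts(2)[OF assms(1)] unfolding exhausting_def by blast
  from compactE_image[OF assms(2) _ this]
  obtain I where I: "finite I" "C \<subseteq> (\<Union>n\<in>I. interior (K (Suc n)))" by auto
  have "interior (K (Suc n)) \<subseteq> K (Suc (Max I))" if "n \<in> I" for n
    using exhausting_mono[OF assms(1), of "Suc n" "Suc (Max I)"] I(1) that interior_subset by force
  then show ?thesis using I(2) by blast
qed

text \<open>The support is closed relative to \<Omega> only; once inside some \<open>K n\<close> it
  is a compact set minus an open set, hence compact.\<close>

lemma compact_gsupport_iff:
  fixes u :: "('n::finite) net"
  assumes "open \<Omega>" "exhausting \<Omega> K" "u \<in> E_M \<Omega>"
  shows "compact (gsupport \<Omega> (gclass \<Omega> u)) \<longleftrightarrow> (\<exists>n. u \<in> N_ideal (\<Omega> - K n))"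
proof
  assume c: "compact (gsupport \<Omega> (gclass \<Omega> u))"
  have "gsupport \<Omega> (gclass \<Omega> u) \<subseteq> \<Omega>" by (auto simp: gsupport_def)
  then obtain n where n: "gsupport \<Omega> (gclass \<Omega> u) \<subseteq> K n" using exhausting_absorbs[OF assms(2) c] by blast
  then show "\<exists>n. u \<in> N_ideal (\<Omega> - K n)"
    using gsupport_subset_iff[OF assms(1,3) exhausting_facts(4)[OF assms(2)]] by blast
next
  assume "\<exists>n. u \<in> N_ideal (\<Omega> - K n)"
  then obtain n where n: "gsupport \<Omega> (gclass \<Omega> u) \<subseteq> K n"
    using gsupport_subset_iff[OF assms(1,3) exhausting_facts(4)[OF assms(2)]] by blast
  then have "gsupport \<Omega> (gclass \<Omega> u) = K n - (\<Omega> - gsupport \<Omega> (gclass \<Omega> u))"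
    using exhausting_facts(3)[OF assms(2), of n] by blast
  moreover have "compact (K n - (\<Omega> - gsupport \<Omega> (gclass \<Omega> u)))"
    by (rule compact_diff[OF exhausting_facts(1)[OF assms(2)] N_ideal_off_gsupport(1)[OF assms(1,3)]])
  ultimately show "compact (gsupport \<Omega> (gclass \<Omega> u))" by simp
qed


section \<open>Integration\<close>

lemma norm_integral_le_content:
  fixes f :: "real^'n \<Rightarrow> complex"
  assumes "compact L" "\<And>y. cmod (f y) \<le> indicator L y * c"
  shows "cmod (integral\<^sup>L lborel f) \<le> measure lborel L * c"
proof (cases "integrable lborel f")
  case True
  have fin: "emeasure lborel L < \<infinity>" using assms(1) by (intro emeasure_bounded_finite compact_imp_bounded)
  have meas: "L \<in> sets lborel" using borel_compact[OF assms(1)] by simp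
  have "cmod (integral\<^sup>L lborel f) \<le> (\<integral>y. indicator L y * c \<partial>lborel)"
    by (rule Bochner_Integration.integral_norm_bound_integral[OF True])
      (use assms(2) fin meas in \<open>auto intro!: integrable_mult_left integrable_real_indicator\<close>)
  then show ?thesis using meas by simp
next
  \<comment> \<open>The integral of a non-integrable function is 0 by convention, so the right-hand
    side has to be nonnegative. A point of \<open>L\<close> gives \<open>0 \<le> c\<close>; for
    empty \<open>L\<close> the measure is 0.\<close>
  case False
  show ?thesis
  proof (cases "L = {}")
    case False
    then obtain y where "y \<in> L" by blast
    then have "0 \<le> c" using assms(2)[of y] order_trans[OF norm_ge_zero] by simp
    then show ?thesis using \<open>\<not> integrable lborel f\<close> by (simp add: not_integrable_integral_eq)
  qed (use False in \<open>simp add: not_integrable_integral_eq\<close>)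
qed

lemma order_O_integral:
  fixes w :: "('n::finite) net"
  assumes "unif_O K w b" "compact K"
  shows "order_O (\<lambda>\<epsilon>. cmod (LINT y:K|lborel. w \<epsilon> y)) b"
  using assms(1)
proof (rule unif_OE)
  fix c assume "c > 0" and c: "\<forall>\<^sub>F \<epsilon> in at_right 0. \<epsilon> \<in> {0<..1} \<and> (\<forall>x\<in>K. cmod (w \<epsilon> x) \<le> c * \<epsilon> powr b)"
  have "\<forall>\<^sub>F \<epsilon> in at_right 0. norm (cmod (LINT y:K|lborel. w \<epsilon> y)) \<le> (measure lborel K * c) * norm (\<epsilon> powr b)"
    using c
  proof eventually_elim
    case (elim \<epsilon>)
    have "cmod (LINT y:K|lborel. w \<epsilon> y) \<le> measure lborel K * (c * \<epsilon> powr b)"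
      unfolding set_lebesgue_integral_def
      by (rule norm_integral_le_content[OF assms(2)]) (use elim in \<open>auto simp: indicator_def\<close>)
    then show ?case by (simp add: mult.assoc)
  qed
  then show ?thesis by (rule bigoI)
qed

lemma E_M_values:
  assumes "open \<Omega>" "u \<in> E_M \<Omega>" "compact K" "K \<subseteq> \<Omega>"
  obtains N :: nat where "unif_O K u (- real N)"
proof -
  have "\<exists>N::nat. unif_O K (\<lambda>\<epsilon>. foldr partial_derivative [] (u \<epsilon>)) (- real N)"
    using assms(2-4) unfolding E_M_iff[OF assms(1)] by meson
  then show thesis using that by auto
qed

lemma N_ideal_values:
  assumes "open \<Omega>" "u \<in> N_ideal \<Omega>" "compact K" "K \<subseteq> \<Omega>"
  shows "unif_O K u (real (q::nat))"
proof -
  have "unif_O K (\<lambda>\<epsilon>. foldr partial_derivative [] (u \<epsilon>)) (real q)"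
    using assms(2-4) unfolding N_ideal_iff[OF assms(1)] by meson
  then show ?thesis by simp
qed

lemma moderate_integral:
  assumes "open \<Omega>" "u \<in> E_M \<Omega>" "compact K" "K \<subseteq> \<Omega>"
  shows "moderate (\<lambda>\<epsilon>. LINT y:K|lborel. u \<epsilon> y)"
  using E_M_values[OF assms] order_O_integral[OF _ assms(3)] moderate_order_O by metis

lemma smooth_net_integrable:
  assumes "u \<in> smooth_nets \<Omega>" "\<epsilon> \<in> {0<..1}" "compact K" "K \<subseteq> \<Omega>"
  shows "set_integrable lborel K (u \<epsilon>)"
proof -
  have "continuous_on K (u \<epsilon>)"
    using continuous_on_subset[OF smooth_on_continuous_on[OF smooth_netsD[OF assms(1,2)], of "[]"] assms(4)] by simp
  then show ?thesis
    unfolding set_integrable_def by (rule borel_integrable_compact[OF assms(3)])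
qed

lemma order_O_eventually_cong:
  assumes "order_O f b" "\<And>\<epsilon>. \<epsilon> \<in> {0<..1} \<Longrightarrow> f \<epsilon> = g \<epsilon>"
  shows "order_O g b"
proof -
  have "\<forall>\<^sub>F \<epsilon> in at_right 0. f \<epsilon> = g \<epsilon>"
    using eventually_unit_interval by eventually_elim (rule assms(2))
  then show ?thesis using assms(1) by (simp cong: landau_o.big.in_cong)
qed

text \<open>Smoothness, and with it integrability, is known for \<epsilon> in the unit interval
  only; identities between integrals hold there and determine the class.\<close>

lemma abs_gcomplex_cong:
  assumes "moderate z" "\<And>\<epsilon>. \<epsilon> \<in> {0<..1} \<Longrightarrow> z \<epsilon> = w \<epsilon>"
  shows "abs_gcomplex z = abs_gcomplex w"
proof -
  obtain N :: nat where "order_O (\<lambda>\<epsilon>. cmod (z \<epsilon>)) (- real N)" using assms(1) by (auto simp: moderate_def)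
  then have "order_O (\<lambda>\<epsilon>. cmod (w \<epsilon>)) (- real N)"
    by (rule order_O_eventually_cong) (use assms(2) in auto)
  then have w: "moderate w" by (rule moderate_order_O)
  have "negligible (\<lambda>\<epsilon>. z \<epsilon> - w \<epsilon>)"
    unfolding negligible_def
  proof
    fix q :: nat
    have "order_O (\<lambda>_. cmod 0) (real q)" by simp
    then show "order_O (\<lambda>\<epsilon>. cmod (z \<epsilon> - w \<epsilon>)) (real q)"
      by (rule order_O_eventually_cong) (use assms(2) in auto)
  qed
  then show ?thesis using abs_gcomplex_eq_iff[OF assms(1) w] by simp
qed

text \<open>Independence of both choices in the definition. Two compact neighbourhoods of the
  support differ by a set away from the support, where the net is negligible, and two
  representatives differ by a negligible net.\<close>

lemma gintegral_eq:
  fixes w :: "('n::finite) net"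
  assumes "open \<Omega>" "w \<in> E_M \<Omega>" "gsupport \<Omega> (gclass \<Omega> w) \<subseteq> interior K0" "compact K0" "K0 \<subseteq> \<Omega>"
  shows "gintegral \<Omega> (gclass \<Omega> w) = abs_gcomplex (\<lambda>\<epsilon>. LINT y:K0|lborel. w \<epsilon> y)"
proof -
  define S where "S = gsupport \<Omega> (gclass \<Omega> w)"
  define K1 where "K1 = (SOME K. compact K \<and> K \<subseteq> \<Omega> \<and> S \<subseteq> interior K)"
  have "compact K1 \<and> K1 \<subseteq> \<Omega> \<and> S \<subseteq> interior K1"
    unfolding K1_def by (rule someI[of _ K0]) (use assms in \<open>auto simp: S_def\<close>)
  then have K1: "compact K1" "K1 \<subseteq> \<Omega>" "S \<subseteq> interior K1" by auto
  define r where "r = representative (gclass \<Omega> w)"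
  note rep = representative_gclass[OF assms(1,2), folded r_def]
  \<comment> \<open>Removing interiors instead of the sets makes \<open>L\<close> compact. It
    contains the symmetric difference of \<open>K0\<close> and \<open>K1\<close>, and it misses the
    support, which lies in both interiors.\<close>
  define L where "L = (K1 - interior K0) \<union> (K0 - interior K1)"
  have L: "compact L" "L \<subseteq> \<Omega> - S" "L \<subseteq> \<Omega>"
    using K1 assms(3-5) interior_subset unfolding L_def S_def by (auto intro!: compact_diff)
  note off = N_ideal_off_gsupport[OF assms(1,2), folded S_def]
  have "w \<in> N_ideal (\<Omega> - S)" by (rule off(2))
  then have r_off: "r \<in> N_ideal (\<Omega> - S)"
    unfolding r_def using N_ideal_gclass[OF assms(1,2) off(1)] by blast
  \<comment> \<open>The difference is split at the integral of \<open>r\<close> over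
    \<open>K0\<close>: first the domain changes, then the representative.\<close>
  have "negligible (\<lambda>\<epsilon>. (LINT y:K1|lborel. r \<epsilon> y) - (LINT y:K0|lborel. w \<epsilon> y))"
    unfolding negligible_def
  proof
    fix q :: nat
    obtain c where c: "c > 0" "\<forall>\<^sub>F \<epsilon> in at_right 0. \<epsilon> \<in> {0<..1} \<and> (\<forall>x\<in>L. cmod (r \<epsilon> x) \<le> c * \<epsilon> powr real q)"
      using N_ideal_values[OF off(1) r_off L(1,2)] by (rule unif_OE)
    have "\<forall>\<^sub>F \<epsilon> in at_right 0. norm (cmod ((LINT y:K1|lborel. r \<epsilon> y) - (LINT y:K0|lborel. r \<epsilon> y)))
        \<le> (measure lborel L * c) * norm (\<epsilon> powr real q)"
      using c(2)
    proof eventually_elim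
      case (elim \<epsilon>)
      then have \<epsilon>: "\<epsilon> \<in> {0<..1}" by blast
      have int: "integrable lborel (\<lambda>y. indicator K1 y *\<^sub>R r \<epsilon> y)" "integrable lborel (\<lambda>y. indicator K0 y *\<^sub>R r \<epsilon> y)"
        using smooth_net_integrable[OF E_M_smooth[OF rep(1)] \<epsilon>] K1 assms(4,5)
        by (simp_all add: set_integrable_def)
      have "cmod (\<integral>y. indicator K1 y *\<^sub>R r \<epsilon> y - indicator K0 y *\<^sub>R r \<epsilon> y \<partial>lborel) \<le>
          measure lborel L * (c * \<epsilon> powr real q)"
      proof (rule norm_integral_le_content[OF L(1)])
        fix y
        show "cmod (indicator K1 y *\<^sub>R r \<epsilon> y - indicator K0 y *\<^sub>R r \<epsilon> y) \<le> indicator L y * (c * \<epsilon> powr real q)"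
          using elim interior_subset[of K0] interior_subset[of K1] mult_nonneg_nonneg[of c "\<epsilon> powr real q"] c(1)
          by (auto simp: indicator_def L_def)
      qed
      then show ?case
        by (simp add: set_lebesgue_integral_def Bochner_Integration.integral_diff[OF int] mult.assoc)
    qed
    then have 1: "order_O (\<lambda>\<epsilon>. cmod ((LINT y:K1|lborel. r \<epsilon> y) - (LINT y:K0|lborel. r \<epsilon> y))) (real q)"
      by (rule bigoI)
    have "order_O (\<lambda>\<epsilon>. cmod (LINT y:K0|lborel. r \<epsilon> y - w \<epsilon> y)) (real q)"
      by (rule order_O_integral[OF N_ideal_values[OF assms(1) rep(3) assms(4,5)] assms(4)])
    then have "order_O (\<lambda>\<epsilon>. cmod ((LINT y:K0|lborel. r \<epsilon> y) - (LINT y:K0|lborel. w \<epsilon> y))) (real q)"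
      by (rule order_O_eventually_cong)
        (use smooth_net_integrable[OF E_M_smooth[OF rep(1)] _ assms(4,5)]
          smooth_net_integrable[OF E_M_smooth[OF assms(2)] _ assms(4,5)] in \<open>simp add: set_integral_diff(2)\<close>)
    from order_O_add[OF 1 this]
    show "order_O (\<lambda>\<epsilon>. cmod ((LINT y:K1|lborel. r \<epsilon> y) - (LINT y:K0|lborel. w \<epsilon> y))) (real q)" by simp
  qed
  then have "abs_gcomplex (\<lambda>\<epsilon>. LINT y:K1|lborel. r \<epsilon> y) = abs_gcomplex (\<lambda>\<epsilon>. LINT y:K0|lborel. w \<epsilon> y)"
    using moderate_integral[OF assms(1) rep(1) K1(1,2)] moderate_integral[OF assms(1,2,4,5)]
    by (simp add: abs_gcomplex_eq_iff)
  then show ?thesis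
    by (simp add: gintegral_def K1_def S_def r_def Let_def)
qed

text \<open>A product is supported where either factor is. The integral runs over
  \<open>K (Suc n)\<close> and not \<open>K n\<close>, because the support must lie in the interior
  of the domain.\<close>

lemma gintegral_gmult:
  fixes u v :: "('n::finite) net"
  assumes "open \<Omega>" "exhausting \<Omega> K" "u \<in> E_M \<Omega>" "v \<in> E_M \<Omega>"
    and "u \<in> N_ideal (\<Omega> - K n) \<or> v \<in> N_ideal (\<Omega> - K n)"
  shows "gintegral \<Omega> (gmult \<Omega> (gclass \<Omega> u) (gclass \<Omega> v)) = abs_gcomplex (\<lambda>\<epsilon>. LINT y:K (Suc n)|lborel. u \<epsilon> y * v \<epsilon> y)"
proof -
  note K = exhausting_facts[OF assms(2)]
  have op: "open (\<Omega> - K n)" using assms(1) K(4) by auto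
  have uv: "(\<lambda>\<epsilon> x. u \<epsilon> x * v \<epsilon> x) \<in> E_M \<Omega>" by (rule E_M_mult[OF assms(1,3,4)])
  have "(\<lambda>\<epsilon> x. u \<epsilon> x * v \<epsilon> x) \<in> N_ideal (\<Omega> - K n)"
    using assms(5)
  proof
    assume "u \<in> N_ideal (\<Omega> - K n)"
    then show ?thesis by (rule N_ideal_mult[OF op _ E_M_subset[OF assms(4)]]) blast
  next
    assume "v \<in> N_ideal (\<Omega> - K n)"
    then have "(\<lambda>\<epsilon> x. v \<epsilon> x * u \<epsilon> x) \<in> N_ideal (\<Omega> - K n)"
      by (rule N_ideal_mult[OF op _ E_M_subset[OF assms(3)]]) blast
    then show ?thesis by (simp add: mult.commute)
  qed
  then have "gsupport \<Omega> (gclass \<Omega> (\<lambda>\<epsilon> x. u \<epsilon> x * v \<epsilon> x)) \<subseteq> interior (K (Suc n))"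
    using gsupport_subset_iff[OF assms(1) uv K(4)] K(2) by blast
  then show ?thesis
    unfolding gmult_gclass[OF assms(1,3,4)] by (rule gintegral_eq[OF assms(1) uv _ K(1,3)])
qed

lemma ord_set_order_0: "ord_set K {\<alpha>. order_multiindex \<alpha> \<le> 0} u = {b. unif_O K u b}"
proof -
  have "{\<alpha> :: 'a::finite \<Rightarrow> nat. order_multiindex \<alpha> \<le> 0} = {\<lambda>_. 0}"
    by (auto simp: order_multiindex_def fun_eq_iff)
  then show ?thesis by (simp add: ord_set_def multi_deriv_zero)
qed

text \<open>Orders add under multiplication and survive integration over a compact set. The volume
  is a constant factor, which the order does not see, so the product of seminorms appears with
  constant 1.\<close>

lemma gnorm_gintegral_le:
  fixes u v :: "('n::finite) net"
  assumes "open \<Omega>" "exhausting \<Omega> K" "u \<in> E_M \<Omega>" "v \<in> E_M \<Omega>"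
    and "u \<in> N_ideal (\<Omega> - K n) \<or> v \<in> N_ideal (\<Omega> - K n)"
  shows "gnorm (gintegral \<Omega> (gmult \<Omega> (gclass \<Omega> u) (gclass \<Omega> v))) \<le>
    P_\<G> (K (Suc n)) 0 (gclass \<Omega> u) * P_\<G> (K (Suc n)) 0 (gclass \<Omega> v)"
proof -
  note K = exhausting_facts[OF assms(2), of "Suc n"]
  have ne: "{b. unif_O (K (Suc n)) w b} \<noteq> {}" if "w \<in> E_M \<Omega>" for w
    using E_M_values[OF assms(1) that K(1,3)] by blast
  have mod: "moderate (\<lambda>\<epsilon>. LINT y:K (Suc n)|lborel. u \<epsilon> y * v \<epsilon> y)"
    by (rule moderate_integral[OF assms(1) E_M_mult[OF assms(1,3,4)] K(1,3)])
  show ?thesis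
    unfolding gintegral_gmult[OF assms] gnorm_abs[OF mod] P_\<G>_gclass[OF assms(1,3) K(1,3)]
      P_\<G>_gclass[OF assms(1,4) K(1,3)] ord_set_order_0
    by (rule expnorm_mult[OF ne[OF assms(3)] ne[OF assms(4)]])
      (use order_O_integral[OF unif_O_mult K(1)] in blast)
qed


section \<open>Nondegeneracy of the pairing\<close>

text \<open>The factor \<open>CARD('n)\<close> is the crude bound of the operator norm by the sum
  over all coordinates.\<close>

lemma gradient_bound:
  fixes f :: "real^'n \<Rightarrow> complex"
  assumes "open \<Omega>" "smooth_on \<Omega> f" "cball x r \<subseteq> \<Omega>" "y \<in> cball x r"
    and "\<And>i z. z \<in> cball x r \<Longrightarrow> cmod (partial_derivative i f z) \<le> G"
  shows "cmod (f y - f x) \<le> real CARD('n) * G * dist x y"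
proof -
  have "norm (f y - f x) \<le> real CARD('n) * G * norm (y - x)"
  proof (rule differentiable_bound[where S = "cball x r" and
        f' = "\<lambda>z h. \<Sum>i\<in>UNIV. (h $ i) *\<^sub>R partial_derivative i f z"])
    fix z assume z: "z \<in> cball x r"
    show "(f has_derivative (\<lambda>h. \<Sum>i\<in>UNIV. (h $ i) *\<^sub>R partial_derivative i f z)) (at z within cball x r)"
    proof (rule has_derivative_at_withinI[OF has_derivative_partial_derivatives])
      show "f differentiable (at z)"
        using smooth_on_differentiable[OF assms(1,2), of z "[]"] z assms(3) by auto
    qed
    show "onorm (\<lambda>h. \<Sum>i\<in>UNIV. (h $ i) *\<^sub>R partial_derivative i f z) \<le> real CARD('n) * G"
    proof (rule onorm_le)
      fix h :: "real^'n"
      have "cmod (\<Sum>i\<in>UNIV. (h $ i) *\<^sub>R partial_derivative i f z) \<le> (\<Sum>i\<in>(UNIV::'n set). norm h * G)"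
      proof (rule sum_norm_le)
        fix i
        have "\<bar>h $ i\<bar> * cmod (partial_derivative i f z) \<le> norm h * G"
          using component_le_norm_cart[of h i] assms(5)[OF z] by (intro mult_mono) auto
        then show "cmod ((h $ i) *\<^sub>R partial_derivative i f z) \<le> norm h * G" by simp
      qed
      then show "cmod (\<Sum>i\<in>UNIV. (h $ i) *\<^sub>R partial_derivative i f z) \<le> real CARD('n) * G * norm h"
        by (simp add: mult_ac)
    qed
  qed (use assms(4) order_trans[OF zero_le_dist, of x y r] in auto)
  then show ?thesis by (simp add: dist_norm norm_minus_commute)
qed

lemma E_M_inf_smooth_function:
  fixes f :: "real^'n \<Rightarrow> complex"
  assumes "open \<Omega>" "smooth_on \<Omega> f"
  shows "(\<lambda>_. f) \<in> E_M_inf \<Omega>"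
  unfolding E_M_inf_iff[OF assms(1)]
proof (intro conjI allI impI exI[of _ "0::nat"])
  show "(\<lambda>_. f) \<in> smooth_nets \<Omega>" using assms(2) by (simp add: smooth_nets_def)
  fix K and "is" :: "'n list" assume K: "compact K \<and> K \<subseteq> \<Omega>"
  have "continuous_on K (foldr partial_derivative is f)"
    using smooth_on_continuous_on[OF assms(2)] K continuous_on_subset by blast
  then have "bounded (foldr partial_derivative is f ` K)"
    using K by (intro compact_imp_bounded compact_continuous_image) auto
  then obtain c where c: "\<And>x. x \<in> K \<Longrightarrow> cmod (foldr partial_derivative is f x) \<le> c"
    by (auto simp: bounded_iff)
  have "\<forall>\<^sub>F \<epsilon> in at_right 0. \<forall>x\<in>K. cmod (foldr partial_derivative is f x) \<le> c * \<epsilon> powr (- real 0)"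
    using eventually_unit_interval by eventually_elim (use c in auto)
  then show "unif_O K (\<lambda>_. foldr partial_derivative is f) (- real 0)" by (rule unif_OI)
qed

lemma E_M_cnj:
  assumes "open \<Omega>" "u \<in> E_M \<Omega>"
  shows "(\<lambda>\<epsilon> x. cnj (u \<epsilon> x)) \<in> E_M \<Omega>"
  unfolding E_M_iff[OF assms(1)]
proof (intro conjI allI impI)
  note s = E_M_smooth[OF assms(2)]
  show "(\<lambda>\<epsilon> x. cnj (u \<epsilon> x)) \<in> smooth_nets \<Omega>"
    using s smooth_on_linear[OF assms(1) bounded_linear_cnj] by (auto simp: smooth_nets_def)
  fix K and "is" :: "'a list" assume K: "compact K \<and> K \<subseteq> \<Omega>"
  then obtain N :: nat where N: "unif_O K (\<lambda>\<epsilon>. foldr partial_derivative is (u \<epsilon>)) (- real N)"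
    using assms(2) unfolding E_M_iff[OF assms(1)] by meson
  then have "unif_O K (\<lambda>\<epsilon> x. cnj (foldr partial_derivative is (u \<epsilon>) x)) (- real N)"
    by (simp add: unif_O_def)
  then have "unif_O K (\<lambda>\<epsilon>. foldr partial_derivative is (\<lambda>x. cnj (u \<epsilon> x))) (- real N)"
  proof (rule unif_O_cong)
    fix \<epsilon> :: real and x assume "\<epsilon> \<in> {0<..1}" "x \<in> K"
    then show "cnj (foldr partial_derivative is (u \<epsilon>) x) = foldr partial_derivative is (\<lambda>x. cnj (u \<epsilon> x)) x"
      using K by (intro foldr_partial_derivative_linear[OF assms(1) bounded_linear_cnj, symmetric]
          smooth_netsD[OF s]) auto
  qed
  then show "\<exists>N::nat. unif_O K (\<lambda>\<epsilon>. foldr partial_derivative is (\<lambda>x. cnj (u \<epsilon> x))) (- real N)" by blast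
qed

lemma N_ideal_vanishing:
  assumes "open V" "\<And>\<epsilon> x. \<epsilon> \<in> {0<..1} \<Longrightarrow> x \<in> V \<Longrightarrow> u \<epsilon> x = 0"
  shows "u \<in> N_ideal V"
  unfolding N_ideal_iff[OF assms(1)]
proof (intro conjI allI impI)
  show "u \<in> smooth_nets V"
    unfolding smooth_nets_def
  proof safe
    fix \<epsilon> :: real assume "\<epsilon> \<in> {0<..1}"
    then show "smooth_on V (u \<epsilon>)"
      using smooth_on_cong[OF assms(1) _ smooth_on_const[of V 0], of "u \<epsilon>"] assms(2) by simp
  qed
  fix K and "is" :: "'a list" and q :: nat assume K: "compact K \<and> K \<subseteq> V"
  show "unif_O K (\<lambda>\<epsilon>. foldr partial_derivative is (u \<epsilon>)) (real q)"
  proof (rule unif_O_cong[OF unif_O_zero])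
    fix \<epsilon> :: real and x assume x: "\<epsilon> \<in> {0<..1}" "x \<in> K"
    have "foldr partial_derivative is (\<lambda>_. 0) x = foldr partial_derivative is (u \<epsilon>) x"
      by (rule foldr_partial_derivative_cong[OF assms(1)]) (use x K assms(2) in auto)
    then show "0 = foldr partial_derivative is (u \<epsilon>) x" by (simp add: foldr_partial_derivative_const)
  qed
qed

text \<open>The integrand is \<open>\<kappa>\<close> times the squared modulus of \<open>f\<close>,
  hence nonnegative, and may be cut down to the ball, where the cutoff is 1.\<close>

lemma integral_square_lower_bound:
  fixes f :: "real^'n \<Rightarrow> complex" and \<kappa> :: "real^'n \<Rightarrow> real"
  assumes "continuous_on K f" "continuous_on K \<kappa>" "compact K" "ball x \<rho> \<subseteq> K" "0 < \<rho>" "0 \<le> m"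
    and \<kappa>: "\<And>y. 0 \<le> \<kappa> y" "\<And>y. y \<in> ball x \<rho> \<Longrightarrow> \<kappa> y = 1"
    and m: "\<And>y. y \<in> ball x \<rho> \<Longrightarrow> m \<le> cmod (f y)"
  shows "m\<^sup>2 * (\<rho> ^ CARD('n) * measure lborel (ball (0::real^'n) 1)) \<le>
    cmod (LINT y:K|lborel. f y * (complex_of_real (\<kappa> y) * cnj (f y)))"
proof -
  define g where "g y = \<kappa> y * (cmod (f y))\<^sup>2" for y
  have g: "f y * (complex_of_real (\<kappa> y) * cnj (f y)) = complex_of_real (g y)" for y
    unfolding g_def of_real_mult complex_norm_square by simp
  have int: "integrable lborel (\<lambda>y. indicator K y *\<^sub>R g y)"
    unfolding g_def by (intro borel_integrable_compact assms(3) continuous_intros assms(1,2))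
  have ball: "emeasure lborel (ball x \<rho>) < \<infinity>" by (intro emeasure_bounded_finite) simp
  have "m\<^sup>2 * measure lborel (ball x \<rho>) = (\<integral>y. indicator (ball x \<rho>) y * m\<^sup>2 \<partial>lborel)" by simp
  also have "\<dots> \<le> (\<integral>y. indicator K y *\<^sub>R g y \<partial>lborel)"
  proof (rule integral_mono[OF _ int])
    show "integrable lborel (\<lambda>y. indicator (ball x \<rho>) y * m\<^sup>2)"
      using ball by (intro integrable_mult_left integrable_real_indicator) auto
    fix y
    show "indicator (ball x \<rho>) y * m\<^sup>2 \<le> indicator K y *\<^sub>R g y"
      using assms(4,6) \<kappa> m[of y] by (auto simp: indicator_def g_def intro: power_mono)
  qed
  finally have le: "m\<^sup>2 * measure lborel (ball x \<rho>) \<le> (\<integral>y. indicator K y *\<^sub>R g y \<partial>lborel)" .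
  have "(LINT y:K|lborel. f y * (complex_of_real (\<kappa> y) * cnj (f y))) = (\<integral>y. complex_of_real (indicator K y *\<^sub>R g y) \<partial>lborel)"
    unfolding set_lebesgue_integral_def g by (simp add: scaleR_conv_of_real)
  also have "\<dots> = complex_of_real (\<integral>y. indicator K y *\<^sub>R g y \<partial>lborel)" by (rule integral_complex_of_real)
  finally have "(\<integral>y. indicator K y *\<^sub>R g y \<partial>lborel) \<le> cmod (LINT y:K|lborel. f y * (complex_of_real (\<kappa> y) * cnj (f y)))"
    by simp
  then show ?thesis
    using le content_ball_conv_unit_ball[of \<rho> x] assms(5) by simp
qed

text \<open>The test net depends on the compact set \<open>C\<close> through the cutoff, which is 1
  on the neighbourhood \<open>L\<close> of \<open>C\<close> that contains the small balls on which
  the integral is bounded from below.\<close>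

lemma pairing_nondegenerate:
  fixes u :: "('n::finite) net"
  assumes "open \<Omega>" "exhausting \<Omega> K" "u \<in> E_M \<Omega>"
    and zero: "\<And>v n. v \<in> E_M \<Omega> \<Longrightarrow> v \<in> N_ideal (\<Omega> - K n) \<Longrightarrow>
      gintegral \<Omega> (gmult \<Omega> (gclass \<Omega> u) (gclass \<Omega> v)) = 0"
  shows "u \<in> N_ideal \<Omega>"
proof (rule N_ideal_if_values_negligible[OF assms(1,3)])
  fix C and q :: nat assume C: "compact C" "C \<subseteq> \<Omega>"
  note Kf = exhausting_facts[OF assms(2)]
  obtain \<delta> L where L: "0 < \<delta>" "compact L" "L \<subseteq> \<Omega>" "\<And>x. x \<in> C \<Longrightarrow> cball x \<delta> \<subseteq> L"
    using compact_neighbourhood[OF C(1) assms(1) C(2)] by metis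
  obtain \<kappa> :: "real^'n \<Rightarrow> real" and W D where \<kappa>: "smooth_on UNIV (\<lambda>x. complex_of_real (\<kappa> x))"
    "\<And>x. 0 \<le> \<kappa> x" "open W" "L \<subseteq> W" "W \<subseteq> D" "compact D" "D \<subseteq> \<Omega>"
    "\<And>x. x \<in> W \<Longrightarrow> \<kappa> x = 1" "\<And>x. x \<notin> D \<Longrightarrow> \<kappa> x = 0"
    by (rule ex_smooth_cutoff[OF L(2) assms(1) L(3)]) (rule that; assumption)
  obtain n where n: "D \<subseteq> K n" using exhausting_absorbs[OF assms(2) \<kappa>(6,7)] by blast
  then have LK: "L \<subseteq> K (Suc n)" using \<kappa>(4,5) exhausting_mono[OF assms(2), of n "Suc n"] by auto
  define v where "v \<epsilon> x = complex_of_real (\<kappa> x) * cnj (u \<epsilon> x)" for \<epsilon> x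
  have v: "v \<in> E_M \<Omega>"
    using E_M_mult[OF assms(1) subsetD[OF E_M_inf_imp_E_M E_M_inf_smooth_function[OF assms(1)
            smooth_on_subset[OF \<kappa>(1) subset_UNIV]]] E_M_cnj[OF assms(1,3)]]
    by (simp add: v_def[abs_def])
  have "v \<in> N_ideal (\<Omega> - K n)"
    by (rule N_ideal_vanishing) (use assms(1) Kf(4) n \<kappa>(9) in \<open>auto simp: v_def intro!: \<kappa>(9)\<close>)
  from gintegral_gmult[OF assms(1,2,3) v disjI2[OF this]] zero[OF v this]
  have I0: "abs_gcomplex (\<lambda>\<epsilon>. LINT y:K (Suc n)|lborel. u \<epsilon> y * v \<epsilon> y) = 0" by simp
  define I where "I \<epsilon> = (LINT y:K (Suc n)|lborel. u \<epsilon> y * v \<epsilon> y)" for \<epsilon>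
  have "moderate I"
    unfolding I_def by (rule moderate_integral[OF assms(1) E_M_mult[OF assms(1,3) v] Kf(1,3)])
  moreover have "abs_gcomplex I = abs_gcomplex (\<lambda>_. 0)"
    using I0 by (simp add: I_def[abs_def] zero_gcomplex_def)
  ultimately have "negligible I"
    using abs_gcomplex_eq_iff[of I "\<lambda>_. 0"] by (simp add: moderate_const)
  define d where "d = CARD('n)"
  obtain N :: nat where N: "\<And>is. length is \<le> 1 \<Longrightarrow> unif_O L (\<lambda>\<epsilon>. foldr partial_derivative is (u \<epsilon>)) (- real N)"
    using E_M_uniform[OF assms(1,3) L(2,3)] by metis
  \<comment> \<open>Pairs of a direction and a point provide one constant \<open>c\<close> for all
    directions.\<close>
  have "unif_O (\<Union>i\<in>UNIV. {i} \<times> L) (\<lambda>\<epsilon> (i, x). partial_derivative i (u \<epsilon>) x) (- real N)"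
  proof (rule unif_O_UN)
    fix i :: 'n
    show "unif_O ({i} \<times> L) (\<lambda>\<epsilon> (i, x). partial_derivative i (u \<epsilon>) x) (- real N)"
      using N[of "[i]"] by (simp add: unif_O_def)
  qed simp
  then obtain c where c: "c > 0" "\<forall>\<^sub>F \<epsilon> in at_right 0. \<epsilon> \<in> {0<..1} \<and>
      (\<forall>z\<in>(\<Union>i\<in>UNIV. {i} \<times> L). cmod (case z of (i, x) \<Rightarrow> partial_derivative i (u \<epsilon>) x) \<le> c * \<epsilon> powr (- real N))"
    by (rule unif_OE)
  \<comment> \<open>On a ball of radius \<open>k * \<epsilon> ^ s\<close> the gradient bound allows
    an oscillation of \<open>d * c * k * \<epsilon> ^ (q + 1)\<close>. The constant \<open>k\<close>
    makes this at most half of \<open>\<epsilon> ^ q\<close>, so a value above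
    \<open>\<epsilon> ^ q\<close> stays above half of it on the ball.\<close>
  define s where "s = q + N + 1"
  define k where "k = 1 / (2 * (real d * c + 1))"
  have k: "0 < k" "real d * c * k \<le> 1 / 2"
    using c(1) by (simp_all add: k_def field_simps add_pos_nonneg)
  \<comment> \<open>The square of \<open>\<epsilon> ^ q / 2\<close> times the volume of the ball is
    \<open>k1 * \<epsilon> ^ p\<close> with the exponent \<open>p\<close> below; the quarter is the
    squared half.\<close>
  define k1 where "k1 = k ^ d * measure lborel (ball (0::real^'n) 1) / 4"
  have k1: "0 < k1" using k(1) content_ball_pos[of 1 "0::real^'n"] by (simp add: k1_def)
  define p where "p = 2 * q + s * d"
  \<comment> \<open>One order more than the lower bound \<open>k1 * \<epsilon> ^ p\<close>, which
    gives the contradiction as soon as \<open>\<epsilon> < k1 / c2\<close>.\<close>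
  have "order_O (\<lambda>\<epsilon>. cmod (I \<epsilon>)) (real (p + 1))"
    using \<open>negligible I\<close> unfolding negligible_def by blast
  then obtain c2 where c2: "c2 > 0" "\<forall>\<^sub>F \<epsilon> in at_right 0. norm (cmod (I \<epsilon>)) \<le> c2 * norm (\<epsilon> powr real (p + 1))"
    by (elim landau_o.bigE)
  have "\<forall>\<^sub>F \<epsilon>::real in at_right 0. \<epsilon> powr real s \<le> \<delta> / k"
    by (rule eventually_powr_le) (use L(1) k(1) in \<open>simp_all add: s_def\<close>)
  moreover have "\<forall>\<^sub>F \<epsilon>::real in at_right 0. \<epsilon> \<in> {0<..<k1 / c2}"
    by (rule eventually_at_right_real) (use k1 c2 in simp)
  ultimately have "\<forall>\<^sub>F \<epsilon> in at_right 0. \<forall>x\<in>C. cmod (u \<epsilon> x) \<le> 1 * \<epsilon> powr real q"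
    using c(2) c2(2)
  proof eventually_elim
    case (elim \<epsilon>)
    then have \<epsilon>: "0 < \<epsilon>" "\<epsilon> \<le> 1" "\<epsilon> \<in> {0<..1}" "\<epsilon> < k1 / c2" by auto
    have pw: "\<epsilon> powr real a = \<epsilon> ^ a" for a using \<epsilon> by (simp add: powr_realpow)
    define \<rho> where "\<rho> = k * \<epsilon> ^ s"
    have \<rho>: "0 < \<rho>" "\<rho> \<le> \<delta>" using elim(1) k(1) \<epsilon>(1) by (simp_all add: \<rho>_def pw field_simps)
    show ?case
    proof (intro ballI, rule ccontr)
      fix x assume x: "x \<in> C" and "\<not> cmod (u \<epsilon> x) \<le> 1 * \<epsilon> powr real q"
      then have big: "\<epsilon> ^ q < cmod (u \<epsilon> x)" by (simp add: pw)
      have ball: "cball x \<rho> \<subseteq> L" using L(4)[OF x] \<rho>(2) by (meson order_trans subset_cball)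
      have sm: "smooth_on \<Omega> (u \<epsilon>)" by (rule smooth_netsD[OF E_M_smooth[OF assms(3)] \<epsilon>(3)])
      have low: "\<epsilon> ^ q / 2 \<le> cmod (u \<epsilon> y)" if y: "y \<in> ball x \<rho>" for y
      proof -
        have "cmod (u \<epsilon> y - u \<epsilon> x) \<le> real CARD('n) * (c * \<epsilon> powr (- real N)) * dist x y"
        proof (rule gradient_bound[OF assms(1) sm, of x \<rho>])
          fix i z assume "z \<in> cball x \<rho>"
          then show "cmod (partial_derivative i (u \<epsilon>) z) \<le> c * \<epsilon> powr (- real N)"
            using elim ball by auto
        qed (use ball L(3) y in auto)
        also have "\<dots> \<le> real d * (c * \<epsilon> powr (- real N)) * \<rho>"
          unfolding d_def using y c(1) by (intro mult_left_mono) auto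
        also have "\<dots> = (real d * c * k) * (\<epsilon> powr (- real N) * \<epsilon> ^ s)" by (simp add: \<rho>_def)
        also have "\<epsilon> powr (- real N) * \<epsilon> ^ s = \<epsilon> ^ (q + 1)"
          using \<epsilon>(1) by (simp add: s_def powr_minus pw power_add)
        also have "(real d * c * k) * \<epsilon> ^ (q + 1) \<le> (1 / 2) * \<epsilon> ^ q"
          using k(2) \<epsilon> power_decreasing[of q "q + 1" \<epsilon>] by (intro mult_mono) auto
        finally have "cmod (u \<epsilon> y - u \<epsilon> x) \<le> (1 / 2) * \<epsilon> ^ q" .
        moreover have "cmod (u \<epsilon> x) \<le> cmod (u \<epsilon> y) + cmod (u \<epsilon> y - u \<epsilon> x)"
          using norm_triangle_sub[of "u \<epsilon> x" "u \<epsilon> y"] by (simp add: norm_minus_commute)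
        ultimately show ?thesis using big by simp
      qed
      have cont: "continuous_on (K (Suc n)) (u \<epsilon>)"
        using continuous_on_subset[OF smooth_on_continuous_on[OF sm, of "[]"] Kf(3)] by simp
      have "continuous_on UNIV (\<lambda>x. complex_of_real (\<kappa> x))"
        using smooth_on_continuous_on[OF \<kappa>(1), of "[]"] by simp
      from continuous_on_Re[OF this] have cont\<kappa>: "continuous_on (K (Suc n)) \<kappa>"
        using continuous_on_subset by fastforce
      have "(\<epsilon> ^ q / 2)\<^sup>2 * (\<rho> ^ CARD('n) * measure lborel (ball (0::real^'n) 1)) \<le> cmod (I \<epsilon>)"
        unfolding I_def v_def
      proof (rule integral_square_lower_bound[OF cont cont\<kappa> Kf(1) _ \<rho>(1) _ \<kappa>(2) _ low])
        show "ball x \<rho> \<subseteq> K (Suc n)" using ball LK ball_subset_cball by blast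
        show "\<kappa> y = 1" if "y \<in> ball x \<rho>" for y
          using \<kappa>(4,8) ball ball_subset_cball that by blast
      qed (use \<epsilon> in auto)
      moreover have "(\<epsilon> ^ q / 2)\<^sup>2 * (\<rho> ^ CARD('n) * measure lborel (ball (0::real^'n) 1)) = k1 * \<epsilon> ^ p"
        by (simp add: \<rho>_def k1_def p_def d_def[symmetric] power_mult_distrib power_divide power_add
            power_mult[symmetric] mult.commute[of q 2])
      moreover have "cmod (I \<epsilon>) \<le> c2 * (\<epsilon> * \<epsilon> ^ p)"
        using elim(4) \<epsilon>(1) by (simp only: pw) simp
      ultimately have "k1 * \<epsilon> ^ p \<le> (c2 * \<epsilon>) * \<epsilon> ^ p" by simp
      then have "k1 \<le> c2 * \<epsilon>" using \<epsilon>(1) by (simp add: mult_le_cancel_right)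
      then show False using \<epsilon>(4) c2(1) by (simp add: field_simps)
    qed
  qed
  then show "unif_O C u (real q)" by (rule unif_OI)
qed


section \<open>Compactly supported and regular elements\<close>

text \<open>The submodules below all consist of classes of nets from a set closed under the
  operations, so closure is checked on nets and representatives are dealt with once.\<close>

lemma lc_submodule_classes:
  fixes N :: "('n::finite) gfun lc_module"
  assumes "open \<Omega>" "\<zero>\<^bsub>N\<^esub> = \<zero>\<^bsub>\<G> \<Omega>\<^esub>" "\<And>u v. u \<oplus>\<^bsub>N\<^esub> v = u \<oplus>\<^bsub>\<G> \<Omega>\<^esub> v" "\<And>z u. z \<odot>\<^bsub>N\<^esub> u = z \<odot>\<^bsub>\<G> \<Omega>\<^esub> u"
    and E: "carrier N = gclass \<Omega> ` E" "E \<subseteq> E_M \<Omega>" "(\<lambda>_ _. 0) \<in> E"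
    "\<And>u v. u \<in> E \<Longrightarrow> v \<in> E \<Longrightarrow> (\<lambda>\<epsilon> x. u \<epsilon> x + v \<epsilon> x) \<in> E"
    "\<And>u z. u \<in> E \<Longrightarrow> moderate z \<Longrightarrow> (\<lambda>\<epsilon> x. z \<epsilon> * u \<epsilon> x) \<in> E"
  shows "lc_submodule N (\<G> \<Omega>)"
proof (rule lc_submoduleI[OF gc_module_\<G>[OF assms(1)] _ assms(2-4)])
  note sub = subsetD[OF E(2)]
  show "carrier N \<subseteq> carrier (\<G> \<Omega>)" using E(1,2) by (auto simp: carrier_\<G>)
  show "\<zero>\<^bsub>\<G> \<Omega>\<^esub> \<in> carrier N" using E(1,3) by (simp add: zero_\<G>)
  fix U assume "U \<in> carrier N"
  then obtain u where u: "u \<in> E" "U = gclass \<Omega> u" using E(1) by auto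
  show "z \<odot>\<^bsub>\<G> \<Omega>\<^esub> U \<in> carrier N" for z
  proof -
    obtain z' where "moderate z'" "z = abs_gcomplex z'" by (rule gcomplexE)
    then show ?thesis using E(1) E(5)[OF u(1)] smult_gclass[OF assms(1) sub[OF u(1)]] by (simp add: u(2))
  qed
  fix V assume "V \<in> carrier N"
  then obtain v where v: "v \<in> E" "V = gclass \<Omega> v" using E(1) by auto
  show "U \<oplus>\<^bsub>\<G> \<Omega>\<^esub> V \<in> carrier N"
    using E(1) E(4)[OF u(1) v(1)] add_gclass[OF assms(1) sub[OF u(1)] sub[OF v(1)]] by (simp add: u(2) v(2))
qed

lemma lc_submodule_between:
  "lc_submodule N M \<Longrightarrow> lc_submodule L M \<Longrightarrow> carrier L \<subseteq> carrier N \<Longrightarrow> lc_submodule L N"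
  by (simp add: lc_submodule_def)

lemma lc_submodule_refl: "gc_module M \<Longrightarrow> lc_submodule M M"
  by (simp add: lc_submodule_def)

text \<open>Compact support expressed by the exhausting sequence; for moderate nets it agrees with
  compactness of the support by \<open>compact_gsupport_iff\<close>.\<close>

definition supported :: "(real^'n) set \<Rightarrow> (nat \<Rightarrow> (real^'n) set) \<Rightarrow> 'n net set" where
  "supported \<Omega> K = {u. \<exists>n. u \<in> N_ideal (\<Omega> - K n)}"

lemma N_ideal_step_mono:
  assumes "exhausting \<Omega> K" "u \<in> N_ideal (\<Omega> - K m)" "m \<le> n"
  shows "u \<in> N_ideal (\<Omega> - K n)"
  by (rule N_ideal_subset[OF assms(2)]) (use exhausting_mono[OF assms(1,3)] in blast)

lemma supported_common:
  assumes "exhausting \<Omega> K" "u \<in> supported \<Omega> K" "v \<in> supported \<Omega> K"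
  obtains n where "u \<in> N_ideal (\<Omega> - K n)" "v \<in> N_ideal (\<Omega> - K n)"
proof -
  obtain m k where "u \<in> N_ideal (\<Omega> - K m)" "v \<in> N_ideal (\<Omega> - K k)"
    using assms(2,3) by (auto simp: supported_def)
  then show thesis
    using that[of "max m k"] N_ideal_step_mono[OF assms(1), of u m "max m k"]
      N_ideal_step_mono[OF assms(1), of v k "max m k"] by simp
qed

locale exhausted_open =
  fixes \<Omega> :: "(real^'n) set" and K :: "nat \<Rightarrow> (real^'n) set"
  assumes op: "open \<Omega>" and exh: "exhausting \<Omega> K"
begin

text \<open>Enlarged by \<open>K (Suc n)\<close>, any compact set becomes a neighbourhood of
  \<open>K n\<close>, as the seminorms of the step require.\<close>

lemma step_neighbourhood:
  assumes "compact L" "L \<subseteq> \<Omega>"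
  shows "compact (L \<union> K (Suc n))" "L \<union> K (Suc n) \<subseteq> \<Omega>" "K n \<subseteq> interior (L \<union> K (Suc n))"
  using assms exhausting_facts[OF exh] interior_mono[of "K (Suc n)" "L \<union> K (Suc n)"]
  by (blast intro: compact_Un)+

lemma open_diff_step: "open (\<Omega> - K n)"
  using op exhausting_facts(4)[OF exh] by auto

lemma step_ideal:
  "(\<lambda>_ _. 0) \<in> N_ideal (\<Omega> - K n)"
  "u \<in> N_ideal (\<Omega> - K n) \<Longrightarrow> v \<in> N_ideal (\<Omega> - K n) \<Longrightarrow> (\<lambda>\<epsilon> x. u \<epsilon> x + v \<epsilon> x) \<in> N_ideal (\<Omega> - K n)"
  "u \<in> N_ideal (\<Omega> - K n) \<Longrightarrow> moderate z \<Longrightarrow> (\<lambda>\<epsilon> x. z \<epsilon> * u \<epsilon> x) \<in> N_ideal (\<Omega> - K n)"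
  using N_ideal_const[OF open_diff_step negligible_zero] N_ideal_add[OF open_diff_step]
    N_ideal_smult[OF open_diff_step] by auto

lemma supported_closed:
  "(\<lambda>_ _. 0) \<in> supported \<Omega> K"
  "u \<in> supported \<Omega> K \<Longrightarrow> v \<in> supported \<Omega> K \<Longrightarrow> (\<lambda>\<epsilon> x. u \<epsilon> x + v \<epsilon> x) \<in> supported \<Omega> K"
  "u \<in> supported \<Omega> K \<Longrightarrow> moderate z \<Longrightarrow> (\<lambda>\<epsilon> x. z \<epsilon> * u \<epsilon> x) \<in> supported \<Omega> K"
proof -
  show "(\<lambda>_ _. 0) \<in> supported \<Omega> K" using step_ideal(1) by (auto simp: supported_def)
  show "(\<lambda>\<epsilon> x. u \<epsilon> x + v \<epsilon> x) \<in> supported \<Omega> K" if "u \<in> supported \<Omega> K" "v \<in> supported \<Omega> K"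
    by (rule supported_common[OF exh that]) (use step_ideal(2) in \<open>auto simp: supported_def\<close>)
  show "(\<lambda>\<epsilon> x. z \<epsilon> * u \<epsilon> x) \<in> supported \<Omega> K" if "u \<in> supported \<Omega> K" "moderate z"
    using that step_ideal(3) by (auto simp: supported_def)
qed

lemma zero_E_M: "(\<lambda>_ _. 0) \<in> E_M \<Omega>" "(\<lambda>_ _. 0) \<in> E_M_inf \<Omega>"
  using E_M_const[OF op moderate_const] E_M_inf_const[OF op moderate_const] by auto

lemma gclass_Collect:
  assumes "E \<subseteq> E_M \<Omega>" "\<And>u. u \<in> E_M \<Omega> \<Longrightarrow> Q (gclass \<Omega> u) \<longleftrightarrow> u \<in> S"
  shows "{U \<in> gclass \<Omega> ` E. Q U} = gclass \<Omega> ` (E \<inter> S)"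
  using assms by blast

lemma carrier_\<G>_c: "carrier (\<G>_c \<Omega> K) = gclass \<Omega> ` (E_M \<Omega> \<inter> supported \<Omega> K)"
  unfolding \<G>_c_def Let_def using gclass_Collect[OF order_refl, of "\<lambda>U. compact (gsupport \<Omega> U)" "supported \<Omega> K"]
    compact_gsupport_iff[OF op exh] by (simp add: carrier_\<G> supported_def)

lemma carrier_\<G>_inf: "carrier (\<G>_inf \<Omega>) = gclass \<Omega> ` E_M_inf \<Omega>"
  by (simp add: \<G>_inf_def)

lemma carrier_\<G>_inf_c: "carrier (\<G>_inf_c \<Omega> K) = gclass \<Omega> ` (E_M_inf \<Omega> \<inter> supported \<Omega> K)"
  unfolding \<G>_inf_c_def Let_def
  using gclass_Collect[OF E_M_inf_imp_E_M, of "\<lambda>U. compact (gsupport \<Omega> U)" "supported \<Omega> K"]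
    compact_gsupport_iff[OF op exh] by (simp add: carrier_\<G>_inf supported_def)

lemma carrier_\<G>_on: "carrier (\<G>_on \<Omega> (K n)) = gclass \<Omega> ` (E_M \<Omega> \<inter> N_ideal (\<Omega> - K n))"
  unfolding \<G>_on_def
  using gclass_Collect[OF order_refl, of "\<lambda>U. gsupport \<Omega> U \<subseteq> K n" "N_ideal (\<Omega> - K n)"]
    gsupport_subset_iff[OF op _ exhausting_facts(4)[OF exh]] by (simp add: carrier_\<G>)

lemma carrier_\<G>_inf_on: "carrier (\<G>_inf_on \<Omega> (K n)) = gclass \<Omega> ` (E_M_inf \<Omega> \<inter> N_ideal (\<Omega> - K n))"
  unfolding \<G>_inf_on_def
  using gclass_Collect[OF E_M_inf_imp_E_M, of "\<lambda>U. gsupport \<Omega> U \<subseteq> K n" "N_ideal (\<Omega> - K n)"]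
    gsupport_subset_iff[OF op _ exhausting_facts(4)[OF exh]] by (simp add: carrier_\<G>_inf)

lemma lc_submodule_\<G>_c: "lc_submodule (\<G>_c \<Omega> K) (\<G> \<Omega>)"
  by (rule lc_submodule_classes[OF op _ _ _ carrier_\<G>_c])
    (auto simp: \<G>_c_def Let_def zero_E_M supported_closed E_M_add[OF op] E_M_smult[OF op])

lemma lc_submodule_\<G>_inf: "lc_submodule (\<G>_inf \<Omega>) (\<G> \<Omega>)"
  by (rule lc_submodule_classes[OF op _ _ _ carrier_\<G>_inf])
    (use E_M_inf_imp_E_M in \<open>auto simp: \<G>_inf_def zero_E_M E_M_inf_add[OF op] E_M_inf_smult[OF op]\<close>)

lemma lc_submodule_\<G>_inf_c: "lc_submodule (\<G>_inf_c \<Omega> K) (\<G> \<Omega>)"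
  by (rule lc_submodule_classes[OF op _ _ _ carrier_\<G>_inf_c])
    (use E_M_inf_imp_E_M in \<open>auto simp: \<G>_inf_c_def Let_def \<G>_inf_def zero_E_M supported_closed E_M_inf_add[OF op] E_M_inf_smult[OF op]\<close>)

lemma lc_submodule_\<G>_on: "lc_submodule (\<G>_on \<Omega> (K n)) (\<G> \<Omega>)"
  by (rule lc_submodule_classes[OF op _ _ _ carrier_\<G>_on])
    (auto simp: \<G>_on_def zero_E_M step_ideal E_M_add[OF op] E_M_smult[OF op])

lemma lc_submodule_\<G>_inf_on: "lc_submodule (\<G>_inf_on \<Omega> (K n)) (\<G> \<Omega>)"
  by (rule lc_submodule_classes[OF op _ _ _ carrier_\<G>_inf_on])
    (use E_M_inf_imp_E_M in \<open>auto simp: \<G>_inf_on_def \<G>_inf_def zero_E_M step_ideal E_M_inf_add[OF op] E_M_inf_smult[OF op]\<close>)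

lemma lc_submodule_\<G>_inf_c_\<G>_inf: "lc_submodule (\<G>_inf_c \<Omega> K) (\<G>_inf \<Omega>)"
  by (rule lc_submodule_between[OF lc_submodule_\<G>_inf lc_submodule_\<G>_inf_c])
    (auto simp: carrier_\<G>_inf carrier_\<G>_inf_c)

lemma lc_submodule_\<G>_on_\<G>_c: "lc_submodule (\<G>_on \<Omega> (K n)) (\<G>_c \<Omega> K)"
  by (rule lc_submodule_between[OF lc_submodule_\<G>_c lc_submodule_\<G>_on])
    (auto simp: carrier_\<G>_on carrier_\<G>_c supported_def)

lemma lc_submodule_\<G>_inf_on_\<G>_inf_c: "lc_submodule (\<G>_inf_on \<Omega> (K n)) (\<G>_inf_c \<Omega> K)"
  by (rule lc_submodule_between[OF lc_submodule_\<G>_inf_c lc_submodule_\<G>_inf_on])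
    (auto simp: carrier_\<G>_inf_on carrier_\<G>_inf_c supported_def)

section \<open>Seminorms of the modules, their steps and the inductive limits\<close>

lemma ups_P_\<G>:
  assumes "lc_submodule N (\<G> \<Omega>)" "compact L" "L \<subseteq> \<Omega>"
  shows "ultra_pseudo_seminorm N (P_\<G> L j)"
  by (rule ups_expnorm[OF op assms P_\<G>_gclass[OF op _ assms(2,3)] ord_set_nonempty[OF op _ assms(2,3) finite_order_multiindex]])

text \<open>Regularity passes to all representatives because negligible nets are regular.\<close>

lemma E_M_inf_of_gclass:
  assumes "u \<in> E_M \<Omega>" "gclass \<Omega> u \<in> gclass \<Omega> ` E_M_inf \<Omega>"
  shows "u \<in> E_M_inf \<Omega>"
proof -
  obtain w where w: "w \<in> E_M_inf \<Omega>" "gclass \<Omega> u = gclass \<Omega> w" using assms(2) by auto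
  have "(\<lambda>\<epsilon> x. u \<epsilon> x - w \<epsilon> x) \<in> N_ideal \<Omega>"
    using gclass_eqD[OF op _ w(2)] w(1) E_M_inf_imp_E_M by blast
  then have "(\<lambda>\<epsilon> x. u \<epsilon> x - w \<epsilon> x) \<in> E_M_inf \<Omega>" using N_ideal_imp_E_M_inf by blast
  from E_M_inf_add[OF op this w(1)] show ?thesis by simp
qed

lemma ups_P_\<G>_inf:
  assumes "lc_submodule N (\<G> \<Omega>)" "carrier N \<subseteq> gclass \<Omega> ` E_M_inf \<Omega>" "compact L" "L \<subseteq> \<Omega>"
  shows "ultra_pseudo_seminorm N (P_\<G>_inf L)"
proof (rule ups_expnorm[OF op assms(1,3,4) P_\<G>_inf_gclass[OF op _ assms(3,4)]])
  fix u assume "u \<in> E_M \<Omega>" "gclass \<Omega> u \<in> carrier N"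
  then have "u \<in> E_M_inf \<Omega>" using E_M_inf_of_gclass assms(2) by blast
  then show "ord_set L UNIV u \<noteq> {}" by (rule ord_set_nonempty_inf[OF op _ assms(3,4)])
qed

lemma P_\<G>_mono:
  assumes "u \<in> E_M \<Omega>" "compact L'" "L' \<subseteq> \<Omega>" "compact L" "L \<subseteq> L'" "j \<le> j'"
  shows "P_\<G> L j (gclass \<Omega> u) \<le> P_\<G> L' j' (gclass \<Omega> u)"
proof -
  have "L \<subseteq> \<Omega>" using assms by blast
  then show ?thesis
    unfolding P_\<G>_gclass[OF op assms(1,2,3)] P_\<G>_gclass[OF op assms(1,4) \<open>L \<subseteq> \<Omega>\<close>]
    by (intro expnorm_antimono ord_set_mono ord_set_nonempty[OF op assms(1-3) finite_order_multiindex])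
      (use assms in auto)
qed

lemma P_\<G>_inf_mono:
  assumes "u \<in> E_M_inf \<Omega>" "compact L'" "L' \<subseteq> \<Omega>" "compact L" "L \<subseteq> L'"
  shows "P_\<G>_inf L (gclass \<Omega> u) \<le> P_\<G>_inf L' (gclass \<Omega> u)"
proof -
  have L: "L \<subseteq> \<Omega>" using assms by blast
  have u: "u \<in> E_M \<Omega>" using assms(1) E_M_inf_imp_E_M by blast
  show ?thesis
    unfolding P_\<G>_inf_gclass[OF op u assms(2,3)] P_\<G>_inf_gclass[OF op u assms(4) L]
    by (intro expnorm_antimono ord_set_mono ord_set_nonempty_inf[OF op assms(1-3)]) (use assms in auto)
qed

lemma seminorms_\<G>_on:
  "seminorms (\<G>_on \<Omega> (K n)) = {P_\<G> L j | L j. compact L \<and> L \<subseteq> \<Omega> \<and> K n \<subseteq> interior L}"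
  by (simp add: \<G>_on_def)

lemma seminorms_\<G>_inf_on:
  "seminorms (\<G>_inf_on \<Omega> (K n)) = {P_\<G>_inf L | L. compact L \<and> L \<subseteq> \<Omega> \<and> K n \<subseteq> interior L}"
  by (simp add: \<G>_inf_on_def)

lemma ups_seminorms_\<G>: "P \<in> seminorms (\<G> \<Omega>) \<Longrightarrow> ultra_pseudo_seminorm (\<G> \<Omega>) P"
  using ups_P_\<G>[OF lc_submodule_refl[OF gc_module_\<G>[OF op]]] by (auto simp: seminorms_\<G>)

lemma ups_seminorms_\<G>_inf: "P \<in> seminorms (\<G>_inf \<Omega>) \<Longrightarrow> ultra_pseudo_seminorm (\<G>_inf \<Omega>) P"
  using ups_P_\<G>_inf[OF lc_submodule_\<G>_inf] by (auto simp: \<G>_inf_def)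

lemma seminorms_\<G>_c:
  "seminorms (\<G>_c \<Omega> K) = ind_lim_seminorms (\<G>_c \<Omega> K) (range (\<lambda>n. \<G>_on \<Omega> (K n)))"
proof -
  define M where "M = (\<G> \<Omega>)\<lparr>carrier := {U \<in> carrier (\<G> \<Omega>). compact (gsupport \<Omega> U)}\<rparr>"
  have eq: "\<G>_c \<Omega> K = M\<lparr>seminorms := ind_lim_seminorms M (range (\<lambda>n. \<G>_on \<Omega> (K n)))\<rparr>"
    by (simp add: \<G>_c_def M_def Let_def)
  have carr: "carrier M = carrier (\<G>_c \<Omega> K)" by (simp add: eq)
  have "lc_submodule M (\<G> \<Omega>)"
    by (rule lc_submodule_classes[OF op _ _ _ carr[unfolded carrier_\<G>_c]])
      (auto simp: M_def zero_E_M supported_closed E_M_add[OF op] E_M_smult[OF op])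
  then have "lc_submodule M (\<G>_c \<Omega> K)"
    using carr by (intro lc_submodule_between[OF lc_submodule_\<G>_c]) auto
  have "seminorms (\<G>_c \<Omega> K) = ind_lim_seminorms M (range (\<lambda>n. \<G>_on \<Omega> (K n)))"
    unfolding eq by simp
  also have "\<dots> = ind_lim_seminorms (\<G>_c \<Omega> K) (range (\<lambda>n. \<G>_on \<Omega> (K n)))"
    by (rule ind_lim_seminorms_cong) fact+
  finally show ?thesis .
qed

lemma seminorms_\<G>_inf_c:
  "seminorms (\<G>_inf_c \<Omega> K) = ind_lim_seminorms (\<G>_inf_c \<Omega> K) (range (\<lambda>n. \<G>_inf_on \<Omega> (K n)))"
proof -
  define M where "M = (\<G>_inf \<Omega>)\<lparr>carrier := {U \<in> carrier (\<G>_inf \<Omega>). compact (gsupport \<Omega> U)}\<rparr>"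
  have eq: "\<G>_inf_c \<Omega> K = M\<lparr>seminorms := ind_lim_seminorms M (range (\<lambda>n. \<G>_inf_on \<Omega> (K n)))\<rparr>"
    by (simp add: \<G>_inf_c_def M_def Let_def)
  have carr: "carrier M = carrier (\<G>_inf_c \<Omega> K)" by (simp add: eq)
  have "lc_submodule M (\<G> \<Omega>)"
    by (rule lc_submodule_classes[OF op _ _ _ carr[unfolded carrier_\<G>_inf_c]])
      (use E_M_inf_imp_E_M in \<open>auto simp: M_def \<G>_inf_def zero_E_M supported_closed E_M_inf_add[OF op] E_M_inf_smult[OF op]\<close>)
  then have "lc_submodule M (\<G>_inf_c \<Omega> K)"
    using carr by (intro lc_submodule_between[OF lc_submodule_\<G>_inf_c]) auto
  have "seminorms (\<G>_inf_c \<Omega> K) = ind_lim_seminorms M (range (\<lambda>n. \<G>_inf_on \<Omega> (K n)))"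
    unfolding eq by simp
  also have "\<dots> = ind_lim_seminorms (\<G>_inf_c \<Omega> K) (range (\<lambda>n. \<G>_inf_on \<Omega> (K n)))"
    by (rule ind_lim_seminorms_cong) fact+
  finally show ?thesis .
qed

lemma ups_seminorms_\<G>_c: "P \<in> seminorms (\<G>_c \<Omega> K) \<Longrightarrow> ultra_pseudo_seminorm (\<G>_c \<Omega> K) P"
  unfolding seminorms_\<G>_c by (rule ind_lim_seminorms_ups)

lemma ups_seminorms_\<G>_inf_c: "P \<in> seminorms (\<G>_inf_c \<Omega> K) \<Longrightarrow> ultra_pseudo_seminorm (\<G>_inf_c \<Omega> K) P"
  unfolding seminorms_\<G>_inf_c by (rule ind_lim_seminorms_ups)

text \<open>The way in which all seminorms of the inductive limit are produced here: compact set,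
  order and constant may change with the step.\<close>

lemma seminorms_\<G>_cI:
  assumes "ultra_pseudo_seminorm (\<G>_c \<Omega> K) P"
    and "\<And>n. \<exists>L j C. compact L \<and> L \<subseteq> \<Omega> \<and> K n \<subseteq> interior L \<and>
      (\<forall>u\<in>E_M \<Omega> \<inter> N_ideal (\<Omega> - K n). P (gclass \<Omega> u) \<le> C * P_\<G> L j (gclass \<Omega> u))"
  shows "P \<in> seminorms (\<G>_c \<Omega> K)"
  unfolding seminorms_\<G>_c
proof (rule ind_lim_seminormsI[OF assms(1)])
  fix S assume "S \<in> range (\<lambda>n. \<G>_on \<Omega> (K n))"
  then obtain n where S: "S = \<G>_on \<Omega> (K n)" by auto
  show "lc_submodule S (\<G>_c \<Omega> K)" unfolding S by (rule lc_submodule_\<G>_on_\<G>_c)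
  show "ultra_pseudo_seminorm S Q" if "Q \<in> seminorms S" for Q
    using that ups_P_\<G>[OF lc_submodule_\<G>_on] by (auto simp: S seminorms_\<G>_on)
  obtain L j C where L: "compact L" "L \<subseteq> \<Omega>" "K n \<subseteq> interior L"
    "\<forall>u\<in>E_M \<Omega> \<inter> N_ideal (\<Omega> - K n). P (gclass \<Omega> u) \<le> C * P_\<G> L j (gclass \<Omega> u)"
    using assms(2)[of n] by blast
  show "\<exists>Q\<in>seminorms S. \<exists>C. \<forall>u\<in>carrier S. P u \<le> C * Q u"
    unfolding S carrier_\<G>_on seminorms_\<G>_on
    by (intro bexI[of _ "P_\<G> L j"] exI[of _ C]) (use L in auto)
qed

lemma seminorms_\<G>_subset_\<G>_c: "seminorms (\<G> \<Omega>) \<subseteq> seminorms (\<G>_c \<Omega> K)"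
proof
  fix P assume "P \<in> seminorms (\<G> \<Omega>)"
  then obtain L j where L: "P = P_\<G> L j" "compact L" "L \<subseteq> \<Omega>" by (auto simp: seminorms_\<G>)
  show "P \<in> seminorms (\<G>_c \<Omega> K)"
  proof (rule seminorms_\<G>_cI)
    show "ultra_pseudo_seminorm (\<G>_c \<Omega> K) P"
      unfolding L(1) by (rule ups_P_\<G>[OF lc_submodule_\<G>_c L(2,3)])
    fix n
    define L' where "L' = L \<union> K (Suc n)"
    have L': "compact L'" "L' \<subseteq> \<Omega>" "K n \<subseteq> interior L'"
      unfolding L'_def by (rule step_neighbourhood[OF L(2,3)])+
    have "P (gclass \<Omega> u) \<le> 1 * P_\<G> L' j (gclass \<Omega> u)" if "u \<in> E_M \<Omega>" for u
      using P_\<G>_mono[OF that L'(1,2) L(2), of j j] by (auto simp: L(1) L'_def)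
    then show "\<exists>L j C. compact L \<and> L \<subseteq> \<Omega> \<and> K n \<subseteq> interior L \<and>
        (\<forall>u\<in>E_M \<Omega> \<inter> N_ideal (\<Omega> - K n). P (gclass \<Omega> u) \<le> C * P_\<G> L j (gclass \<Omega> u))"
      using L' by blast
  qed
qed

lemma seminorms_\<G>_inf_subset_\<G>_inf_c: "seminorms (\<G>_inf \<Omega>) \<subseteq> seminorms (\<G>_inf_c \<Omega> K)"
proof
  fix P assume "P \<in> seminorms (\<G>_inf \<Omega>)"
  then obtain L where L: "P = P_\<G>_inf L" "compact L" "L \<subseteq> \<Omega>" by (auto simp: \<G>_inf_def)
  show "P \<in> seminorms (\<G>_inf_c \<Omega> K)"
    unfolding seminorms_\<G>_inf_c
  proof (rule ind_lim_seminormsI)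
    show "ultra_pseudo_seminorm (\<G>_inf_c \<Omega> K) P"
      unfolding L(1) by (rule ups_P_\<G>_inf[OF lc_submodule_\<G>_inf_c _ L(2,3)]) (auto simp: carrier_\<G>_inf_c)
    fix S assume "S \<in> range (\<lambda>n. \<G>_inf_on \<Omega> (K n))"
    then obtain n where S: "S = \<G>_inf_on \<Omega> (K n)" by auto
    show "lc_submodule S (\<G>_inf_c \<Omega> K)" unfolding S by (rule lc_submodule_\<G>_inf_on_\<G>_inf_c)
    show "ultra_pseudo_seminorm S Q" if Q: "Q \<in> seminorms S" for Q
    proof -
      obtain L where L: "Q = P_\<G>_inf L" "compact L" "L \<subseteq> \<Omega>" using Q by (auto simp: S seminorms_\<G>_inf_on)
      show ?thesis
        unfolding L(1) S by (rule ups_P_\<G>_inf[OF lc_submodule_\<G>_inf_on _ L(2,3)]) (auto simp: carrier_\<G>_inf_on)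
    qed
    define L' where "L' = L \<union> K (Suc n)"
    have L': "compact L'" "L' \<subseteq> \<Omega>" "K n \<subseteq> interior L'"
      unfolding L'_def by (rule step_neighbourhood[OF L(2,3)])+
    have "P (gclass \<Omega> u) \<le> 1 * P_\<G>_inf L' (gclass \<Omega> u)" if "u \<in> E_M_inf \<Omega>" for u
      using P_\<G>_inf_mono[OF that L'(1,2) L(2)] by (auto simp: L(1) L'_def)
    then show "\<exists>Q\<in>seminorms S. \<exists>C. \<forall>u\<in>carrier S. P u \<le> C * Q u"
      unfolding S carrier_\<G>_inf_on seminorms_\<G>_inf_on
      by (intro bexI[of _ "P_\<G>_inf L'"] exI[of _ 1]) (use L' in auto)
  qed
qed

section \<open>Bounded sets of the inductive limit\<close>

text \<open>The supremum over infinitely many seminorms is finite since on the step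
  \<open>K m\<close> only the first \<open>m\<close> of them can be nonzero, and the weights make
  the value on \<open>V n\<close> at least \<open>n\<close>.\<close>

lemma bounded_in_step:
  assumes "bounded_in (\<G>_c \<Omega> K) B"
  shows "\<exists>n. B \<subseteq> carrier (\<G>_on \<Omega> (K n))"
proof (rule ccontr)
  assume "\<not> ?thesis"
  then have "\<forall>n. \<exists>V. V \<in> B \<and> V \<notin> carrier (\<G>_on \<Omega> (K n))" by blast
  then obtain V where V: "\<And>n. V n \<in> B" "\<And>n. V n \<notin> carrier (\<G>_on \<Omega> (K n))" by metis
  have Bsub: "B \<subseteq> carrier (\<G>_c \<Omega> K)" using assms by (simp add: bounded_in_def)
  \<comment> \<open>Outside \<open>K n\<close> some derivative of \<open>V n\<close> is not
    negligible on a compact set. The seminorm up to the order of that derivative is then positive,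
    as its order set is not all of the reals.\<close>
  have "\<exists>L j. compact L \<and> L \<subseteq> \<Omega> - K n \<and> 0 < P_\<G> L j (V n)" for n
  proof -
    obtain v where v: "v \<in> E_M \<Omega>" "V n = gclass \<Omega> v"
      using V(1)[of n] Bsub by (auto simp: carrier_\<G>_c)
    have "v \<notin> N_ideal (\<Omega> - K n)" using V(2)[of n] v by (auto simp: carrier_\<G>_on)
    moreover have sm: "v \<in> smooth_nets (\<Omega> - K n)"
      by (rule smooth_nets_subset[OF E_M_smooth[OF v(1)]]) blast
    ultimately have "\<exists>L \<alpha>. \<exists>q::nat. compact L \<and> L \<subseteq> \<Omega> - K n \<and> \<not> order_O (sup_deriv L \<alpha> v) (real q)"
      unfolding N_ideal_def mem_Collect_eq by metis
    then obtain L \<alpha> and q :: nat where L: "compact L" "L \<subseteq> \<Omega> - K n" "\<not> order_O (sup_deriv L \<alpha> v) (real q)"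
      by blast
    define S where "S = ord_set L {\<beta>. order_multiindex \<beta> \<le> order_multiindex \<alpha>} v"
    have "real q \<notin> S" using L(3) unfolding order_O_sup_deriv[OF sm L(1,2)] by (auto simp: S_def ord_set_def)
    have L\<Omega>: "L \<subseteq> \<Omega>" using L(2) by blast
    have "S \<noteq> {}" unfolding S_def by (rule ord_set_nonempty[OF op v(1) L(1) L\<Omega> finite_order_multiindex])
    then have "expnorm S \<noteq> 0"
      using expnorm_0_imp[of S "real q"] \<open>real q \<notin> S\<close> ord_set_down unfolding S_def by blast
    then have "0 < P_\<G> L (order_multiindex \<alpha>) (V n)"
      unfolding v(2) P_\<G>_gclass[OF op v(1) L(1) L\<Omega>] S_def using expnorm_nonneg by (simp add: less_le)
    then show ?thesis using L by blast
  qed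
  then obtain L j where L: "\<And>n. compact (L n)" "\<And>n. L n \<subseteq> \<Omega> - K n" "\<And>n. 0 < P_\<G> (L n) (j n) (V n)"
    by metis
  have L\<Omega>: "L n \<subseteq> \<Omega>" for n using L(2) by blast
  \<comment> \<open>Scaled so that the weighted seminorm takes the value \<open>n\<close> on
    \<open>V n\<close>.\<close>
  define c where "c n = real n / P_\<G> (L n) (j n) (V n)" for n
  have c: "0 \<le> c n" for n using L(3)[of n] by (simp add: c_def)
  define a where "a n U = c n * P_\<G> (L n) (j n) U" for n U
  define P where "P U = (SUP n. a n U)" for U
  have upsn: "ultra_pseudo_seminorm (\<G>_c \<Omega> K) (P_\<G> (L n) (j n))" for n
    by (rule ups_P_\<G>[OF lc_submodule_\<G>_c L(1) L\<Omega>])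
  have a_nn: "0 \<le> a n U" if "U \<in> carrier (\<G>_c \<Omega> K)" for n U
    using upsn[of n] that c[of n] by (simp add: a_def ultra_pseudo_seminorm_def)
  have a_zero: "a n (gclass \<Omega> u) = 0" if "u \<in> E_M \<Omega>" "u \<in> N_ideal (\<Omega> - K m)" "m \<le> n" for u m n
  proof -
    have "u \<in> N_ideal (\<Omega> - K n)" by (rule N_ideal_step_mono[OF exh that(2,3)])
    then have "ord_set (L n) {\<alpha>. order_multiindex \<alpha> \<le> j n} u = UNIV"
      by (rule ord_set_N_ideal[OF open_diff_step _ L(1,2)])
    then show ?thesis
      unfolding a_def P_\<G>_gclass[OF op that(1) L(1) L\<Omega>] by (simp add: expnorm_eq_0)
  qed
  \<comment> \<open>Terms with index at least \<open>m\<close> vanish, the others are summands: one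
    finite sum dominates all terms, giving both the existence of the supremum and its bound on the
    step.\<close>
  have a_le: "a n (gclass \<Omega> u) \<le> (\<Sum>k<m. a k (gclass \<Omega> u))"
    if "u \<in> E_M \<Omega>" "u \<in> N_ideal (\<Omega> - K m)" for u m n
  proof -
    have "gclass \<Omega> u \<in> carrier (\<G>_c \<Omega> K)"
      using that by (auto simp: carrier_\<G>_c supported_def)
    note nn = a_nn[OF this]
    show ?thesis
    proof (cases "n < m")
      case True
      then show ?thesis using nn by (intro member_le_sum) auto
    next
      case False
      then show ?thesis using a_zero[OF that, of n] nn by (simp add: sum_nonneg)
    qed
  qed
  have bdd: "bdd_above (range (\<lambda>n. a n U))" if U: "U \<in> carrier (\<G>_c \<Omega> K)" for U
  proof -
    obtain u m where "u \<in> E_M \<Omega>" "u \<in> N_ideal (\<Omega> - K m)" "U = gclass \<Omega> u"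
      using U by (auto simp: carrier_\<G>_c supported_def)
    then show ?thesis using a_le by (auto intro!: bdd_aboveI)
  qed
  have a_P: "a n U \<le> P U" if "U \<in> carrier (\<G>_c \<Omega> K)" for n U
    unfolding P_def by (rule cSUP_upper[OF UNIV_I bdd[OF that]])
  have P_le: "P U \<le> d" if "\<And>n. a n U \<le> d" for U d
    unfolding P_def by (rule cSUP_least) (use that in auto)
  interpret gc_module "\<G>_c \<Omega> K" using lc_submodule_\<G>_c by (simp add: lc_submodule_def)
  have P_nn: "0 \<le> P U" if "U \<in> carrier (\<G>_c \<Omega> K)" for U
    using a_nn[OF that, of 0] a_P[OF that, of 0] by simp
  have ups: "ultra_pseudo_seminorm (\<G>_c \<Omega> K) P"
  proof (rule upsI[OF P_nn])
    have "a n \<zero>\<^bsub>\<G>_c \<Omega> K\<^esub> = 0" for n using upsn[of n] by (simp add: a_def ultra_pseudo_seminorm_def)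
    then show "P \<zero>\<^bsub>\<G>_c \<Omega> K\<^esub> = 0" by (simp add: P_def)
  next
    fix z U assume U: "U \<in> carrier (\<G>_c \<Omega> K)"
    show "P (z \<odot>\<^bsub>\<G>_c \<Omega> K\<^esub> U) \<le> gnorm z * P U"
    proof (rule P_le)
      fix n
      have "P_\<G> (L n) (j n) (z \<odot>\<^bsub>\<G>_c \<Omega> K\<^esub> U) \<le> gnorm z * P_\<G> (L n) (j n) U"
        using upsn[of n] U unfolding ultra_pseudo_seminorm_def by blast
      then have "a n (z \<odot>\<^bsub>\<G>_c \<Omega> K\<^esub> U) \<le> c n * (gnorm z * P_\<G> (L n) (j n) U)"
        unfolding a_def by (rule mult_left_mono[OF _ c])
      also have "\<dots> = gnorm z * a n U" by (simp add: a_def)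
      also have "\<dots> \<le> gnorm z * P U" by (rule mult_left_mono[OF a_P[OF U] gnorm_nonneg])
      finally show "a n (z \<odot>\<^bsub>\<G>_c \<Omega> K\<^esub> U) \<le> gnorm z * P U" .
    qed
  next
    fix U W assume U: "U \<in> carrier (\<G>_c \<Omega> K)" "W \<in> carrier (\<G>_c \<Omega> K)"
    show "P (U \<oplus>\<^bsub>\<G>_c \<Omega> K\<^esub> W) \<le> max (P U) (P W)"
    proof (rule P_le)
      fix n
      have "P_\<G> (L n) (j n) (U \<oplus>\<^bsub>\<G>_c \<Omega> K\<^esub> W) \<le> max (P_\<G> (L n) (j n) U) (P_\<G> (L n) (j n) W)"
        using upsn[of n] U unfolding ultra_pseudo_seminorm_def by blast
      then have "a n (U \<oplus>\<^bsub>\<G>_c \<Omega> K\<^esub> W) \<le> c n * max (P_\<G> (L n) (j n) U) (P_\<G> (L n) (j n) W)"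
        unfolding a_def by (rule mult_left_mono[OF _ c])
      also have "\<dots> = max (a n U) (a n W)" using c[of n] by (simp add: a_def max_mult_distrib_left)
      also have "\<dots> \<le> max (P U) (P W)" by (intro max.mono a_P U)
      finally show "a n (U \<oplus>\<^bsub>\<G>_c \<Omega> K\<^esub> W) \<le> max (P U) (P W)" .
    qed
  qed
  have mem: "P \<in> seminorms (\<G>_c \<Omega> K)"
  proof (rule seminorms_\<G>_cI[OF ups])
    fix m
    define L' where "L' = (\<Union>k<m. L k) \<union> K (Suc m)"
    have cL: "compact (\<Union>k<m. L k)" "(\<Union>k<m. L k) \<subseteq> \<Omega>" using L(1) L\<Omega> by (auto intro!: compact_UN)
    note L' = step_neighbourhood[OF cL, of m, folded L'_def]
    \<comment> \<open>A sum instead of a maximum: it dominates every \<open>j k\<close> with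
      \<open>k < m\<close> and makes sense for \<open>m = 0\<close>.\<close>
    define j' where "j' = (\<Sum>k<m. j k)"
    have "P (gclass \<Omega> u) \<le> (\<Sum>k<m. c k) * P_\<G> L' j' (gclass \<Omega> u)"
      if u: "u \<in> E_M \<Omega>" "u \<in> N_ideal (\<Omega> - K m)" for u
    proof (rule P_le)
      fix n
      have "a n (gclass \<Omega> u) \<le> (\<Sum>k<m. a k (gclass \<Omega> u))" by (rule a_le[OF u])
      also have "\<dots> \<le> (\<Sum>k<m. c k * P_\<G> L' j' (gclass \<Omega> u))"
      proof (rule sum_mono)
        fix k assume k: "k \<in> {..<m}"
        then have "L k \<subseteq> L'" "j k \<le> j'" by (auto simp: L'_def j'_def intro!: member_le_sum)
        then show "a k (gclass \<Omega> u) \<le> c k * P_\<G> L' j' (gclass \<Omega> u)"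
          unfolding a_def by (intro mult_left_mono[OF _ c] P_\<G>_mono[OF u(1) L'(1,2) L(1)])
      qed
      finally show "a n (gclass \<Omega> u) \<le> (\<Sum>k<m. c k) * P_\<G> L' j' (gclass \<Omega> u)"
        by (simp add: sum_distrib_right)
    qed
    then show "\<exists>L j C. compact L \<and> L \<subseteq> \<Omega> \<and> K m \<subseteq> interior L \<and>
        (\<forall>u\<in>E_M \<Omega> \<inter> N_ideal (\<Omega> - K m). P (gclass \<Omega> u) \<le> C * P_\<G> L j (gclass \<Omega> u))"
      using L' by blast
  qed
  have "continuous_map (lc_topology (\<G>_c \<Omega> K)) euclideanreal P"
    unfolding lc_topology_def by (rule continuous_ups[OF gc_module_axioms ups mem])
  then obtain C where C: "\<And>U. U \<in> B \<Longrightarrow> P U \<le> C"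
    using assms ups unfolding bounded_in_def by blast
  obtain n :: nat where "C < real n" using reals_Archimedean2 by blast
  moreover have "real n = a n (V n)" using L(3)[of n] by (simp add: a_def c_def)
  moreover have "a n (V n) \<le> P (V n)" using V(1)[of n] Bsub by (intro a_P) blast
  ultimately show False using C[OF V(1)[of n]] by simp
qed

section \<open>The pairing and the two integration maps\<close>

definition pairing :: "'n gfun \<Rightarrow> 'n gfun \<Rightarrow> gcomplex" where
  "pairing U V = gintegral \<Omega> (gmult \<Omega> U V)"

lemma pairing_commute: "pairing U V = pairing V U"
  by (simp add: pairing_def gmult_def mult.commute)

text \<open>A common \<open>n\<close> lets all three integrals run over the same compact set. The
  alternative in the hypothesis admits the compact support in either argument, so that with
  \<open>pairing_commute\<close> additivity in both arguments follows.\<close>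

lemma pairing_add_left:
  assumes "u \<in> E_M \<Omega>" "u' \<in> E_M \<Omega>" "v \<in> E_M \<Omega>"
    and n: "u \<in> N_ideal (\<Omega> - K n) \<and> u' \<in> N_ideal (\<Omega> - K n) \<or> v \<in> N_ideal (\<Omega> - K n)"
  shows "pairing (gclass \<Omega> u \<oplus>\<^bsub>\<G> \<Omega>\<^esub> gclass \<Omega> u') (gclass \<Omega> v) =
    pairing (gclass \<Omega> u) (gclass \<Omega> v) + pairing (gclass \<Omega> u') (gclass \<Omega> v)"
proof -
  note Kf = exhausting_facts[OF exh, of "Suc n"]
  note int = moderate_integral[OF op E_M_mult[OF op assms(1,3)] Kf(1,3)]
    moderate_integral[OF op E_M_mult[OF op assms(2,3)] Kf(1,3)]
  have sum: "u \<in> N_ideal (\<Omega> - K n) \<or> v \<in> N_ideal (\<Omega> - K n)" "u' \<in> N_ideal (\<Omega> - K n) \<or> v \<in> N_ideal (\<Omega> - K n)"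
    "(\<lambda>\<epsilon> x. u \<epsilon> x + u' \<epsilon> x) \<in> N_ideal (\<Omega> - K n) \<or> v \<in> N_ideal (\<Omega> - K n)"
    using n step_ideal(2) by blast+
  have "abs_gcomplex (\<lambda>\<epsilon>. (LINT y:K (Suc n)|lborel. u \<epsilon> y * v \<epsilon> y) + (LINT y:K (Suc n)|lborel. u' \<epsilon> y * v \<epsilon> y)) =
      abs_gcomplex (\<lambda>\<epsilon>. LINT y:K (Suc n)|lborel. (u \<epsilon> y + u' \<epsilon> y) * v \<epsilon> y)"
  proof (rule abs_gcomplex_cong[OF moderate_add[OF int]])
    fix \<epsilon> :: real assume \<epsilon>: "\<epsilon> \<in> {0<..1}"
    show "(LINT y:K (Suc n)|lborel. u \<epsilon> y * v \<epsilon> y) + (LINT y:K (Suc n)|lborel. u' \<epsilon> y * v \<epsilon> y) =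
        (LINT y:K (Suc n)|lborel. (u \<epsilon> y + u' \<epsilon> y) * v \<epsilon> y)"
      using smooth_net_integrable[OF E_M_smooth[OF E_M_mult[OF op assms(1,3)]] \<epsilon> Kf(1,3)]
        smooth_net_integrable[OF E_M_smooth[OF E_M_mult[OF op assms(2,3)]] \<epsilon> Kf(1,3)]
      by (simp add: distrib_right set_integral_add(2))
  qed
  then show ?thesis
    unfolding pairing_def add_gclass[OF op assms(1,2)]
      gintegral_gmult[OF op exh assms(1,3) sum(1)] gintegral_gmult[OF op exh assms(2,3) sum(2)]
      gintegral_gmult[OF op exh E_M_add[OF op assms(1,2)] assms(3) sum(3)]
      plus_abs_gcomplex[OF int] by (rule sym)
qed

lemma pairing_smult_left:
  assumes "u \<in> E_M \<Omega>" "v \<in> E_M \<Omega>" and n: "u \<in> N_ideal (\<Omega> - K n) \<or> v \<in> N_ideal (\<Omega> - K n)"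
  shows "pairing (z \<odot>\<^bsub>\<G> \<Omega>\<^esub> gclass \<Omega> u) (gclass \<Omega> v) = z * pairing (gclass \<Omega> u) (gclass \<Omega> v)"
proof -
  obtain z' where z: "moderate z'" "z = abs_gcomplex z'" by (rule gcomplexE)
  note Kf = exhausting_facts[OF exh, of "Suc n"]
  have sum: "(\<lambda>\<epsilon> x. z' \<epsilon> * u \<epsilon> x) \<in> N_ideal (\<Omega> - K n) \<or> v \<in> N_ideal (\<Omega> - K n)"
    using n step_ideal(3)[OF _ z(1)] by blast
  show ?thesis
    unfolding pairing_def z(2) smult_gclass[OF op assms(1) z(1)] gintegral_gmult[OF op exh assms]
      gintegral_gmult[OF op exh E_M_smult[OF op assms(1) z(1)] assms(2) sum]
      times_abs_gcomplex[OF z(1) moderate_integral[OF op E_M_mult[OF op assms(1,2)] Kf(1,3)]]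
    by (simp add: mult.assoc)
qed

lemma pairing_add:
  assumes "U \<in> carrier (\<G> \<Omega>)" "U' \<in> carrier (\<G> \<Omega>)" "V \<in> carrier (\<G>_c \<Omega> K)"
  shows "pairing (U \<oplus>\<^bsub>\<G> \<Omega>\<^esub> U') V = pairing U V + pairing U' V"
  using assms pairing_add_left by (auto simp: carrier_\<G> carrier_\<G>_c supported_def)

lemma pairing_add':
  assumes "U \<in> carrier (\<G> \<Omega>)" "V \<in> carrier (\<G>_c \<Omega> K)" "V' \<in> carrier (\<G>_c \<Omega> K)"
  shows "pairing U (V \<oplus>\<^bsub>\<G> \<Omega>\<^esub> V') = pairing U V + pairing U V'"
proof -
  obtain v v' where v: "v \<in> E_M \<Omega>" "v \<in> supported \<Omega> K" "V = gclass \<Omega> v"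
    "v' \<in> E_M \<Omega>" "v' \<in> supported \<Omega> K" "V' = gclass \<Omega> v'"
    using assms(2,3) by (auto simp: carrier_\<G>_c)
  obtain u where u: "u \<in> E_M \<Omega>" "U = gclass \<Omega> u" using assms(1) by (auto simp: carrier_\<G>)
  obtain n where "v \<in> N_ideal (\<Omega> - K n)" "v' \<in> N_ideal (\<Omega> - K n)"
    by (rule supported_common[OF exh v(2,5)])
  then show ?thesis
    using pairing_add_left[OF v(1,4) u(1), of n] by (simp add: u(2) v(3,6) pairing_commute[of "gclass \<Omega> u"])
qed

lemma pairing_smult:
  assumes "U \<in> carrier (\<G> \<Omega>)" "V \<in> carrier (\<G>_c \<Omega> K)"
  shows "pairing (z \<odot>\<^bsub>\<G> \<Omega>\<^esub> U) V = z * pairing U V" "pairing U (z \<odot>\<^bsub>\<G> \<Omega>\<^esub> V) = z * pairing U V"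
proof -
  obtain u where u: "u \<in> E_M \<Omega>" "U = gclass \<Omega> u" using assms(1) by (auto simp: carrier_\<G>)
  obtain v n where v: "v \<in> E_M \<Omega>" "v \<in> N_ideal (\<Omega> - K n)" "V = gclass \<Omega> v"
    using assms(2) by (auto simp: carrier_\<G>_c supported_def)
  show "pairing (z \<odot>\<^bsub>\<G> \<Omega>\<^esub> U) V = z * pairing U V"
    using pairing_smult_left[OF u(1) v(1) disjI2[OF v(2)]] by (simp add: u(2) v(3))
  show "pairing U (z \<odot>\<^bsub>\<G> \<Omega>\<^esub> V) = z * pairing U V"
    using pairing_smult_left[OF v(1) u(1) disjI1[OF v(2)]]
    by (simp add: u(2) v(3) pairing_commute[of "gclass \<Omega> u"])
qed

lemma gnorm_pairing_le:
  assumes "U \<in> carrier (\<G> \<Omega>)" "V \<in> carrier (\<G>_on \<Omega> (K n))"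
  shows "gnorm (pairing U V) \<le> P_\<G> (K (Suc n)) 0 U * P_\<G> (K (Suc n)) 0 V"
proof -
  obtain u where u: "u \<in> E_M \<Omega>" "U = gclass \<Omega> u" using assms(1) by (auto simp: carrier_\<G>)
  obtain v where v: "v \<in> E_M \<Omega>" "v \<in> N_ideal (\<Omega> - K n)" "V = gclass \<Omega> v"
    using assms(2) by (auto simp: carrier_\<G>_on)
  show ?thesis
    unfolding pairing_def u(2) v(3) by (rule gnorm_gintegral_le[OF op exh u(1) v(1) disjI2[OF v(2)]])
qed

lemma pairing_eq_zero:
  assumes "U \<in> carrier (\<G> \<Omega>)" "\<And>V. V \<in> carrier (\<G>_c \<Omega> K) \<Longrightarrow> pairing U V = 0"
  shows "U = \<zero>\<^bsub>\<G> \<Omega>\<^esub>"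
proof -
  obtain u where u: "u \<in> E_M \<Omega>" "U = gclass \<Omega> u" using assms(1) by (auto simp: carrier_\<G>)
  have "u \<in> N_ideal \<Omega>"
  proof (rule pairing_nondegenerate[OF op exh u(1)])
    fix v n assume "v \<in> E_M \<Omega>" "v \<in> N_ideal (\<Omega> - K n)"
    then have "pairing U (gclass \<Omega> v) = 0"
      by (intro assms(2)) (auto simp: carrier_\<G>_c supported_def)
    then show "gintegral \<Omega> (gmult \<Omega> (gclass \<Omega> u) (gclass \<Omega> v)) = 0" by (simp add: pairing_def u(2))
  qed
  then show ?thesis unfolding u(2) zero_\<G> using gclass_eq_zero_iff[OF op] by blast
qed

lemma gc_modules: "gc_module (\<G> \<Omega>)" "gc_module (\<G>_c \<Omega> K)"
  using lc_submodule_\<G>_c by (simp_all add: lc_submodule_def)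

lemma ops_\<G>_c: "\<zero>\<^bsub>\<G>_c \<Omega> K\<^esub> = \<zero>\<^bsub>\<G> \<Omega>\<^esub>" "U \<oplus>\<^bsub>\<G>_c \<Omega> K\<^esub> V = U \<oplus>\<^bsub>\<G> \<Omega>\<^esub> V" "z \<odot>\<^bsub>\<G>_c \<Omega> K\<^esub> U = z \<odot>\<^bsub>\<G> \<Omega>\<^esub> U"
  and \<G>_c_subset: "U \<in> carrier (\<G>_c \<Omega> K) \<Longrightarrow> U \<in> carrier (\<G> \<Omega>)"
  using lc_submodule_\<G>_c by (auto simp: lc_submodule_def)

lemma P_step_seminorm: "P_\<G> (K (Suc n)) 0 \<in> seminorms (\<G> \<Omega>)"
  unfolding seminorms_\<G> using exhausting_facts[OF exh] by blast

lemma linear_functional_pairing: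
  "U \<in> carrier (\<G> \<Omega>) \<Longrightarrow> linear_functional (\<G>_c \<Omega> K) (pairing U)"
  "V \<in> carrier (\<G>_c \<Omega> K) \<Longrightarrow> linear_functional (\<G> \<Omega>) (pairing V)"
  using pairing_add' pairing_add pairing_smult
  by (simp_all add: linear_functional_def ops_\<G>_c pairing_commute[of V])

lemma continuous_pairing_\<G>:
  assumes U: "U \<in> carrier (\<G>_c \<Omega> K)"
  shows "continuous_map (lc_topology (\<G> \<Omega>)) euclidean (pairing U)"
proof -
  obtain n where n: "U \<in> carrier (\<G>_on \<Omega> (K n))"
    using U by (auto simp: carrier_\<G>_c carrier_\<G>_on supported_def)
  show ?thesis
    unfolding lc_topology_def
  proof (rule continuous_functional_bound[OF gc_modules(1) linear_functional_pairing(2)[OF U]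
        ups_seminorms_\<G>[OF P_step_seminorm] P_step_seminorm])
    fix V assume "V \<in> carrier (\<G> \<Omega>)"
    from gnorm_pairing_le[OF this n]
    show "gnorm (pairing U V) \<le> P_\<G> (K (Suc n)) 0 U * P_\<G> (K (Suc n)) 0 V"
      by (simp add: pairing_commute[of U] mult.commute)
  qed
qed

lemma embedding_\<G>_into_dual_\<G>_c:
  "continuous_linear_embedding (\<G> \<Omega>) (dual (\<G>_c \<Omega> K)) (\<lambda>U. \<lambda>V\<in>carrier (\<G>_c \<Omega> K). pairing U V)"
proof (rule embedding_into_dual[OF gc_modules(1) ups_seminorms_\<G> gc_modules(2)])
  fix U assume U: "U \<in> carrier (\<G> \<Omega>)"
  show "linear_functional (\<G>_c \<Omega> K) (pairing U)" by (rule linear_functional_pairing(1)[OF U])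
  note ups = ups_gnorm_functional[OF gc_modules(2) this]
  \<comment> \<open>The functional is continuous because its own absolute value is a seminorm of the
    inductive limit: on each step a step seminorm dominates it, with a constant depending on
    \<open>U\<close> and on the step.\<close>
  have "(\<lambda>V. gnorm (pairing U V)) \<in> seminorms (\<G>_c \<Omega> K)"
  proof (rule seminorms_\<G>_cI[OF ups])
    fix n
    have "gnorm (pairing U (gclass \<Omega> v)) \<le> P_\<G> (K (Suc n)) 0 U * P_\<G> (K (Suc n)) 0 (gclass \<Omega> v)"
      if "v \<in> E_M \<Omega> \<inter> N_ideal (\<Omega> - K n)" for v
      using that by (intro gnorm_pairing_le[OF U]) (auto simp: carrier_\<G>_on)
    then show "\<exists>L j C. compact L \<and> L \<subseteq> \<Omega> \<and> K n \<subseteq> interior L \<and>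
        (\<forall>v\<in>E_M \<Omega> \<inter> N_ideal (\<Omega> - K n). gnorm (pairing U (gclass \<Omega> v)) \<le> C * P_\<G> L j (gclass \<Omega> v))"
      by (intro exI[of _ "K (Suc n)"] exI[of _ 0] exI[of _ "P_\<G> (K (Suc n)) 0 U"] conjI ballI
          exhausting_facts[OF exh])
  qed
  then show "continuous_map (lc_topology (\<G>_c \<Omega> K)) euclidean (pairing U)"
    unfolding lc_topology_def
    by (rule continuous_functional_bound[OF gc_modules(2) linear_functional_pairing(1)[OF U] ups, of _ 1]) simp
  show "U = \<zero>\<^bsub>\<G> \<Omega>\<^esub>" if "\<And>V. V \<in> carrier (\<G>_c \<Omega> K) \<Longrightarrow> pairing U V = 0"
    by (rule pairing_eq_zero[OF U that])
  fix V assume V: "V \<in> carrier (\<G>_c \<Omega> K)"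
  show "pairing (z \<odot>\<^bsub>\<G> \<Omega>\<^esub> U) V = z * pairing U V" for z by (rule pairing_smult(1)[OF U V])
  show "pairing (U \<oplus>\<^bsub>\<G> \<Omega>\<^esub> U') V = pairing U V + pairing U' V" if "U' \<in> carrier (\<G> \<Omega>)" for U'
    by (rule pairing_add[OF U that V])
next
  fix B assume B: "bounded_in (\<G>_c \<Omega> K) B"
  \<comment> \<open>With \<open>B\<close> inside one step, the compact set \<open>K (Suc n)\<close>
    serves for all elements of \<open>B\<close>, and the bound of its seminorm on \<open>B\<close>
    is the constant.\<close>
  obtain n where n: "B \<subseteq> carrier (\<G>_on \<Omega> (K n))" using bounded_in_step[OF B] by blast
  let ?P = "P_\<G> (K (Suc n)) 0"
  have "?P \<in> seminorms (\<G>_c \<Omega> K)" using P_step_seminorm seminorms_\<G>_subset_\<G>_c by blast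
  then obtain C where C: "0 \<le> C" "\<And>V. V \<in> B \<Longrightarrow> ?P V \<le> C"
    using bounded_seminorm[OF gc_modules(2) B _ ups_seminorms_\<G>_c] by blast
  have "gnorm (pairing U V) \<le> C * ?P U" if U: "U \<in> carrier (\<G> \<Omega>)" and V: "V \<in> B" for U V
  proof -
    have "0 \<le> ?P U" using ups_seminorms_\<G>[OF P_step_seminorm] U by (simp add: ultra_pseudo_seminorm_def)
    then have "?P U * ?P V \<le> ?P U * C" using C(2)[OF V] by (rule mult_left_mono[rotated])
    moreover have "gnorm (pairing U V) \<le> ?P U * ?P V" using n V by (intro gnorm_pairing_le[OF U]) blast
    ultimately show ?thesis by (simp add: mult.commute)
  qed
  then show "\<exists>P\<in>seminorms (\<G> \<Omega>). \<exists>C\<ge>0. \<forall>U\<in>carrier (\<G> \<Omega>). \<forall>V\<in>B. gnorm (pairing U V) \<le> C * P U"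
    using P_step_seminorm C(1) by blast
qed

text \<open>The seminorm of \<open>\<G>_c\<close> that controls the pairing on a bounded
  \<open>B\<close> is the supremum over \<open>B\<close> itself. On a step, its bound is the
  supremum over \<open>B\<close> of the seminorm for \<open>K (Suc n)\<close>.\<close>

lemma embedding_\<G>_c_into_dual_\<G>:
  "continuous_linear_embedding (\<G>_c \<Omega> K) (dual (\<G> \<Omega>)) (\<lambda>U. \<lambda>V\<in>carrier (\<G> \<Omega>). pairing U V)"
proof (rule embedding_into_dual[OF gc_modules(2) ups_seminorms_\<G>_c gc_modules(1)])
  fix U assume U: "U \<in> carrier (\<G>_c \<Omega> K)"
  show "linear_functional (\<G> \<Omega>) (pairing U)" by (rule linear_functional_pairing(2)[OF U])
  show "continuous_map (lc_topology (\<G> \<Omega>)) euclidean (pairing U)" by (rule continuous_pairing_\<G>[OF U])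
  show "U = \<zero>\<^bsub>\<G>_c \<Omega> K\<^esub>" if "\<And>V. V \<in> carrier (\<G> \<Omega>) \<Longrightarrow> pairing U V = 0"
    unfolding ops_\<G>_c by (rule pairing_eq_zero[OF \<G>_c_subset[OF U] that[OF \<G>_c_subset]])
  fix V assume V: "V \<in> carrier (\<G> \<Omega>)"
  show "pairing (z \<odot>\<^bsub>\<G>_c \<Omega> K\<^esub> U) V = z * pairing U V" for z
    using pairing_smult(2)[OF V U] by (simp add: ops_\<G>_c pairing_commute[of _ V])
  show "pairing (U \<oplus>\<^bsub>\<G>_c \<Omega> K\<^esub> U') V = pairing U V + pairing U' V" if "U' \<in> carrier (\<G>_c \<Omega> K)" for U'
    using pairing_add'[OF V U that] by (simp add: ops_\<G>_c pairing_commute[of _ V])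
next
  fix B assume B: "bounded_in (\<G> \<Omega>) B"
  have sub: "V \<in> carrier (\<G> \<Omega>)" if "V \<in> B" for V using B that by (auto simp: bounded_in_def)
  define \<Phi> where "\<Phi> U = (\<lambda>V\<in>carrier (\<G> \<Omega>). pairing U V)" for U
  define Q where "Q T = sup_nonneg ((\<lambda>V. gnorm (T V)) ` B)" for T :: "'n gfun \<Rightarrow> gcomplex"
  have Q: "Q \<in> seminorms (dual (\<G> \<Omega>))" unfolding dual_ops Q_def[abs_def] using B by blast
  have \<Phi>: "\<Phi> U \<in> carrier (dual (\<G> \<Omega>))" if U: "U \<in> carrier (\<G>_c \<Omega> K)" for U
    unfolding \<Phi>_def
    by (rule restrict_in_dual[OF gc_modules(1) linear_functional_pairing(2)[OF U] continuous_pairing_\<G>[OF U]])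
  \<comment> \<open>A seminorm of the dual, pulled back along the linear map into the dual.\<close>
  have ups: "ultra_pseudo_seminorm (\<G>_c \<Omega> K) (\<lambda>U. Q (\<Phi> U))"
  proof (rule ups_pullback[OF gc_modules(2) gc_module_dual[OF gc_modules(1)] ups_dual_seminorms[OF gc_modules(1) Q] \<Phi>])
    fix U assume U: "U \<in> carrier (\<G>_c \<Omega> K)"
    show "\<Phi> (U \<oplus>\<^bsub>\<G>_c \<Omega> K\<^esub> U') = \<Phi> U \<oplus>\<^bsub>dual (\<G> \<Omega>)\<^esub> \<Phi> U'" if "U' \<in> carrier (\<G>_c \<Omega> K)" for U'
      using pairing_add'[OF _ U that]
      by (auto simp: \<Phi>_def dual_ops ops_\<G>_c restrict_def fun_eq_iff pairing_commute[of U] pairing_commute[of U'] pairing_commute[of "U \<oplus>\<^bsub>\<G> \<Omega>\<^esub> U'"])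
    show "\<Phi> (z \<odot>\<^bsub>\<G>_c \<Omega> K\<^esub> U) = z \<odot>\<^bsub>dual (\<G> \<Omega>)\<^esub> \<Phi> U" for z
      using pairing_smult(2)[OF _ U]
      by (auto simp: \<Phi>_def dual_ops ops_\<G>_c restrict_def fun_eq_iff pairing_commute[of U] pairing_commute[of "z \<odot>\<^bsub>\<G> \<Omega>\<^esub> U"])
  qed
  have mem: "(\<lambda>U. Q (\<Phi> U)) \<in> seminorms (\<G>_c \<Omega> K)"
  proof (rule seminorms_\<G>_cI[OF ups])
    fix n
    let ?P = "P_\<G> (K (Suc n)) 0"
    obtain C where C: "0 \<le> C" "\<And>V. V \<in> B \<Longrightarrow> ?P V \<le> C"
      using bounded_seminorm[OF gc_modules(1) B P_step_seminorm ups_seminorms_\<G>[OF P_step_seminorm]] by blast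
    have "Q (\<Phi> U) \<le> C * ?P U" if U: "U \<in> carrier (\<G>_on \<Omega> (K n))" for U
    proof -
      have "U \<in> carrier (\<G> \<Omega>)" using U by (auto simp: carrier_\<G>_on carrier_\<G>)
      then have "0 \<le> ?P U"
        using ups_seminorms_\<G>[OF P_step_seminorm] by (simp add: ultra_pseudo_seminorm_def)
      moreover have "gnorm (\<Phi> U V) \<le> C * ?P U" if V: "V \<in> B" for V
      proof -
        have "gnorm (pairing V U) \<le> ?P V * ?P U" by (rule gnorm_pairing_le[OF sub[OF V] U])
        also have "\<dots> \<le> C * ?P U" by (intro mult_right_mono C(2)[OF V]) fact
        finally show ?thesis using sub[OF V] by (simp add: \<Phi>_def pairing_commute[of U])
      qed
      ultimately show ?thesis unfolding Q_def using C(1) by (intro sup_nonneg_le) auto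
    qed
    then have "\<forall>u\<in>E_M \<Omega> \<inter> N_ideal (\<Omega> - K n). Q (\<Phi> (gclass \<Omega> u)) \<le> C * ?P (gclass \<Omega> u)"
      by (auto simp: carrier_\<G>_on)
    then show "\<exists>L j C. compact L \<and> L \<subseteq> \<Omega> \<and> K n \<subseteq> interior L \<and>
        (\<forall>u\<in>E_M \<Omega> \<inter> N_ideal (\<Omega> - K n). Q (\<Phi> (gclass \<Omega> u)) \<le> C * P_\<G> L j (gclass \<Omega> u))"
      by (intro exI[of _ "K (Suc n)"] exI[of _ 0] exI[of _ C] conjI exhausting_facts[OF exh])
  qed
  have "gnorm (pairing U V) \<le> 1 * Q (\<Phi> U)" if "U \<in> carrier (\<G>_c \<Omega> K)" "V \<in> B" for U V
  proof -
    have "gnorm (\<Phi> U V) \<le> Q (\<Phi> U)"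
      unfolding Q_def
      by (rule sup_nonneg_upper[OF bdd_above_functional[OF gc_modules(1) \<Phi>[OF that(1)] B] imageI[OF that(2)]])
    moreover have "\<Phi> U V = pairing U V" using sub[OF that(2)] by (simp add: \<Phi>_def)
    ultimately show ?thesis by simp
  qed
  then show "\<exists>P\<in>seminorms (\<G>_c \<Omega> K). \<exists>C\<ge>0. \<forall>U\<in>carrier (\<G>_c \<Omega> K). \<forall>V\<in>B. gnorm (pairing U V) \<le> C * P U"
    by (intro bexI[OF _ mem] exI[of _ 1]) auto
qed

section \<open>Cutoff nets and the restriction maps\<close>

text \<open>The last two properties hold for an arbitrary net \<open>u\<close>, because the products
  and differences vanish identically on the open sets in question.\<close>

lemma ex_cutoff_net:
  assumes "compact L" "L \<subseteq> \<Omega>"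
  obtains \<kappa> W n where "(\<lambda>_. \<kappa>) \<in> E_M_inf \<Omega>" "open W" "L \<subseteq> W"
    "\<And>u. (\<lambda>\<epsilon> x. \<kappa> x * u \<epsilon> x) \<in> N_ideal (\<Omega> - K n)"
    "\<And>u. (\<lambda>\<epsilon> x. \<kappa> x * u \<epsilon> x - u \<epsilon> x) \<in> N_ideal W"
proof -
  obtain \<phi> :: "real^'n \<Rightarrow> real" and W D where \<phi>: "smooth_on UNIV (\<lambda>x. complex_of_real (\<phi> x))"
    "\<And>x. 0 \<le> \<phi> x" "open W" "L \<subseteq> W" "W \<subseteq> D" "compact D" "D \<subseteq> \<Omega>"
    "\<And>x. x \<in> W \<Longrightarrow> \<phi> x = 1" "\<And>x. x \<notin> D \<Longrightarrow> \<phi> x = 0"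
    by (rule ex_smooth_cutoff[OF assms(1) op assms(2)]) (rule that; assumption)
  obtain n where n: "D \<subseteq> K n" using exhausting_absorbs[OF exh \<phi>(6,7)] by blast
  show thesis
  proof (rule that[of "\<lambda>x. complex_of_real (\<phi> x)" W n])
    show "(\<lambda>_ x. complex_of_real (\<phi> x)) \<in> E_M_inf \<Omega>"
      by (rule E_M_inf_smooth_function[OF op smooth_on_subset[OF \<phi>(1) subset_UNIV]])
    show "(\<lambda>\<epsilon> x. complex_of_real (\<phi> x) * u \<epsilon> x) \<in> N_ideal (\<Omega> - K n)" for u
      by (rule N_ideal_vanishing[OF open_diff_step]) (use n \<phi>(9) in auto)
    show "(\<lambda>\<epsilon> x. complex_of_real (\<phi> x) * u \<epsilon> x - u \<epsilon> x) \<in> N_ideal W" for u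
      by (rule N_ideal_vanishing[OF \<phi>(3)]) (use \<phi>(8) in auto)
  qed (use \<phi> in auto)
qed

lemma restriction_\<G>:
  "continuous_linear_embedding (dual (\<G> \<Omega>)) (dual (\<G>_c \<Omega> K)) (\<lambda>T. restrict T (carrier (\<G>_c \<Omega> K)))"
proof (rule restriction_embedding[OF lc_submodule_\<G>_c ups_seminorms_\<G> ups_seminorms_\<G>_c seminorms_\<G>_subset_\<G>_c])
  fix U F assume "U \<in> carrier (\<G> \<Omega>)" and F: "finite F" "F \<subseteq> seminorms (\<G> \<Omega>)"
  then obtain u where u: "u \<in> E_M \<Omega>" "U = gclass \<Omega> u" by (auto simp: carrier_\<G>)
  have "\<forall>P\<in>F. \<exists>L j. P = P_\<G> L j \<and> compact L \<and> L \<subseteq> \<Omega>" using F(2) by (auto simp: seminorms_\<G>)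
  then obtain L j where L: "\<And>P. P \<in> F \<Longrightarrow> P = P_\<G> (L P) (j P) \<and> compact (L P) \<and> L P \<subseteq> \<Omega>" by metis
  have "compact (\<Union>P\<in>F. L P)" "(\<Union>P\<in>F. L P) \<subseteq> \<Omega>" using L F(1) by (auto intro!: compact_UN)
  then obtain \<kappa> W n where \<kappa>: "(\<lambda>_. \<kappa>) \<in> E_M_inf \<Omega>" "open W" "(\<Union>P\<in>F. L P) \<subseteq> W"
    "\<And>u. (\<lambda>\<epsilon> x. \<kappa> x * u \<epsilon> x) \<in> N_ideal (\<Omega> - K n)"
    "\<And>u. (\<lambda>\<epsilon> x. \<kappa> x * u \<epsilon> x - u \<epsilon> x) \<in> N_ideal W"
    by (rule ex_cutoff_net) (rule that; assumption)
  have w: "(\<lambda>\<epsilon> x. \<kappa> x * u \<epsilon> x) \<in> E_M \<Omega>"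
    using E_M_mult[OF op subsetD[OF E_M_inf_imp_E_M \<kappa>(1)] u(1)] .
  show "\<exists>w\<in>carrier (\<G>_c \<Omega> K). \<forall>P\<in>F. P (w \<ominus>\<^bsub>\<G> \<Omega>\<^esub> U) = 0"
  proof (intro bexI ballI)
    show "gclass \<Omega> (\<lambda>\<epsilon> x. \<kappa> x * u \<epsilon> x) \<in> carrier (\<G>_c \<Omega> K)"
      using w \<kappa>(4) by (auto simp: carrier_\<G>_c supported_def)
    fix P assume P: "P \<in> F"
    have LP: "P = P_\<G> (L P) (j P)" "compact (L P)" "L P \<subseteq> \<Omega>" using L[OF P] by blast+
    have LW: "L P \<subseteq> W" using \<kappa>(3) P by blast
    have "P_\<G> (L P) (j P) (gclass \<Omega> (\<lambda>\<epsilon> x. \<kappa> x * u \<epsilon> x) \<ominus>\<^bsub>\<G> \<Omega>\<^esub> U) = 0"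
      unfolding u(2) minus_gclass[OF op w u(1)] P_\<G>_gclass[OF op E_M_diff[OF op w u(1)] LP(2,3)]
      by (rule expnorm_ord_set_zero[OF \<kappa>(2,5) LP(2) LW])
    then show "P (gclass \<Omega> (\<lambda>\<epsilon> x. \<kappa> x * u \<epsilon> x) \<ominus>\<^bsub>\<G> \<Omega>\<^esub> U) = 0"
      by (rule trans[OF fun_cong[OF LP(1)]])
  qed
qed

text \<open>The cutoff is constant in \<epsilon> and therefore regular, so multiplication by it
  stays within \<open>\<G>_inf\<close>; vanishing near the compact sets then annihilates the
  seminorms over all derivatives at once.\<close>

lemma restriction_\<G>_inf:
  "continuous_linear_embedding (dual (\<G>_inf \<Omega>)) (dual (\<G>_inf_c \<Omega> K)) (\<lambda>T. restrict T (carrier (\<G>_inf_c \<Omega> K)))"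
proof (rule restriction_embedding[OF lc_submodule_\<G>_inf_c_\<G>_inf ups_seminorms_\<G>_inf ups_seminorms_\<G>_inf_c
      seminorms_\<G>_inf_subset_\<G>_inf_c])
  fix U F assume U: "U \<in> carrier (\<G>_inf \<Omega>)" and F: "finite F" "F \<subseteq> seminorms (\<G>_inf \<Omega>)"
  then obtain u where u: "u \<in> E_M_inf \<Omega>" "U = gclass \<Omega> u" by (auto simp: carrier_\<G>_inf)
  have uM: "u \<in> E_M \<Omega>" using u(1) E_M_inf_imp_E_M by blast
  have "\<forall>P\<in>F. \<exists>L. P = P_\<G>_inf L \<and> compact L \<and> L \<subseteq> \<Omega>" using F(2) by (auto simp: \<G>_inf_def)
  then obtain L where L: "\<And>P. P \<in> F \<Longrightarrow> P = P_\<G>_inf (L P) \<and> compact (L P) \<and> L P \<subseteq> \<Omega>" by metis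
  have "compact (\<Union>P\<in>F. L P)" "(\<Union>P\<in>F. L P) \<subseteq> \<Omega>" using L F(1) by (auto intro!: compact_UN)
  then obtain \<kappa> W n where \<kappa>: "(\<lambda>_. \<kappa>) \<in> E_M_inf \<Omega>" "open W" "(\<Union>P\<in>F. L P) \<subseteq> W"
    "\<And>u. (\<lambda>\<epsilon> x. \<kappa> x * u \<epsilon> x) \<in> N_ideal (\<Omega> - K n)"
    "\<And>u. (\<lambda>\<epsilon> x. \<kappa> x * u \<epsilon> x - u \<epsilon> x) \<in> N_ideal W"
    by (rule ex_cutoff_net) (rule that; assumption)
  have w: "(\<lambda>\<epsilon> x. \<kappa> x * u \<epsilon> x) \<in> E_M_inf \<Omega>" using E_M_inf_mult[OF op \<kappa>(1) u(1)] .
  then have wM: "(\<lambda>\<epsilon> x. \<kappa> x * u \<epsilon> x) \<in> E_M \<Omega>" using E_M_inf_imp_E_M by blast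
  show "\<exists>w\<in>carrier (\<G>_inf_c \<Omega> K). \<forall>P\<in>F. P (w \<ominus>\<^bsub>\<G>_inf \<Omega>\<^esub> U) = 0"
  proof (intro bexI ballI)
    show "gclass \<Omega> (\<lambda>\<epsilon> x. \<kappa> x * u \<epsilon> x) \<in> carrier (\<G>_inf_c \<Omega> K)"
      using w \<kappa>(4) by (auto simp: carrier_\<G>_inf_c supported_def)
    have "gclass \<Omega> (\<lambda>\<epsilon> x. \<kappa> x * u \<epsilon> x) \<in> carrier (\<G>_inf \<Omega>)" using w by (simp add: carrier_\<G>_inf)
    then have minus: "gclass \<Omega> (\<lambda>\<epsilon> x. \<kappa> x * u \<epsilon> x) \<ominus>\<^bsub>\<G>_inf \<Omega>\<^esub> U = gclass \<Omega> (\<lambda>\<epsilon> x. \<kappa> x * u \<epsilon> x - u \<epsilon> x)"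
      using lc_submodule_minus[OF lc_submodule_\<G>_inf _ U] minus_gclass[OF op wM uM] by (simp add: u(2))
    fix P assume P: "P \<in> F"
    have LP: "P = P_\<G>_inf (L P)" "compact (L P)" "L P \<subseteq> \<Omega>" using L[OF P] by blast+
    have LW: "L P \<subseteq> W" using \<kappa>(3) P by blast
    have "P_\<G>_inf (L P) (gclass \<Omega> (\<lambda>\<epsilon> x. \<kappa> x * u \<epsilon> x) \<ominus>\<^bsub>\<G>_inf \<Omega>\<^esub> U) = 0"
      unfolding minus P_\<G>_inf_gclass[OF op E_M_diff[OF op wM uM] LP(2,3)]
      by (rule expnorm_ord_set_zero[OF \<kappa>(2,5) LP(2) LW])
    then show "P (gclass \<Omega> (\<lambda>\<epsilon> x. \<kappa> x * u \<epsilon> x) \<ominus>\<^bsub>\<G>_inf \<Omega>\<^esub> U) = 0"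
      by (rule trans[OF fun_cong[OF LP(1)]])
  qed
qed

end

theorem theorem3p1:
  fixes \<Omega> :: "(real^'n) set" and K :: "nat \<Rightarrow> (real^'n) set"
  assumes "open \<Omega>" and "exhausting \<Omega> K"
  shows
    "continuous_linear_embedding (\<G> \<Omega>) (dual (\<G>_c \<Omega> K))
       (\<lambda>U. \<lambda>V\<in>carrier (\<G>_c \<Omega> K). gintegral \<Omega> (gmult \<Omega> U V)) \<and>
     continuous_linear_embedding (\<G>_c \<Omega> K) (dual (\<G> \<Omega>))
       (\<lambda>U. \<lambda>V\<in>carrier (\<G> \<Omega>). gintegral \<Omega> (gmult \<Omega> U V)) \<and>
     continuous_linear_embedding (dual (\<G> \<Omega>)) (dual (\<G>_c \<Omega> K))
       (\<lambda>T. restrict T (carrier (\<G>_c \<Omega> K))) \<and>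
     continuous_linear_embedding (dual (\<G>_inf \<Omega>)) (dual (\<G>_inf_c \<Omega> K))
       (\<lambda>T. restrict T (carrier (\<G>_inf_c \<Omega> K)))"
proof -
  interpret exhausted_open \<Omega> K by (rule exhausted_open.intro[OF assms])
  show ?thesis
    by (intro conjI embedding_\<G>_into_dual_\<G>_c[unfolded pairing_def]
        embedding_\<G>_c_into_dual_\<G>[unfolded pairing_def] restriction_\<G> restriction_\<G>_inf)
qed

end
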